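(* Let $d\ge1$, $\lambda>0$, let $\mathbf{m}=(m_1,\dots,m_d)$ be a fixed multi-index with $m_j>\lambda+1$ for $j=1,\dots,d$, and let $f\in\mathcal{H}^{\mathbf{m}}(\Omega_d)$. Then there is a constant $\widehat{\mathcal{K}}$, independent of $N$ and $\mathbf{m}$, such that for all sufficiently large $N$, $$\max_{\mathbf{x}\in\Omega_d}\left|f(\mathbf{x})-\sum_{\mathbf{k}\in\Lambda_N^\infty}a_{\mathbf{k}}C_{\mathbf{k}}^{(\lambda)}(\mathbf{x})\right|\le\widehat{\mathcal{K}}\,N^{-\min_{j=1,\dots,d}\{m_j-\lambda-1\}}.$$ (Here $\widehat{\mathcal{K}}$ may depend on $f$, $\lambda$ and $d$, and how large $N$ must be may depend on $f,\lambda,d$ and $\mathbf{m}$.)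
   Context: $\Omega_d=[-1,1]^d$; $\Lambda_N^\infty=\{\mathbf{k}\in\mathbb{N}_0^d:\max_ik_i\le N\}$. For multi-indices, $\mathbf{n}\le\mathbf{m}$ is componentwise, $\mathbf{m}-1=(m_1-1,\dots,m_d-1)$, and $\partial^{\mathbf{n}}f=\frac{\partial^{n_1+\dots+n_d}f}{\partial x_1^{n_1}\cdots\partial x_d^{n_d}}$ in the distributional sense. The space is $$\mathcal{H}^{\mathbf{m}}(\Omega_d)=\{f:\ \partial^{\mathbf{n}}f\in C(\Omega_d)\ \text{for } \mathbf{0}\le\mathbf{n}\le\mathbf{m}-1,\ \partial^{\mathbf{m}}f\in L^2(\Omega_d)\}.$$ $C_n^{(\lambda)}$ is the Gegenbauer polynomial of degree $n$, orthogonal on $[-1,1]$ with respect to $\omega_\lambda(x)=(1-x^2)^{\lambda-1/2}$, normalized by $C_n^{(\lambda)}(1)=\frac{\Gamma(n+2\lambda)}{n!\,\Gamma(2\lambda)}$; $h_n^{(\lambda)}=\int_{-1}^1C_n^{(\lambda)}(x)^2\omega_\lambda(x)\,dx$. With $C_{\mathbf{k}}^{(\lambda)}(\mathbf{x})=\prod_jC_{k_j}^{(\lambda)}(x_j)$, $h_{\mathbf{k}}^{(\lambda)}=\prod_jh_{k_j}^{(\lambda)}$, $\omega_\lambda(\mathbf{x})=\prod_j\omega_\lambda(x_j)$, the multivariate Gegenbauer coefficients are $a_{\mathbf{k}}=\frac1{h_{\mathbf{k}}^{(\lambda)}}\int_{\Omega_d}f(\mathbf{x})C_{\mathbf{k}}^{(\lambda)}(\mathbf{x})\omega_\lambda(\mathbf{x})\,d\mathbf{x}$.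 *)

theory Defs
  imports "HOL-Analysis.Analysis" "HOL-Computational_Algebra.Polynomial"
begin

text \<open>The dimension \<open>d \<ge> 1\<close> is \<open>CARD('d)\<close>; multi-indices are vectors of type \<open>nat ^ 'd\<close>.\<close>

definition Omega :: "(real ^ 'd) set"
  where "Omega = cbox (\<chi> i. - 1) (\<chi> i. 1)"

definition partial_derivative :: "'d \<Rightarrow> (real ^ 'd \<Rightarrow> real) \<Rightarrow> real ^ 'd \<Rightarrow> real"
  where "partial_derivative i \<phi> x = deriv (\<lambda>t. \<phi> (x + t *\<^sub>R axis i 1)) 0"

text \<open>A function is \<open>C\<^sup>\<infinity>\<close> iff all its iterated partial derivatives exist and are (Frechet)
  differentiable everywhere; continuity of all of them follows.\<close>

definition smooth :: "(real ^ 'd \<Rightarrow> real) \<Rightarrow> bool"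
  where "smooth \<phi> \<longleftrightarrow> (\<forall>is. foldr partial_derivative is \<phi> differentiable_on UNIV)"

text \<open>Classical derivative for a multi-index. It is only applied to smooth functions, whose partial
  derivatives commute, so the order in which the directions are listed is irrelevant.\<close>

definition multi_derivative :: "nat ^ 'd \<Rightarrow> (real ^ 'd \<Rightarrow> real) \<Rightarrow> real ^ 'd \<Rightarrow> real"
  where "multi_derivative n \<phi> =
    foldr partial_derivative (SOME is. \<forall>i. count_list is i = n $ i) \<phi>"

definition test_function :: "(real ^ 'd \<Rightarrow> real) \<Rightarrow> bool"
  where "test_function \<phi> \<longleftrightarrow> smooth \<phi> \<and> closure {x. \<phi> x \<noteq> 0} \<subseteq> interior Omega"

text \<open>\<open>g\<close> represents the \<open>n\<close>-th distributional derivative of \<open>f\<close> on the interior of \<open>Omega\<close>.\<close>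

definition has_distributional_derivative ::
    "(real ^ 'd \<Rightarrow> real) \<Rightarrow> nat ^ 'd \<Rightarrow> (real ^ 'd \<Rightarrow> real) \<Rightarrow> bool"
  where "has_distributional_derivative f n g \<longleftrightarrow>
    (\<forall>\<phi>. test_function \<phi> \<longrightarrow>
      (LINT x:Omega|lborel. f x * multi_derivative n \<phi> x) =
      (- 1) ^ (\<Sum>i\<in>UNIV. n $ i) * (LINT x:Omega|lborel. g x * \<phi> x))"

definition square_integrable_on_Omega :: "(real ^ 'd \<Rightarrow> real) \<Rightarrow> bool"
  where "square_integrable_on_Omega g \<longleftrightarrow>
    set_borel_measurable lborel Omega g \<and> set_integrable lborel Omega (\<lambda>x. (g x)\<^sup>2)"

text \<open>Elements are honest functions, so \<open>f\<close> itself (and not merely some function equal to it almost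
  everywhere) is required to be continuous. The condition \<open>n \<le> m - 1\<close> is written as
  \<open>n $ i < m $ i\<close> to avoid truncated subtraction.\<close>

definition H_space :: "nat ^ 'd \<Rightarrow> (real ^ 'd \<Rightarrow> real) set"
  where "H_space m =
    {f. continuous_on Omega f \<and>
        (\<forall>n. (\<forall>i. n $ i < m $ i) \<longrightarrow>
          (\<exists>g. continuous_on Omega g \<and> has_distributional_derivative f n g)) \<and>
        (\<exists>g. square_integrable_on_Omega g \<and> has_distributional_derivative f m g)}"

definition gweight :: "real \<Rightarrow> real \<Rightarrow> real"
  where "gweight lam x = (1 - x\<^sup>2) powr (lam - 1/2)"

definition gegenbauer :: "real \<Rightarrow> nat \<Rightarrow> real poly"
  where "gegenbauer lam n = (THE p.
    degree p = n \<and>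
    (\<forall>q. degree q < n \<longrightarrow>
      (LINT x:{-1..1}|lborel. poly p x * poly q x * gweight lam x) = 0) \<and>
    poly p 1 = Gamma (real n + 2 * lam) / (fact n * Gamma (2 * lam)))"

definition gnorm :: "real \<Rightarrow> nat \<Rightarrow> real"
  where "gnorm lam n = (LINT x:{-1..1}|lborel. (poly (gegenbauer lam n) x)\<^sup>2 * gweight lam x)"

definition multi_gweight :: "real \<Rightarrow> real ^ 'd \<Rightarrow> real"
  where "multi_gweight lam x = (\<Prod>j\<in>UNIV. gweight lam (x $ j))"

definition multi_gegenbauer :: "real \<Rightarrow> nat ^ 'd \<Rightarrow> real ^ 'd \<Rightarrow> real"
  where "multi_gegenbauer lam k x = (\<Prod>j\<in>UNIV. poly (gegenbauer lam (k $ j)) (x $ j))"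

definition multi_gnorm :: "real \<Rightarrow> nat ^ 'd \<Rightarrow> real"
  where "multi_gnorm lam k = (\<Prod>j\<in>UNIV. gnorm lam (k $ j))"

definition gegenbauer_coeff :: "real \<Rightarrow> (real ^ 'd \<Rightarrow> real) \<Rightarrow> nat ^ 'd \<Rightarrow> real"
  where "gegenbauer_coeff lam f k =
    1 / multi_gnorm lam k *
    (LINT x:Omega|lborel. f x * multi_gegenbauer lam k x * multi_gweight lam x)"

definition Lambda_inf :: "nat \<Rightarrow> (nat ^ 'd) set"
  where "Lambda_inf N = {k. (MAX i. k $ i) \<le> N}"

end

theory Submission
  imports Defs
begin

text \<open>
  In one variable, combine Jackson's theorem (polynomials of degree \<open>N\<close> approximate a \<open>C\<^sup>r\<close> function up to
  \<open>O(N\<^sup>-\<^sup>r)\<close>) with the bound \<open>O(N\<^sup>\<lambda>)\<close> for the Lebesgue constant of Gegenbauer partial sums; the latter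
  follows from the Christoffel--Darboux formula and the bound
  \<open>\<bar>C\<^sub>n(cos \<theta>)\<bar> = O(C\<^sub>n(1) min(1, (n sin \<theta>)\<^sup>-\<^sup>\<lambda>))\<close>, an energy estimate for the Gegenbauer equation.
  With \<open>r = m - 1\<close> this gives \<open>N\<close> to the power \<open>\<lambda> + 1 - m\<close>.

  In several variables write \<open>S\<^sub>i\<close> for the partial sum operator in the \<open>i\<close>-th variable and \<open>T\<^sub>i = 1 - S\<^sub>i\<close>. Then
  \<open>f - S\<^sub>A S\<^sub>i f = (f - S\<^sub>A f) + T\<^sub>i f - (T\<^sub>i f - S\<^sub>A T\<^sub>i f)\<close>, and \<open>T\<^sub>i f\<close> inherits the mixed derivatives of \<open>f\<close> in the
  other variables with no growth in \<open>N\<close>, so an induction on the number of variables loses no power of \<open>N\<close>.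
  Only the continuous derivatives of order at most \<open>m - 1\<close> enter: for \<open>d \<ge> 2\<close> the derivative of order \<open>m\<close> gives
  nothing more, as it vanishes for every function of fewer variables.

  Uniformity of the constant in \<open>m\<close> is free: use the constant belonging to an admissible \<open>m\<close> with the largest
  \<open>min\<^sub>j m\<^sub>j\<close>, or \<open>1\<close> if these minima are unbounded, since then the next larger one has a spare factor \<open>1/N\<close>.
\<close>

text \<open>Each one-variable projection costs a factor N^\<lambda>, and composing d of them naively
  would multiply these losses. The decomposition avoids this because in a mixed error term one of
  the factors is only asked to be bounded, N^(\<lambda> - r_i) \<le> 1 with r_i = m_i - 1, and this
  is where m_i > \<lambda> + 1 enters. It forces two features on the proof: the one-variable
  estimate must have constants uniform in the function, and the functions must come with all their
  mixed derivatives, classical and continuous up to the boundary, so that the one-variable errors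
  stay in the same class. The iterated projections are identified with the partial sum over
  \<open>Lambda_inf N\<close> on sums of products of one-variable functions, where all integrals
  factor; density and boundedness for fixed N carry this over to continuous functions. The
  polynomials are normalized to the value 1 at 1. The factor relating them to the usual Gegenbauer
  polynomials cancels between a_k and C_k.\<close>

section \<open>Normalized Gegenbauer polynomials\<close>

text \<open>The Gegenbauer polynomial divided by its value at 1, generated by a first-order raising
  operator instead of orthogonality. The values at 1 and -1 are then immediate, since the term with
  1 - x^2 drops out there, and the differential equation becomes accessible to induction.\<close>

primrec ngeg :: "real \<Rightarrow> nat \<Rightarrow> real poly" where
  "ngeg l 0 = 1"
| "ngeg l (Suc n) = [:0, 1:] * ngeg l n
     - smult (1 / (real n + 2 * l)) ([:1, 0, -1:] * pderiv (ngeg l n))"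

abbreviation ng :: "real \<Rightarrow> nat \<Rightarrow> real \<Rightarrow> real" where
  "ng l n x \<equiv> poly (ngeg l n) x"

abbreviation ngd :: "real \<Rightarrow> nat \<Rightarrow> real \<Rightarrow> real" where
  "ngd l n x \<equiv> poly (pderiv (ngeg l n)) x"

lemma poly_eqI_real: "(\<And>x. poly p x = poly q x) \<Longrightarrow> p = (q :: real poly)"
  using poly_eq_poly_eq_iff[of p q] by (auto simp: fun_eq_iff)

lemma ng_Suc: "ng l (Suc n) x = x * ng l n x - (1 - x\<^sup>2) * ngd l n x / (real n + 2 * l)"
  by (simp add: power2_eq_square diff_divide_distrib algebra_simps)

lemma ng_1: "ng l n 1 = 1"
  by (induction n) (simp_all add: ng_Suc del: ngeg.simps(2))

lemma ng_minus_1: "ng l n (-1) = (-1) ^ n"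
  by (induction n) (simp_all add: ng_Suc del: ngeg.simps(2))

text \<open>One step multiplies the top coefficient by 1 + n / (n + 2 l): both contributions are
  nonnegative, so there is no cancellation and the degree is exactly n.\<close>

lemma ngeg_degree_coeff:
  assumes "l > 0"
  shows "degree (ngeg l n) \<le> n \<and> coeff (ngeg l n) n > 0"
proof (induction n)
  case (Suc n)
  let ?p = "ngeg l n"
  have d: "degree ([:0, 1:] * ?p) \<le> Suc n" 
    using degree_mult_le[of "[:0,1:]" ?p] Suc by simp
  have d1: "degree (pderiv ?p) \<le> n - 1" using Suc by (simp add: degree_pderiv diff_le_mono)
  have d2: "degree ([:1, 0, -1:] * pderiv ?p) \<le> Suc n"
  proof (cases n)
    case 0 then have "degree ?p = 0" using Suc by simp
    then have "pderiv ?p = 0" by (simp add: pderiv_eq_0_iff)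
    then show ?thesis by simp
  next
    case (Suc k) then show ?thesis 
      using degree_mult_le[of "[:1,0,-1::real:]" "pderiv ?p"] d1 by simp
  qed
  have deg: "degree (ngeg l (Suc n)) \<le> Suc n" unfolding ngeg.simps
    by (intro degree_diff_le d order_trans[OF degree_smult_le] d2)
  have c: "coeff ([:1, 0, -1:] * pderiv ?p) (Suc n) = - (real n * coeff ?p n)"
  proof (cases n)
    case 0 then have "degree ?p = 0" using Suc by simp
    then have "pderiv ?p = 0" by (simp add: pderiv_eq_0_iff)
    with 0 show ?thesis by simp
  next
    case (Suc k)
    have "coeff (pderiv ?p) (Suc n) = 0" using d1 by (intro coeff_eq_0) auto
    moreover have "coeff (pderiv ?p) k = real n * coeff ?p n" by (simp add: coeff_pderiv Suc)
    ultimately show ?thesis by (simp add: Suc)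
  qed
  have "coeff (ngeg l (Suc n)) (Suc n) = coeff ?p n + real n * coeff ?p n / (real n + 2 * l)"
  proof -
    have "coeff ([:0, 1:] * ?p) (Suc n) = coeff ?p n" by simp
    then show ?thesis unfolding ngeg.simps coeff_diff coeff_smult c by simp
  qed
  also have "\<dots> > 0" using Suc assms by (intro add_pos_nonneg) (auto intro!: divide_nonneg_pos)
  finally show ?case using deg by simp
qed simp

lemma degree_ngeg: "l > 0 \<Longrightarrow> degree (ngeg l n) = n"
  using ngeg_degree_coeff[of l n] le_degree[of "ngeg l n" n] by fastforce

text \<open>The differential equation and the lowering relation feed each other. Differentiating the
  lowering relation and eliminating the derivative of the older polynomial gives the equation for
  the next index; inserting that equation into the differentiated raising formula gives the next
  lowering relation.\<close>

lemma ngeg_identities: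
  assumes l: "l > 0"
  defines "W \<equiv> [:1, 0, -1 :: real:]" and "X \<equiv> [:0, 1 :: real:]"
  shows "W * pderiv (pderiv (ngeg l n)) = 
          smult (2 * l + 1) (X * pderiv (ngeg l n)) - smult (real n * (real n + 2 * l)) (ngeg l n) \<and>
         W * pderiv (ngeg l (Suc n)) = smult (real (Suc n)) (ngeg l n - X * ngeg l (Suc n))"
proof (induction n)
  case 0
  have "ngeg l (Suc 0) = X" by (simp add: X_def)
  then show ?case by (simp add: W_def X_def pderiv_pCons one_pCons del: ngeg.simps(2))
next
  case (Suc n)
  let ?q = "ngeg l n" and ?r = "ngeg l (Suc n)"
  define N where "N = real n"
  have N: "N + 2 * l > 0" "N + 1 > 0" "real (Suc n) = N + 1" "real n = N" "N + 1 + 2 * l > 0"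
    using l by (auto simp: N_def)
  have ode: "(1 - x\<^sup>2) * poly (pderiv (pderiv ?q)) x = (2 * l + 1) * (x * ngd l n x) - N * (N + 2 * l) * ng l n x" for x
    using arg_cong[OF conjunct1[OF Suc], of "\<lambda>p. poly p x"]
    by (simp add: W_def X_def N_def power2_eq_square algebra_simps)
  have d1: "(1 - x\<^sup>2) * ngd l (Suc n) x = (N + 1) * (ng l n x - x * ng l (Suc n) x)" for x
    using arg_cong[OF conjunct2[OF Suc], of "\<lambda>p. poly p x"]
    by (simp add: W_def X_def N_def power2_eq_square algebra_simps del: ngeg.simps)
  have d2: "(N + 2 * l) * ng l (Suc n) x = (N + 2 * l) * (x * ng l n x) - (1 - x\<^sup>2) * ngd l n x" for x
    using N by (simp add: ng_Suc field_simps del: ngeg.simps)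
  have d2p: "smult (N + 2 * l) ?r = smult (N + 2 * l) (X * ?q) - W * pderiv ?q"
    by (rule poly_eqI_real) (use d2 in \<open>simp add: W_def X_def power2_eq_square algebra_simps del: ngeg.simps\<close>)
  have R: "(N + 2 * l) * ngd l (Suc n) x = (N + 1) * (N + 2 * l) * ng l n x + (N + 1) * (x * ngd l n x)" for x
  proof -
    have "(N + 2 * l) * ngd l (Suc n) x = (N + 2 * l) * (ng l n x + x * ngd l n x) 
       + 2 * x * ngd l n x - (1 - x\<^sup>2) * poly (pderiv (pderiv ?q)) x"
      using arg_cong[OF d2p, of "\<lambda>p. poly (pderiv p) x"]
      by (simp add: pderiv_smult pderiv_add pderiv_minus pderiv_diff pderiv_mult W_def X_def pderiv_pCons 
          power2_eq_square algebra_simps del: ngeg.simps)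
    also have "\<dots> = (N + 1) * (N + 2 * l) * ng l n x + (N + 1) * (x * ngd l n x)"
      unfolding ode by (simp add: algebra_simps)
    finally show ?thesis .
  qed
  \<comment> \<open>When \<open>R\<close> and \<open>d2\<close> are combined, x^2 and 1 - x^2 times
    the derivative of the older polynomial add up to that derivative, so no division by 1 - x^2
    occurs.\<close>
  have S: "(N + 1) * ngd l n x = (N + 2 * l) * (x * ngd l (Suc n) x - (N + 1) * ng l (Suc n) x)" for x
    using R[of x] d2[of x] by algebra
  have ode': "(1 - x\<^sup>2) * poly (pderiv (pderiv ?r)) x = (2 * l + 1) * (x * ngd l (Suc n) x) 
      - (N + 1) * (N + 1 + 2 * l) * ng l (Suc n) x" for x
  proof -
    have "(1 - x\<^sup>2) * poly (pderiv (pderiv ?r)) x - 2 * x * ngd l (Suc n) x 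
       = (N + 1) * (ngd l n x - ng l (Suc n) x - x * ngd l (Suc n) x)"
      using arg_cong[OF conjunct2[OF Suc], of "\<lambda>p. poly (pderiv p) x"]
      by (simp add: pderiv_smult pderiv_add pderiv_minus pderiv_diff pderiv_mult W_def X_def pderiv_pCons N_def
          power2_eq_square algebra_simps del: ngeg.simps)
    then show ?thesis using S[of x] by algebra
  qed
  have d2': "(N + 1 + 2 * l) * ng l (Suc (Suc n)) x = (N + 1 + 2 * l) * (x * ng l (Suc n) x) - (1 - x\<^sup>2) * ngd l (Suc n) x" for x
  proof -
    have "ng l (Suc (Suc n)) x = x * ng l (Suc n) x - (1 - x\<^sup>2) * ngd l (Suc n) x / (N + 1 + 2 * l)"
      using ng_Suc[of l "Suc n" x] unfolding N(3) .
    then show ?thesis using N(5) by (simp add: field_simps del: ngeg.simps)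
  qed
  have d2p': "smult (N + 1 + 2 * l) (ngeg l (Suc (Suc n))) = smult (N + 1 + 2 * l) (X * ?r) - W * pderiv ?r"
    by (rule poly_eqI_real) (use d2' in \<open>simp add: W_def X_def power2_eq_square algebra_simps del: ngeg.simps\<close>)
  have R': "(N + 1 + 2 * l) * ngd l (Suc (Suc n)) x = (N + 2) * (N + 1 + 2 * l) * ng l (Suc n) x + (N + 2) * (x * ngd l (Suc n) x)" for x
  proof -
    have "(N + 1 + 2 * l) * ngd l (Suc (Suc n)) x = (N + 1 + 2 * l) * (ng l (Suc n) x + x * ngd l (Suc n) x) 
       + 2 * x * ngd l (Suc n) x - (1 - x\<^sup>2) * poly (pderiv (pderiv ?r)) x"
      using arg_cong[OF d2p', of "\<lambda>p. poly (pderiv p) x"]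
      by (simp add: pderiv_smult pderiv_add pderiv_minus pderiv_diff pderiv_mult W_def X_def pderiv_pCons 
          power2_eq_square algebra_simps del: ngeg.simps)
    also have "\<dots> = (N + 2) * (N + 1 + 2 * l) * ng l (Suc n) x + (N + 2) * (x * ngd l (Suc n) x)"
      unfolding ode' by (simp add: algebra_simps del: ngeg.simps)
    finally show ?thesis .
  qed
  have d1': "(1 - x\<^sup>2) * ngd l (Suc (Suc n)) x = (N + 2) * (ng l (Suc n) x - x * ng l (Suc (Suc n)) x)" for x
  proof -
    have "(N + 1 + 2 * l) * ((1 - x\<^sup>2) * ngd l (Suc (Suc n)) x) = 
          (N + 1 + 2 * l) * ((N + 2) * (ng l (Suc n) x - x * ng l (Suc (Suc n)) x))"
      using R'[of x] d2'[of x] by algebra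
    then show ?thesis using N by simp
  qed
  show ?case
  proof
    show "W * pderiv (pderiv ?r) = 
          smult (2 * l + 1) (X * pderiv ?r) - smult (real (Suc n) * (real (Suc n) + 2 * l)) ?r"
      by (rule poly_eqI_real) (use ode' in \<open>simp add: W_def X_def N_def power2_eq_square algebra_simps del: ngeg.simps\<close>)
    show "W * pderiv (ngeg l (Suc (Suc n))) = smult (real (Suc (Suc n))) (?r - X * ngeg l (Suc (Suc n)))"
      by (rule poly_eqI_real) (use d1' in \<open>simp add: W_def X_def N_def power2_eq_square algebra_simps del: ngeg.simps\<close>)
  qed
qed

declare ngeg.simps(2)[simp del]

section \<open>Evaluated identities, three-term recurrence and parity\<close>

lemma ng_ode:
  assumes "l > 0"
  shows "(1 - x\<^sup>2) * poly (pderiv (pderiv (ngeg l n))) x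
    = (2 * l + 1) * x * ngd l n x - real n * (real n + 2 * l) * ng l n x"
  using arg_cong[OF conjunct1[OF ngeg_identities[OF assms, of n]], of "\<lambda>p. poly p x"]
  by (simp add: power2_eq_square algebra_simps)

lemma ngd_Suc:
  assumes "l > 0"
  shows "(1 - x\<^sup>2) * ngd l (Suc n) x = real (Suc n) * (ng l n x - x * ng l (Suc n) x)"
  using arg_cong[OF conjunct2[OF ngeg_identities[OF assms, of n]], of "\<lambda>p. poly p x"]
  by (simp add: power2_eq_square algebra_simps)

lemma ngd_eq:
  assumes "l > 0"
  shows "(1 - x\<^sup>2) * ngd l n x = (real n + 2 * l) * (x * ng l n x - ng l (Suc n) x)"
proof -
  have "real n + 2 * l > 0" using assms by (simp add: add_nonneg_pos)
  then show ?thesis by (simp add: ng_Suc field_simps)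
qed

lemma ng_three_term:
  assumes "l > 0"
  shows "2 * (real (Suc n) + l) * (x * ng l (Suc n) x) 
     = (real (Suc n) + 2 * l) * ng l (Suc (Suc n)) x + real (Suc n) * ng l n x"
  using ngd_Suc[OF assms, of x n] ngd_eq[OF assms, of x "Suc n"] by (simp add: algebra_simps)

lemma ng_three_term_0: "l > 0 \<Longrightarrow> 2 * l * (x * ng l 0 x) = 2 * l * ng l (Suc 0) x"
  by (simp add: ng_Suc)

lemma ng_parity:
  assumes "l > 0"
  shows "ng l n (-x) = (-1) ^ n * ng l n x"
proof (induction n rule: less_induct)
  case (less n)
  consider "n = 0" | "n = 1" | k where "n = Suc (Suc k)" by (metis One_nat_def not0_implies_Suc)
  then show ?case
  proof cases
    case 3
    have "real (Suc k) + 2 * l > 0" using assms by (simp add: add_pos_pos)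
    moreover have e: "ng l k (-x) = (-1) ^ k * ng l k x" "ng l (Suc k) (-x) = - ((-1) ^ k * ng l (Suc k) x)"
      using less[of k] less[of "Suc k"] 3 by auto
    have "(real (Suc k) + 2 * l) * ng l n (-x) = (-1) ^ k * 
        (2 * (real (Suc k) + l) * (x * ng l (Suc k) x) - real (Suc k) * ng l k x)"
      using ng_three_term[OF assms, of k "-x"] 3 unfolding e by (simp add: algebra_simps)
    then have "(real (Suc k) + 2 * l) * ng l n (-x) = (real (Suc k) + 2 * l) * ((-1) ^ n * ng l n x)"
      using ng_three_term[OF assms, of k x] 3 by simp
    ultimately show ?thesis by simp
  qed (simp_all add: ng_Suc)
qed

section \<open>Pointwise bounds from the differential equation\<close>

text \<open>By the differential equation the left-hand side has derivative 4 l x p'^2. It therefore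
  increases on [0,1] and decreases on [-1,0], and at both endpoints it equals the right-hand
  side.\<close>

lemma ng_energy:
  assumes l: "l > 0" and x: "x \<in> {-1..1}"
  shows "real n * (real n + 2 * l) * (ng l n x)\<^sup>2 + (1 - x\<^sup>2) * (ngd l n x)\<^sup>2 \<le> real n * (real n + 2 * l)"
proof -
  define \<nu> where "\<nu> = real n * (real n + 2 * l)"
  define G where "G = (\<lambda>x. \<nu> * (ng l n x)\<^sup>2 + (1 - x\<^sup>2) * (ngd l n x)\<^sup>2)"
  have G': "(G has_real_derivative 4 * l * (ngd l n x)\<^sup>2 * x) (at x)" for x
  proof -
    have "(G has_real_derivative 2 * \<nu> * ng l n x * ngd l n x - 2 * x * (ngd l n x)\<^sup>2 
         + 2 * ngd l n x * ((1 - x\<^sup>2) * poly (pderiv (pderiv (ngeg l n))) x)) (at x)"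
      unfolding G_def by (auto intro!: derivative_eq_intros poly_DERIV simp: power2_eq_square algebra_simps)
    then show ?thesis unfolding ng_ode[OF l] by (simp add: \<nu>_def power2_eq_square algebra_simps)
  qed
  have "G x \<le> \<nu>"
  proof (cases "x \<ge> 0")
    case True
    have "G x \<le> G 1" 
    proof (rule DERIV_nonneg_imp_nondecreasing[where f = G and a = x and b = 1])
      show "x \<le> 1" using x by simp
    next
      fix y assume "x \<le> y" "y \<le> 1"
      then have "4 * l * (ngd l n y)\<^sup>2 * y \<ge> 0" using True l by (intro mult_nonneg_nonneg) auto
      then show "\<exists>z. (G has_real_derivative z) (at y) \<and> z \<ge> 0" using G' by blast
    qed
    also have "G 1 = \<nu>" by (simp add: G_def ng_1)
    finally show ?thesis .
  next
    case False
    have "G x \<le> G (-1)"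
    proof (rule DERIV_nonpos_imp_nonincreasing[where f = G and a = "-1" and b = x])
      show "-1 \<le> x" using x by simp
      fix y assume "-1 \<le> y" "y \<le> x"
      then have "4 * l * (ngd l n y)\<^sup>2 * y \<le> 0" using False l by (intro mult_nonneg_nonpos) auto
      then show "\<exists>z. (G has_real_derivative z) (at y) \<and> z \<le> 0" using G' by blast
    qed
    also have "G (-1) = \<nu>" by (simp add: G_def ng_minus_1 power_mult_distrib flip: power_mult)
    finally show ?thesis .
  qed
  then show ?thesis by (simp add: G_def \<nu>_def)
qed

text \<open>This is a \<le> artanh a, the sharp comparison behind the decay of the values at the
  origin. The difference (1 + a) e^(-a) - (1 - a) e^a vanishes at 0 and has derivative a (e^a -
  e^(-a)).\<close>

lemma one_plus_exp_le:
  fixes a :: real assumes "0 \<le> a" "a < 1"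
  shows "exp (2 * a) \<le> (1 + a) / (1 - a)"
proof -
  define h where "h = (\<lambda>a::real. (1 + a) * exp (- a) - (1 - a) * exp a)"
  have "h 0 \<le> h a"
  proof (rule DERIV_nonneg_imp_nondecreasing[OF assms(1)])
    fix x :: real assume x: "0 \<le> x"
    have "(h has_real_derivative x * (exp x - exp (- x))) (at x)"
      unfolding h_def by (auto intro!: derivative_eq_intros simp: algebra_simps)
    moreover have "x * (exp x - exp (- x)) \<ge> 0" using x by (intro mult_nonneg_nonneg) auto
    ultimately show "\<exists>y. (h has_real_derivative y) (at x) \<and> 0 \<le> y" by blast
  qed
  then have "(1 - a) * exp a \<le> (1 + a) * exp (- a)" by (simp add: h_def)
  then have "(1 - a) * exp a * exp a \<le> (1 + a) * exp (- a) * exp a"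
    by (rule mult_right_mono) simp
  also have "\<dots> = 1 + a" by (simp add: exp_minus)
  finally show ?thesis using assms by (simp add: field_simps mult_exp_exp flip: exp_double)
qed

text \<open>At x = 0 the recurrence loses its middle term and becomes a two-step product with ratios
  m / (m + 2 l), m = k + 1. These values supply the initial energy at \<theta> = pi/2 for the bounds
  below.\<close>

lemma ng_at_0_le:
  assumes l: "l > 0"
  shows "\<bar>ng l n 0\<bar> \<le> ((1 + l) / (real n + 1 + l)) powr l"
proof (induction n rule: less_induct)
  case (less n)
  consider "n = 0" | "n = 1" | k where "n = Suc (Suc k)" by (metis One_nat_def not0_implies_Suc)
  then show ?case
  proof cases
    case 3
    define m where "m = real (Suc k)"
    have m: "m \<ge> 1" "real n = m + 1" "real k = m - 1" by (auto simp: m_def 3)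
    have eq: "(m + 2 * l) * ng l n 0 = - m * ng l k 0"
      using ng_three_term[OF l, of k 0] 3 unfolding m_def by (simp add: algebra_simps)
    \<comment> \<open>With this \<open>a\<close> the quotient (1 + a) / (1 - a) is exactly the
      inverse (m + 2 l) / m of the recurrence ratio, and 2 a is the exponent 2 l / (m + l) of the
      preceding estimate.\<close>
    define a where "a = l / (m + l)"
    have a: "0 \<le> a" "a < 1" using l m by (auto simp: a_def field_simps)
    have "((m + 2 + l) / (m + l)) powr l = exp (l * ln (1 + 2 / (m + l)))"
      using l m by (simp add: powr_def field_simps)
    also have "\<dots> \<le> exp (l * (2 / (m + l)))"
      using l m by (intro exp_mono mult_left_mono ln_add_one_self_le_self) auto
    also have "\<dots> = exp (2 * a)" by (simp add: a_def)
    also have "\<dots> \<le> (1 + a) / (1 - a)" by (rule one_plus_exp_le[OF a])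
    also have "\<dots> = (m + 2 * l) / m" 
    proof -
      have "1 + a = (m + 2 * l) / (m + l)" "1 - a = m / (m + l)" using l m by (auto simp: a_def field_simps)
      then show ?thesis using l m by simp
    qed
    finally have *: "((m + 2 + l) / (m + l)) powr l \<le> (m + 2 * l) / m" .
    have "\<bar>ng l n 0\<bar> = m / (m + 2 * l) * \<bar>ng l k 0\<bar>"
    proof -
      have "ng l n 0 = - m * ng l k 0 / (m + 2 * l)" using eq l m by (simp add: field_simps)
      then show ?thesis using l m by (simp add: abs_mult)
    qed
    also have "\<dots> \<le> m / (m + 2 * l) * ((1 + l) / (m + l)) powr l"
      using less[of k] 3 l m by (intro mult_left_mono) auto
    also have "((1 + l) / (m + l)) powr l = ((1 + l) / (m + 2 + l)) powr l * ((m + 2 + l) / (m + l)) powr l"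
      using l m by (subst powr_mult[symmetric]) auto
    also have "m / (m + 2 * l) * \<dots> \<le> m / (m + 2 * l) * (((1 + l) / (m + 2 + l)) powr l * ((m + 2 * l) / m))"
      using l m by (intro mult_left_mono *) auto
    also have "\<dots> = (m / (m + 2 * l) * ((m + 2 * l) / m)) * ((1 + l) / (m + 2 + l)) powr l"
      by (simp only: mult_ac)
    also have "m / (m + 2 * l) * ((m + 2 * l) / m) = 1" using l m by simp
    also have "1 * ((1 + l) / (m + 2 + l)) powr l = ((1 + l) / (real n + 1 + l)) powr l" 
      using m by (simp add: add_ac)
    finally show ?thesis .
  qed (use l in \<open>simp_all add: ng_Suc\<close>)
qed

text \<open>In the variable \<open>\<theta>\<close> with \<open>x = cos \<theta>\<close>, the function \<open>u = sin\<^sup>l \<theta> C\<^sub>n(cos \<theta>)\<close> satisfies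
  \<open>u'' + Q u = 0\<close> with \<open>Q = (n + l)\<^sup>2 + l (1 - l) / sin\<^sup>2 \<theta>\<close>. The quantity \<open>(1 - x\<^sup>2)\<^sup>l B\<close> below is \<open>u'\<^sup>2 + Q u\<^sup>2\<close>;
  an exponential factor makes it monotone as long as \<open>n sin \<theta>\<close> is bounded away from 0.\<close>

lemma ng_local_energy:
  assumes l: "l > 0" and n: "n \<ge> 1" and x: "0 \<le> x" "x < 1" 
    and W: "real n ^ 2 * (1 - x\<^sup>2) \<ge> 2 * l\<^sup>2 + 1"
  defines "B \<equiv> \<lambda>x. real n * (real n + 2 * l) * (ng l n x)\<^sup>2 - 2 * l * x * ng l n x * ngd l n x
     + (1 - x\<^sup>2) * (ngd l n x)\<^sup>2 + l * (ng l n x)\<^sup>2 / (1 - x\<^sup>2)"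
  shows "(1 - x\<^sup>2) powr l * B x \<le> exp (2 * l * \<bar>1 - l\<bar>) * B 0"
    and "real n ^ 2 * (ng l n x)\<^sup>2 / 2 \<le> B x"
    and "(l * x * ng l n x - (1 - x\<^sup>2) * ngd l n x)\<^sup>2 / (1 - x\<^sup>2) \<le> B x"
proof -
  define \<nu> where "\<nu> = real n * (real n + 2 * l)"
  define \<kappa> where "\<kappa> = 2 * l * \<bar>1 - l\<bar> / real n ^ 2"
  have \<kappa>0: "\<kappa> \<ge> 0" using l by (simp add: \<kappa>_def)
  have n0: "real n \<ge> 1" using n by simp
  have WW: "1 - y\<^sup>2 > 0" "real n ^ 2 * (1 - y\<^sup>2) \<ge> 2 * l\<^sup>2 + 1" if "0 \<le> y" "y \<le> x" for y
  proof -
    have le: "1 - x\<^sup>2 \<le> 1 - y\<^sup>2" using that by (simp add: power_mono)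
    moreover have "x\<^sup>2 < 1" using x by (simp add: power2_less_1_iff abs_less_iff)
    ultimately show "1 - y\<^sup>2 > 0" by linarith
    show "real n ^ 2 * (1 - y\<^sup>2) \<ge> 2 * l\<^sup>2 + 1" 
      using W mult_left_mono[OF le, of "real n ^ 2"] by auto
  qed
  \<comment> \<open>The positive form of the energy: the first square is \<open>u'^2\<close> and the
    second term \<open>Q u^2\<close>, both divided by (1 - y^2)^l. Positivity cannot be read off the
    definition of \<open>B\<close>.\<close>
  have Bsq: "B y = ((l * y * ng l n y - (1 - y\<^sup>2) * ngd l n y)\<^sup>2) / (1 - y\<^sup>2) 
       + ((real n + l)\<^sup>2 + l * (1 - l) / (1 - y\<^sup>2)) * (ng l n y)\<^sup>2" if "0 \<le> y" "y \<le> x" for y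
  proof -
    have "(1 - y\<^sup>2) * B y = (1 - y\<^sup>2) * (((l * y * ng l n y - (1 - y\<^sup>2) * ngd l n y)\<^sup>2) / (1 - y\<^sup>2) 
       + ((real n + l)\<^sup>2 + l * (1 - l) / (1 - y\<^sup>2)) * (ng l n y)\<^sup>2)"
      using WW(1)[OF that] by (simp add: B_def divide_simps) algebra
    then show ?thesis using WW(1)[OF that] by simp
  qed
  \<comment> \<open>For l > 1 the second term of \<open>Q\<close> is negative; the threshold 2 l^2 +
    1 in the hypothesis \<open>W\<close> keeps it from using up more than half of n^2.\<close>
  have Q: "(real n + l)\<^sup>2 + l * (1 - l) / (1 - y\<^sup>2) \<ge> real n ^ 2 / 2" if y: "0 \<le> y" "y \<le> x" for y
  proof -
    have "l * (l - 1) \<le> l\<^sup>2" using l by (simp add: power2_eq_square algebra_simps)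
    also have "\<dots> \<le> real n ^ 2 * (1 - y\<^sup>2) / 2" using WW(2)[OF y] by linarith
    finally have "l * (l - 1) / (1 - y\<^sup>2) \<le> real n ^ 2 / 2"
      using WW(1)[OF y] by (simp add: field_simps)
    moreover have "l * (1 - l) / (1 - y\<^sup>2) = - (l * (l - 1) / (1 - y\<^sup>2))" 
      unfolding minus_divide_left by (simp add: algebra_simps)
    moreover have "(real n + l)\<^sup>2 \<ge> real n ^ 2" using l by (intro power_mono) auto
    ultimately show ?thesis by linarith
  qed
  have B1: "real n ^ 2 * (ng l n y)\<^sup>2 / 2 \<le> B y" if y: "0 \<le> y" "y \<le> x" for y
  proof -
    have "real n ^ 2 / 2 * (ng l n y)\<^sup>2 \<le> ((real n + l)\<^sup>2 + l * (1 - l) / (1 - y\<^sup>2)) * (ng l n y)\<^sup>2"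
      by (rule mult_right_mono[OF Q[OF y]]) simp
    moreover have "((l * y * ng l n y - (1 - y\<^sup>2) * ngd l n y)\<^sup>2) / (1 - y\<^sup>2) \<ge> 0"
      using WW(1)[OF y] by simp
    moreover have "real n ^ 2 * (ng l n y)\<^sup>2 / 2 = real n ^ 2 / 2 * (ng l n y)\<^sup>2" by simp
    ultimately show ?thesis unfolding Bsq[OF y] by linarith
  qed
  show "real n ^ 2 * (ng l n x)\<^sup>2 / 2 \<le> B x" using B1 x by simp
  have "0 \<le> real n ^ 2 / 2 * (ng l n x)\<^sup>2" by simp
  also have "\<dots> \<le> ((real n + l)\<^sup>2 + l * (1 - l) / (1 - x\<^sup>2)) * (ng l n x)\<^sup>2"
      by (rule mult_right_mono[OF Q]) (use x in auto)
  finally show "(l * x * ng l n x - (1 - x\<^sup>2) * ngd l n x)\<^sup>2 / (1 - x\<^sup>2) \<le> B x"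
    using Bsq[of x] x by simp
  \<comment> \<open>The derivative of (1 - y^2)^l B has the sign of l (1 - l). The exponential
    factor, with \<kappa> tuned to n^2 p^2 / 2 \<le> B, outweighs it in either case. It costs at
    most exp (2 l |1 - l|), because n^2 (1 - y^2) \<ge> 1.\<close>
  define G where "G = (\<lambda>y. (1 - y\<^sup>2) powr l * B y * exp (- \<kappa> / (1 - y\<^sup>2)))"
  have G': "(G has_real_derivative (1 - y\<^sup>2) powr l * exp (- \<kappa> / (1 - y\<^sup>2)) * 
      (2 * y / (1 - y\<^sup>2)\<^sup>2 * (l * (1 - l) * (ng l n y)\<^sup>2 - \<kappa> * B y))) (at y)" if y: "0 \<le> y" "y \<le> x" for y
  proof -
    define w where "w = 1 - y\<^sup>2"
    have w: "w > 0" using WW(1)[OF y] by (simp add: w_def)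
    define q where "q = ng l n y"
    define d where "d = ngd l n y"
    define e where "e = poly (pderiv (pderiv (ngeg l n))) y"
    have ode: "w * e = (2 * l + 1) * y * d - \<nu> * q" 
      using ng_ode[OF l, of y n] by (simp add: w_def q_def d_def e_def \<nu>_def)
    define B' where "B' = 2 * \<nu> * q * d - 2 * l * q * d - 2 * l * y * d\<^sup>2 - 2 * l * y * q * e
        - 2 * y * d\<^sup>2 + 2 * d * (w * e) + 2 * l * q * d / w + 2 * l * y * q\<^sup>2 / w\<^sup>2"
    have D: "((\<lambda>y. l * (ng l n y)\<^sup>2 / (1 - y\<^sup>2)) has_real_derivative 
        (2 * l * q * d * w + 2 * l * y * q\<^sup>2) / (w * w)) (at y)"
      unfolding w_def q_def d_def using w
      by (auto intro!: derivative_eq_intros poly_DERIV simp: w_def power2_eq_square algebra_simps)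
    have D2: "(2 * l * q * d * w + 2 * l * y * q\<^sup>2) / (w * w) = 2 * l * q * d / w + 2 * l * y * q\<^sup>2 / w\<^sup>2"
      using w by (simp add: power2_eq_square add_divide_distrib)
    have A: "((\<lambda>y. real n * (real n + 2 * l) * (ng l n y)\<^sup>2 - 2 * l * y * ng l n y * ngd l n y
         + (1 - y\<^sup>2) * (ngd l n y)\<^sup>2) has_real_derivative 2 * \<nu> * q * d - 2 * l * q * d - 2 * l * y * d\<^sup>2 - 2 * l * y * q * e
        - 2 * y * d\<^sup>2 + 2 * d * (w * e)) (at y)"
      unfolding w_def q_def d_def e_def \<nu>_def
      by (auto intro!: derivative_eq_intros poly_DERIV simp: power2_eq_square algebra_simps)
    have B': "(B has_real_derivative B') (at y)"
      unfolding B_def by (rule DERIV_cong[OF DERIV_add[OF A D]]) (simp only: B'_def D2 add.assoc)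
    have P': "((\<lambda>y. (1 - y\<^sup>2) powr l) has_real_derivative (- 2 * l * y / w) * (1 - y\<^sup>2) powr l) (at y)"
      using w by (auto intro!: derivative_eq_intros simp: w_def field_simps powr_diff)
    have E': "((\<lambda>y. exp (- \<kappa> / (1 - y\<^sup>2))) has_real_derivative (- 2 * \<kappa> * y / w\<^sup>2) * exp (- \<kappa> / (1 - y\<^sup>2))) (at y)"
      using w by (auto intro!: derivative_eq_intros simp: w_def power2_eq_square field_simps)
    \<comment> \<open>For solutions of \<open>u'' + Q u = 0\<close> the energy
      \<open>u'^2 + Q u^2\<close> changes only through the derivative of \<open>Q\<close>; the
      right-hand side is that derivative times p^2.\<close>
    have id: "B' - 2 * l * y / w * B y = 2 * l * (1 - l) * y * q\<^sup>2 / w\<^sup>2"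
    proof -
      have By: "w * B y = \<nu> * w * q\<^sup>2 - 2 * l * y * w * q * d + w\<^sup>2 * d\<^sup>2 + l * q\<^sup>2"
        unfolding B_def w_def[symmetric] q_def[symmetric] d_def[symmetric] \<nu>_def 
        using w by (simp add: field_simps power2_eq_square)
      have "w\<^sup>2 * B' = w\<^sup>2 * (2 * \<nu> * q * d - 2 * l * q * d - 2 * l * y * d\<^sup>2 - 2 * y * d\<^sup>2 + 2 * d * (w * e)) 
          - 2 * l * y * q * w * (w * e) + 2 * l * q * d * w + 2 * l * y * q\<^sup>2"
        using w by (simp add: B'_def field_simps power2_eq_square)
      then have "w\<^sup>2 * B' - 2 * l * y * (w * B y) = 2 * l * (1 - l) * y * q\<^sup>2"
        unfolding By ode unfolding w_def by algebra
      moreover have "w\<^sup>2 * (B' - 2 * l * y / w * B y) = w\<^sup>2 * B' - 2 * l * y * (w * B y)"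
        using w by (simp add: right_diff_distrib power2_eq_square)
      moreover have "w\<^sup>2 * (2 * l * (1 - l) * y * q\<^sup>2 / w\<^sup>2) = 2 * l * (1 - l) * y * q\<^sup>2" using w by simp
      ultimately have "w\<^sup>2 * (B' - 2 * l * y / w * B y) = w\<^sup>2 * (2 * l * (1 - l) * y * q\<^sup>2 / w\<^sup>2)"
        by simp
      then show ?thesis using w by (subst (asm) mult_left_cancel) auto
    qed
    have "(G has_real_derivative ((- 2 * l * y / w) * (1 - y\<^sup>2) powr l * B y + B' * (1 - y\<^sup>2) powr l) * exp (- \<kappa> / (1 - y\<^sup>2))
      + (- 2 * \<kappa> * y / w\<^sup>2) * exp (- \<kappa> / (1 - y\<^sup>2)) * ((1 - y\<^sup>2) powr l * B y)) (at y)"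
      unfolding G_def by (rule DERIV_mult[OF DERIV_mult[OF P' B'] E'])
    also have "((- 2 * l * y / w) * (1 - y\<^sup>2) powr l * B y + B' * (1 - y\<^sup>2) powr l) * exp (- \<kappa> / (1 - y\<^sup>2))
      + (- 2 * \<kappa> * y / w\<^sup>2) * exp (- \<kappa> / (1 - y\<^sup>2)) * ((1 - y\<^sup>2) powr l * B y) =
      (1 - y\<^sup>2) powr l * exp (- \<kappa> / (1 - y\<^sup>2)) * ((B' - 2 * l * y / w * B y) - 2 * \<kappa> * y / w\<^sup>2 * B y)"
      by (simp add: algebra_simps)
    also have "\<dots> = (1 - y\<^sup>2) powr l * exp (- \<kappa> / (1 - y\<^sup>2)) * (2 * y / w\<^sup>2 * (l * (1 - l) * q\<^sup>2 - \<kappa> * B y))"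
      unfolding id by (simp add: algebra_simps diff_divide_distrib)
    finally show ?thesis by (simp add: w_def q_def)
  qed
  have "G x \<le> G 0"
  proof (rule DERIV_nonpos_imp_nonincreasing[OF x(1)])
    fix y assume y: "0 \<le> y" "y \<le> x"
    have "l * (1 - l) * (ng l n y)\<^sup>2 \<le> l * \<bar>1 - l\<bar> * (ng l n y)\<^sup>2" 
      using l by (intro mult_right_mono mult_left_mono) auto
    also have "\<dots> = \<kappa> * (real n ^ 2 * (ng l n y)\<^sup>2 / 2)" using n0 by (simp add: \<kappa>_def)
    also have "\<dots> \<le> \<kappa> * B y" by (rule mult_left_mono[OF B1[OF y] \<kappa>0])
    finally have neg: "2 * y / (1 - y\<^sup>2)\<^sup>2 * (l * (1 - l) * (ng l n y)\<^sup>2 - \<kappa> * B y) \<le> 0"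
      using y by (intro mult_nonneg_nonpos) auto
    then have "(1 - y\<^sup>2) powr l * exp (- \<kappa> / (1 - y\<^sup>2)) * 
      (2 * y / (1 - y\<^sup>2)\<^sup>2 * (l * (1 - l) * (ng l n y)\<^sup>2 - \<kappa> * B y)) \<le> 0"
      by (intro mult_nonneg_nonpos[OF _ neg]) simp
    then show "\<exists>z. (G has_real_derivative z) (at y) \<and> z \<le> 0" using G'[OF y] by blast
  qed
  also have "G 0 = B 0 * exp (- \<kappa>)" by (simp add: G_def)
  also have "\<dots> \<le> B 0 * 1" using B1[of 0] x \<kappa>0
    by (intro mult_left_mono) (auto intro: order_trans[OF _ B1[of 0]])
  finally have GB: "G x \<le> B 0" by simp
  have Wx: "1 - x\<^sup>2 > 0" using WW(1)[of x] x by simp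
  have "\<kappa> / (1 - x\<^sup>2) = 2 * l * \<bar>1 - l\<bar> / (real n ^ 2 * (1 - x\<^sup>2))" by (simp add: \<kappa>_def)
  also have "\<dots> \<le> 2 * l * \<bar>1 - l\<bar> / 1"
  proof (rule divide_left_mono)
    show *: "1 \<le> real n ^ 2 * (1 - x\<^sup>2)" using W zero_le_power2[of l] by linarith
    show "0 < real n ^ 2 * (1 - x\<^sup>2) * 1" using * by linarith
  qed (use l in auto)
  finally have "exp (\<kappa> / (1 - x\<^sup>2)) \<le> exp (2 * l * \<bar>1 - l\<bar>)" by simp
  moreover have "(1 - x\<^sup>2) powr l * B x = G x * exp (\<kappa> / (1 - x\<^sup>2))"
    by (simp add: G_def mult.assoc flip: exp_add)
  moreover have "0 \<le> B 0" using B1[of 0] x by (auto intro: order_trans[OF _ B1[of 0]])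
  moreover have "0 \<le> B x" using B1[of x] x by (auto intro: order_trans[OF _ B1[of x]])
  then have "0 \<le> G x" by (simp add: G_def)
  ultimately show "(1 - x\<^sup>2) powr l * B x \<le> exp (2 * l * \<bar>1 - l\<bar>) * B 0"
    using mult_mono[OF GB, of "exp (\<kappa> / (1 - x\<^sup>2))" "exp (2 * l * \<bar>1 - l\<bar>)"] by (simp add: mult.commute)
qed

lemma ng_abs_le_1:
  assumes l: "l > 0" and x: "x \<in> {-1..1}"
  shows "\<bar>ng l n x\<bar> \<le> 1"
proof (cases "n = 0")
  case False
  have \<nu>: "real n * (real n + 2 * l) > 0" using False l by (intro mult_pos_pos) auto
  have "(1 - x\<^sup>2) * (ngd l n x)\<^sup>2 \<ge> 0" using x by (intro mult_nonneg_nonneg) (auto simp: abs_square_le_1 abs_le_iff)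
  then have "real n * (real n + 2 * l) * (ng l n x)\<^sup>2 \<le> real n * (real n + 2 * l) * 1"
    using ng_energy[OF l x, of n] by linarith
  then have "(ng l n x)\<^sup>2 \<le> 1" using \<nu> by (subst (asm) mult_le_cancel_left_pos)
  then show ?thesis by (simp add: abs_square_le_1)
qed simp

text \<open>Away from the endpoints, where n^2 (1 - x^2) \<ge> 2 l^2 + 1, the bounds come from the
  local energy, started with the decay of the values at 0 for the indices n and n + 1. Nearer to the
  endpoints the power of n^2 (1 - x^2) is itself bounded and \<open>ng_energy\<close> suffices.
  Negative x are reflected by parity.\<close>

lemma ng_uniform_bounds:
  assumes l: "l > 0"
  obtains C where "C \<ge> 0"
    "\<And>n x. n \<ge> 1 \<Longrightarrow> x \<in> {-1..1} \<Longrightarrow> (real n ^ 2 * (1 - x\<^sup>2)) powr l * (ng l n x)\<^sup>2 \<le> C"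
    "\<And>n x. n \<ge> 1 \<Longrightarrow> x \<in> {-1..1} \<Longrightarrow> (real n ^ 2 * (1 - x\<^sup>2)) powr l * ((1 - x\<^sup>2) * (ngd l n x)\<^sup>2) \<le> C * real n ^ 2"
proof -
  define c0 where "c0 = 2 * l\<^sup>2 + 1"
  define A where "A = (1 + l) powr l"
  define C1 where "C1 = exp (2 * l * \<bar>1 - l\<bar>) * (A\<^sup>2 * ((1 + 3 * l) + (1 + 2 * l)\<^sup>2))"
  define C2 where "C2 = c0 powr l * (1 + 2 * l)"
  define C where "C = (4 * l\<^sup>2 + 2) * C1 + C2"
  have C1: "C1 \<ge> 0" using l by (auto simp: C1_def intro!: mult_nonneg_nonneg)
  have C2: "C2 \<ge> 0" using l by (auto simp: C2_def)
  have c0: "c0 \<ge> 1" by (simp add: c0_def)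
  have C: "C \<ge> 0" "2 * C1 \<le> C" "C2 \<le> C" using C1 C2 by (auto simp: C_def algebra_simps)
  have pos: "(real n ^ 2 * (1 - x\<^sup>2)) powr l * (ng l n x)\<^sup>2 \<le> C \<and> 
     (real n ^ 2 * (1 - x\<^sup>2)) powr l * ((1 - x\<^sup>2) * (ngd l n x)\<^sup>2) \<le> C * real n ^ 2"
    if n: "n \<ge> 1" and x: "0 \<le> x" "x \<le> 1" for n x
  proof (cases "real n ^ 2 * (1 - x\<^sup>2) \<ge> c0")
    case True
    define W where "W = 1 - x\<^sup>2"
    have n0: "real n \<ge> 1" using n by simp
    have x1: "x < 1" using True c0 x by (cases "x = 1") auto
    then have W: "W > 0" "W \<le> 1" using x by (auto simp: W_def abs_square_less_1)
    define M where "M = (real n ^ 2 * W) powr l"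
    define B where "B = (\<lambda>x. real n * (real n + 2 * l) * (ng l n x)\<^sup>2 - 2 * l * x * ng l n x * ngd l n x
     + (1 - x\<^sup>2) * (ngd l n x)\<^sup>2 + l * (ng l n x)\<^sup>2 / (1 - x\<^sup>2))"
    have en: "W powr l * B x \<le> exp (2 * l * \<bar>1 - l\<bar>) * B 0"
      "real n ^ 2 * (ng l n x)\<^sup>2 / 2 \<le> B x"
      "(l * x * ng l n x - W * ngd l n x)\<^sup>2 / W \<le> B x"
      using ng_local_energy[OF l n x(1) x1 True[unfolded c0_def]] unfolding B_def W_def by blast+
    have M: "M = (real n powr l)\<^sup>2 * W powr l"
      using W by (simp add: M_def powr_mult power2_eq_square)
    have a: "real k powr l * \<bar>ng l m 0\<bar> \<le> A" if "k \<le> m" for k m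
    proof -
      have "real k powr l * \<bar>ng l m 0\<bar> \<le> real k powr l * ((1 + l) / (real m + 1 + l)) powr l"
        by (intro mult_left_mono ng_at_0_le[OF l]) auto
      also have "\<dots> = (real k * ((1 + l) / (real m + 1 + l))) powr l"
        using l by (subst powr_mult) auto
      also have "\<dots> \<le> A" unfolding A_def
      proof (rule powr_mono2)
        have "real k * (1 + l) \<le> (1 + l) * (real m + 1 + l)"
          using that l by (subst mult.commute) (intro mult_left_mono, auto)
        then show "real k * ((1 + l) / (real m + 1 + l)) \<le> 1 + l"
          using l by (simp add: field_simps)
      qed (use l in auto)
      finally show ?thesis .
    qed
    have a2: "(real k powr l)\<^sup>2 * (ng l m 0)\<^sup>2 \<le> A\<^sup>2" if "k \<le> m" for k m
      using power_mono[OF a[OF that], of 2] by (simp add: power_mult_distrib)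
    have d0: "ngd l n 0 = - (real n + 2 * l) * ng l (Suc n) 0"
      using ngd_eq[OF l, of 0 n] by (simp add: algebra_simps)
    have "(real n powr l)\<^sup>2 * B 0 = (real n * (real n + 2 * l) + l) * ((real n powr l)\<^sup>2 * (ng l n 0)\<^sup>2)
       + (real n + 2 * l)\<^sup>2 * ((real n powr l)\<^sup>2 * (ng l (Suc n) 0)\<^sup>2)"
      by (simp add: B_def d0 power2_eq_square algebra_simps)
    also have "\<dots> \<le> ((1 + 3 * l) * real n ^ 2) * A\<^sup>2 + ((1 + 2 * l)\<^sup>2 * real n ^ 2) * A\<^sup>2"
    proof (intro add_mono mult_mono a2)
      have "1 \<le> real n * real n" using n0 mult_mono[OF n0 n0] by simp
      then have "l * real n \<le> l * (real n * real n)" "l \<le> l * (real n * real n)" using l n0 by auto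
      then show "real n * (real n + 2 * l) + l \<le> (1 + 3 * l) * (real n)\<^sup>2"
        by (simp add: power2_eq_square algebra_simps)
      have "real n + 2 * l \<le> (1 + 2 * l) * real n" using l n0 by (simp add: algebra_simps)
      then show "(real n + 2 * l)\<^sup>2 \<le> (1 + 2 * l)\<^sup>2 * (real n)\<^sup>2"
        using l by (subst power_mult_distrib[symmetric]) (intro power_mono, auto)
    qed (use l in auto)
    finally have B0: "(real n powr l)\<^sup>2 * B 0 \<le> A\<^sup>2 * ((1 + 3 * l) + (1 + 2 * l)\<^sup>2) * real n ^ 2"
      by (simp add: algebra_simps)
    have "M * B x = (real n powr l)\<^sup>2 * (W powr l * B x)" by (simp add: M)
    also have "\<dots> \<le> (real n powr l)\<^sup>2 * (exp (2 * l * \<bar>1 - l\<bar>) * B 0)"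
      by (intro mult_left_mono en) auto
    also have "\<dots> = exp (2 * l * \<bar>1 - l\<bar>) * ((real n powr l)\<^sup>2 * B 0)" by simp
    also have "\<dots> \<le> exp (2 * l * \<bar>1 - l\<bar>) * (A\<^sup>2 * ((1 + 3 * l) + (1 + 2 * l)\<^sup>2) * real n ^ 2)"
      by (intro mult_left_mono B0) auto
    finally have MB: "M * B x \<le> C1 * real n ^ 2" by (simp add: C1_def mult_ac)
    have "M * (real n ^ 2 * (ng l n x)\<^sup>2 / 2) \<le> M * B x" 
      by (intro mult_left_mono en) (simp add: M_def)
    then have "real n ^ 2 * (M * (ng l n x)\<^sup>2) \<le> real n ^ 2 * (2 * C1)" using MB by (simp add: mult_ac)
    then have Mq: "M * (ng l n x)\<^sup>2 \<le> 2 * C1" using n0 by (subst (asm) mult_le_cancel_left_pos) auto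
    have "W * (ngd l n x)\<^sup>2 = (l * x * ng l n x - (l * x * ng l n x - W * ngd l n x))\<^sup>2 / W"
      using W by (simp add: power2_eq_square)
    also have "\<dots> \<le> (2 * (l * x * ng l n x)\<^sup>2 + 2 * (l * x * ng l n x - W * ngd l n x)\<^sup>2) / W"
      using W sum_squares_ge_zero[of "l * x * ng l n x + (l * x * ng l n x - W * ngd l n x)" 0]
      by (intro divide_right_mono) (auto simp: power2_eq_square algebra_simps)
    also have "\<dots> = 2 * (l * x * ng l n x)\<^sup>2 / W + 2 * ((l * x * ng l n x - W * ngd l n x)\<^sup>2 / W)"
      by (simp add: add_divide_distrib)
    also have "\<dots> \<le> 2 * (l\<^sup>2 * (ng l n x)\<^sup>2) / W + 2 * B x"
    proof (intro add_mono divide_right_mono mult_left_mono en)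
      have "x\<^sup>2 * (l\<^sup>2 * (ng l n x)\<^sup>2) \<le> 1 * (l\<^sup>2 * (ng l n x)\<^sup>2)" 
        using x by (intro mult_right_mono) (auto simp: abs_square_le_1)
      then show "(l * x * ng l n x)\<^sup>2 \<le> l\<^sup>2 * (ng l n x)\<^sup>2" by (simp add: power_mult_distrib mult_ac)
    qed (use W in auto)
    finally have "M * (W * (ngd l n x)\<^sup>2) \<le> M * (2 * (l\<^sup>2 * (ng l n x)\<^sup>2) / W + 2 * B x)"
      by (rule mult_left_mono) (simp add: M_def)
    also have "\<dots> = (2 * l\<^sup>2 / W) * (M * (ng l n x)\<^sup>2) + 2 * (M * B x)" by (simp add: algebra_simps)
    also have "\<dots> \<le> (2 * l\<^sup>2 * real n ^ 2) * (2 * C1) + 2 * (C1 * real n ^ 2)"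
    proof -
      have "2 * l\<^sup>2 * 1 \<le> 2 * l\<^sup>2 * (real n ^ 2 * W)" using True c0 by (intro mult_left_mono) (auto simp: W_def)
      then have *: "2 * l\<^sup>2 / W \<le> 2 * l\<^sup>2 * real n ^ 2" using W by (simp add: field_simps)
      have "(2 * l\<^sup>2 / W) * (M * (ng l n x)\<^sup>2) \<le> (2 * l\<^sup>2 * real n ^ 2) * (2 * C1)"
        by (rule mult_mono[OF * Mq]) (auto simp: M_def)
      then show ?thesis using MB by linarith
    qed
    also have "\<dots> \<le> C * real n ^ 2" using C2 n0 by (simp add: C_def algebra_simps)
    finally show ?thesis using Mq C by (auto simp: M_def W_def)
  next
    case False
    have W0: "1 - x\<^sup>2 \<ge> 0" using x by (simp add: abs_square_le_1)
    have n0: "real n \<ge> 1" using n by simp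
    have M: "(real n ^ 2 * (1 - x\<^sup>2)) powr l \<le> c0 powr l"
      using False W0 l by (intro powr_mono2) auto
    have q: "(ng l n x)\<^sup>2 \<le> 1" using ng_abs_le_1[OF l, of x n] x by (simp add: abs_square_le_1)
    have \<nu>: "real n * (real n + 2 * l) \<le> (1 + 2 * l) * real n ^ 2"
      using l n0 by (simp add: power2_eq_square algebra_simps)
    have "0 \<le> real n * (real n + 2 * l) * (ng l n x)\<^sup>2" using l by (intro mult_nonneg_nonneg) auto
    then have d: "(1 - x\<^sup>2) * (ngd l n x)\<^sup>2 \<le> (1 + 2 * l) * real n ^ 2"
      using ng_energy[OF l, of x n] x \<nu> by auto
    have "(real n ^ 2 * (1 - x\<^sup>2)) powr l * (ng l n x)\<^sup>2 \<le> c0 powr l * 1"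
      by (intro mult_mono M q) auto
    also have "\<dots> \<le> C2" unfolding C2_def using l by (intro mult_left_mono) auto
    finally have 1: "(real n ^ 2 * (1 - x\<^sup>2)) powr l * (ng l n x)\<^sup>2 \<le> C" using C by simp
    have "(real n ^ 2 * (1 - x\<^sup>2)) powr l * ((1 - x\<^sup>2) * (ngd l n x)\<^sup>2) \<le> c0 powr l * ((1 + 2 * l) * real n ^ 2)"
      using W0 by (intro mult_mono M d) auto
    also have "\<dots> = C2 * real n ^ 2" by (simp add: C2_def)
    also have "\<dots> \<le> C * real n ^ 2" using C by (intro mult_right_mono) auto
    finally show ?thesis using 1 by simp
  qed
  have all: "(real n ^ 2 * (1 - x\<^sup>2)) powr l * (ng l n x)\<^sup>2 \<le> C \<and> 
     (real n ^ 2 * (1 - x\<^sup>2)) powr l * ((1 - x\<^sup>2) * (ngd l n x)\<^sup>2) \<le> C * real n ^ 2"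
    if n: "n \<ge> 1" and x: "x \<in> {-1..1}" for n x
  proof (cases "x \<ge> 0")
    case True then show ?thesis using pos[OF n, of x] x by simp
  next
    case False
    have q: "(ng l n (-x))\<^sup>2 = (ng l n x)\<^sup>2" 
      by (simp add: ng_parity[OF l] power_mult_distrib flip: power_mult)
    have "((1 - x\<^sup>2) * ngd l n (-x))\<^sup>2 = ((1 - x\<^sup>2) * ngd l n x)\<^sup>2"
    proof -
      have "(1 - x\<^sup>2) * ngd l n (-x) = - ((-1) ^ n) * ((1 - x\<^sup>2) * ngd l n x)"
      proof -
        have "(1 - x\<^sup>2) * ngd l n (-x) = (real n + 2 * l) * (- x * ((-1) ^ n * ng l n x) + (-1) ^ n * ng l (Suc n) x)"
          using ngd_eq[OF l, of "-x" n] by (simp add: ng_parity[OF l])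
        then show ?thesis unfolding ngd_eq[OF l, of x n] by (simp add: algebra_simps)
      qed
      then show ?thesis by (simp add: power_mult_distrib flip: power_mult)
    qed
    then have dd: "(1 - x\<^sup>2) * (ngd l n (-x))\<^sup>2 = (1 - x\<^sup>2) * (ngd l n x)\<^sup>2"
      by (cases "1 - x\<^sup>2 = 0") (auto simp: power_mult_distrib)
    have "0 \<le> -x" "-x \<le> 1" using x False by auto
    from pos[OF n this] show ?thesis unfolding power2_minus q dd .
  qed
  show thesis by (rule that[OF C(1)]) (use all in auto)
qed

section \<open>Orthogonality and the Christoffel--Darboux formula\<close>

text \<open>Integration against the Gegenbauer weight after x = cos \<theta>. In this form the
  density is continuous even for l < 1/2, when the weight is unbounded at both endpoints, so
  continuous integrands cause no integrability questions.\<close>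

definition gint :: "real \<Rightarrow> (real \<Rightarrow> real) \<Rightarrow> real" where
  "gint l f = integral {0..pi} (\<lambda>\<theta>. f (cos \<theta>) * sin \<theta> powr (2 * l))"

definition geta :: "real \<Rightarrow> nat \<Rightarrow> real" where
  "geta l n = gint l (\<lambda>x. (ng l n x)\<^sup>2)"

definition gker :: "real \<Rightarrow> nat \<Rightarrow> real \<Rightarrow> real \<Rightarrow> real" where
  "gker l N x t = (\<Sum>k\<le>N. ng l k x * ng l k t / geta l k)"

lemma continuous_on_sin_powr: "l > 0 \<Longrightarrow> continuous_on {0..pi} (\<lambda>\<theta>. sin \<theta> powr l)"
  by (intro continuous_on_powr' continuous_intros) (auto simp: sin_ge_zero)

lemma continuous_on_comp_cos:
  assumes "continuous_on {-1..1} f" shows "continuous_on S (\<lambda>\<theta>. f (cos \<theta> :: real))"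
  by (rule continuous_on_compose2[OF assms]) (auto intro!: continuous_intros)

lemma gint_integrable:
  assumes "l > 0" "continuous_on {-1..1} f"
  shows "(\<lambda>\<theta>. f (cos \<theta>) * sin \<theta> powr (2 * l)) integrable_on {0..pi}"
  using assms by (intro integrable_continuous_real continuous_on_mult continuous_on_comp_cos continuous_on_sin_powr) auto

lemma gint_add:
  assumes "l > 0" "continuous_on {-1..1} f" "continuous_on {-1..1} g"
  shows "gint l (\<lambda>x. f x + g x) = gint l f + gint l g"
  unfolding gint_def distrib_right
  by (intro integral_add gint_integrable assms)

lemma gint_diff:
  assumes "l > 0" "continuous_on {-1..1} f" "continuous_on {-1..1} g"
  shows "gint l (\<lambda>x. f x - g x) = gint l f - gint l g"
  unfolding gint_def left_diff_distrib
  by (intro integral_diff gint_integrable assms)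

lemma gint_cmult: "gint l (\<lambda>x. c * f x) = c * gint l f"
  unfolding gint_def by (simp add: mult.assoc)

lemma gint_sum:
  assumes "l > 0" "\<And>i. i \<in> I \<Longrightarrow> continuous_on {-1..1} (f i)" "finite I"
  shows "gint l (\<lambda>x. \<Sum>i\<in>I. f i x) = (\<Sum>i\<in>I. gint l (f i))"
  unfolding gint_def sum_distrib_right
  by (intro integral_sum gint_integrable assms)

lemma gint_mult_abs_le:
  assumes l: "l > 0" and k: "continuous_on {-1..1} k" and f: "continuous_on {-1..1} f"
    and B: "\<And>t. t \<in> {-1..1} \<Longrightarrow> \<bar>f t\<bar> \<le> B"
  shows "\<bar>gint l (\<lambda>t. k t * f t)\<bar> \<le> B * gint l (\<lambda>t. \<bar>k t\<bar>)"
proof -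
  have "\<bar>gint l (\<lambda>t. k t * f t)\<bar> \<le> gint l (\<lambda>t. B * \<bar>k t\<bar>)"
    unfolding gint_def real_norm_def[symmetric]
  proof (rule integral_norm_bound_integral)
    fix \<theta> :: real
    have "norm (k (cos \<theta>) * f (cos \<theta>)) \<le> B * norm (k (cos \<theta>))"
      using mult_left_mono[OF B[of "cos \<theta>"], of "\<bar>k (cos \<theta>)\<bar>"] by (simp add: abs_mult mult.commute[of B])
    then show "norm (k (cos \<theta>) * f (cos \<theta>) * sin \<theta> powr (2 * l)) \<le> B * norm (k (cos \<theta>)) * sin \<theta> powr (2 * l)"
      unfolding norm_mult[of _ "sin \<theta> powr (2 * l)"] by (simp add: mult_right_mono)
  next
    show "(\<lambda>\<theta>. k (cos \<theta>) * f (cos \<theta>) * sin \<theta> powr (2 * l)) integrable_on {0..pi}"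
      by (rule gint_integrable[OF l]) (intro continuous_intros k f)
    show "(\<lambda>\<theta>. B * norm (k (cos \<theta>)) * sin \<theta> powr (2 * l)) integrable_on {0..pi}"
      by (rule gint_integrable[OF l]) (intro continuous_intros k)
  qed
  then show ?thesis by (simp add: gint_cmult)
qed

text \<open>Self-adjointness of the Gegenbauer operator: \<open>h\<close> is the Wronskian with its
  weight, its derivative is the difference of the eigenvalues times the integrand, and the factor
  sin^(2 l + 1) makes it vanish at 0 and pi.\<close>

lemma ng_orthogonal:
  assumes l: "l > 0" and nm: "n \<noteq> m"
  shows "gint l (\<lambda>x. ng l n x * ng l m x) = 0"
proof -
  define \<nu> where "\<nu> = (\<lambda>n. real n * (real n + 2 * l))"
  define h where "h = (\<lambda>\<theta>. sin \<theta> powr (2 * l + 1) * (ngd l n (cos \<theta>) * ng l m (cos \<theta>) - ngd l m (cos \<theta>) * ng l n (cos \<theta>)))"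
  have cont: "continuous_on {0..pi} h"
    unfolding h_def using l by (intro continuous_intros continuous_on_sin_powr) auto
  have der: "(h has_vector_derivative (\<nu> n - \<nu> m) * (ng l n (cos \<theta>) * ng l m (cos \<theta>) * sin \<theta> powr (2 * l))) (at \<theta>)"
    if "\<theta> \<in> {0<..<pi}" for \<theta>
  proof -
    define s c where "s = sin \<theta>" and "c = cos \<theta>"
    have s: "s > 0" using that by (simp add: s_def sin_gt_zero)
    have sc: "s\<^sup>2 = 1 - c\<^sup>2" by (simp add: s_def c_def sin_squared_eq)
    define e where "e = (\<lambda>n. poly (pderiv (pderiv (ngeg l n))) c)"
    have A: "((\<lambda>\<theta>. sin \<theta> powr (2 * l + 1)) has_real_derivative (2 * l + 1) * s powr (2 * l) * c) (at \<theta>)"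
      using DERIV_powr[OF DERIV_sin, of \<theta> "\<lambda>_. 2 * l + 1" 0] s by (simp add: s_def c_def powr_add mult_ac)
    have P: "((\<lambda>\<theta>. poly p (cos \<theta>)) has_real_derivative - s * poly (pderiv p) c) (at \<theta>)" for p
      unfolding s_def c_def by (auto intro!: derivative_eq_intros DERIV_chain2[OF poly_DERIV])
    have B: "((\<lambda>\<theta>. ngd l n (cos \<theta>) * ng l m (cos \<theta>) - ngd l m (cos \<theta>) * ng l n (cos \<theta>))
        has_real_derivative - s * (e n * ng l m c - e m * ng l n c)) (at \<theta>)"
      by (rule DERIV_cong[OF DERIV_diff[OF DERIV_mult[OF P P] DERIV_mult[OF P P]]])
         (simp add: e_def c_def algebra_simps)
    have "(h has_real_derivative (2 * l + 1) * s powr (2 * l) * c * (ngd l n c * ng l m c - ngd l m c * ng l n c) 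
       + - s * (e n * ng l m c - e m * ng l n c) * s powr (2 * l + 1)) (at \<theta>)"
      unfolding h_def by (rule DERIV_cong[OF DERIV_mult[OF A B]]) (simp add: s_def c_def)
    also have "s powr (2 * l + 1) = s powr (2 * l) * s" using s by (simp add: powr_add)
    also have "(2 * l + 1) * s powr (2 * l) * c * (ngd l n c * ng l m c - ngd l m c * ng l n c) 
       + - s * (e n * ng l m c - e m * ng l n c) * (s powr (2 * l) * s)
       = s powr (2 * l) * ((2 * l + 1) * c * (ngd l n c * ng l m c - ngd l m c * ng l n c)
           - (s\<^sup>2 * e n * ng l m c - s\<^sup>2 * e m * ng l n c))"
      by (simp add: algebra_simps power2_eq_square)
    also have "\<dots> = (\<nu> n - \<nu> m) * (ng l n c * ng l m c * s powr (2 * l))"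
      unfolding sc e_def ng_ode[OF l] \<nu>_def by (simp add: algebra_simps)
    finally show ?thesis by (simp add: has_real_derivative_iff_has_vector_derivative s_def c_def)
  qed
  have "((\<lambda>\<theta>. (\<nu> n - \<nu> m) * (ng l n (cos \<theta>) * ng l m (cos \<theta>) * sin \<theta> powr (2 * l))) has_integral h pi - h 0) {0..pi}"
    by (rule fundamental_theorem_of_calculus_interior[OF _ cont der]) auto
  then have "integral {0..pi} (\<lambda>\<theta>. (\<nu> n - \<nu> m) * (ng l n (cos \<theta>) * ng l m (cos \<theta>) * sin \<theta> powr (2 * l))) = h pi - h 0"
    by (rule integral_unique)
  also have "h pi - h 0 = 0" by (simp add: h_def)
  finally have "(\<nu> n - \<nu> m) * gint l (\<lambda>x. ng l n x * ng l m x) = 0"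
    by (simp add: gint_def)
  moreover have "\<nu> n \<noteq> \<nu> m"
  proof -
    have "\<nu> n - \<nu> m = (real n - real m) * (real n + real m + 2 * l)" by (simp add: \<nu>_def algebra_simps)
    moreover have "real n + real m + 2 * l > 0" using l by (simp add: add_nonneg_pos)
    ultimately show ?thesis using nm by auto
  qed
  ultimately show ?thesis by simp
qed

lemma gint_square_pos:
  assumes l: "l > 0" and p: "p \<noteq> 0"
  shows "gint l (\<lambda>x. (poly p x)\<^sup>2) > 0"
proof -
  define h where "h = (\<lambda>\<theta>. (poly p (cos \<theta>))\<^sup>2 * sin \<theta> powr (2 * l))"
  have cont: "continuous_on {0..pi} h"
    unfolding h_def using l by (intro continuous_intros continuous_on_sin_powr) auto
  have nn: "h \<theta> \<ge> 0" for \<theta> by (simp add: h_def)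
  have "integral {0..pi} h \<noteq> 0"
  proof
    assume "integral {0..pi} h = 0"
    then have z: "(h has_integral 0) (cbox 0 pi)" 
      using integrable_integral[OF integrable_continuous_real[OF cont]] by simp
    have "poly p x = 0" if "x \<in> {-1<..<1}" for x
    proof -
      have x: "-1 < x" "x < 1" using that by auto
      have "h (arccos x) = 0"
        by (rule has_integral_0_cbox_imp_0[OF _ nn z]) (use cont x arccos_bounded[of x] pi_gt_zero in \<open>auto simp: box_real simp del: pi_gt_zero\<close>)
      moreover have "sin (arccos x) > 0" using x arccos_lt_bounded[of x] by (intro sin_gt_zero) auto
      ultimately show ?thesis using x by (simp add: h_def)
    qed
    then have "{-1<..<1} \<subseteq> {x. poly p x = 0}" by auto
    then have "finite {-1<..<1::real}" using poly_roots_finite[OF p] finite_subset by blast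
    then show False using infinite_Ioo[of "-1" "1 :: real"] by simp
  qed
  moreover have "integral {0..pi} h \<ge> 0" by (rule integral_nonneg) (use nn integrable_continuous_real[OF cont] in auto)
  ultimately show ?thesis by (simp add: gint_def h_def)
qed

lemma geta_pos: "l > 0 \<Longrightarrow> geta l n > 0"
  unfolding geta_def by (rule gint_square_pos) (use ngeg_degree_coeff[of l n] in auto)

lemma ng_inner: "l > 0 \<Longrightarrow> gint l (\<lambda>x. ng l n x * ng l m x) = (if n = m then geta l n else 0)"
  by (simp add: ng_orthogonal geta_def power2_eq_square)

section \<open>Polynomial expansions and the reproducing kernel\<close>

lemma poly_ngeg_expansion:
  assumes l: "l > 0" and "degree p \<le> N"
  shows "\<exists>c. p = (\<Sum>k\<le>N. smult (c k) (ngeg l k))"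
  using assms(2)
proof (induction N arbitrary: p)
  case 0
  then obtain a where "p = [:a:]" by (auto elim: degree_eq_zeroE)
  then show ?case by (intro exI[of _ "\<lambda>_. a"]) simp
next
  case (Suc N)
  define a where "a = coeff p (Suc N) / coeff (ngeg l (Suc N)) (Suc N)"
  have c: "coeff (ngeg l (Suc N)) (Suc N) > 0" using ngeg_degree_coeff[OF l] by blast
  have "degree (p - smult a (ngeg l (Suc N))) \<le> N"
  proof (rule degree_le, safe)
    fix i assume i: "i > N"
    show "coeff (p - smult a (ngeg l (Suc N))) i = 0"
    proof (cases "i = Suc N")
      case True then show ?thesis using c by (simp add: a_def)
    next
      case False
      then have "i > degree p" "i > degree (ngeg l (Suc N))" 
        using i Suc.prems by (auto simp: degree_ngeg[OF l])
      then show ?thesis by (simp add: coeff_eq_0)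
    qed
  qed
  from Suc.IH[OF this] obtain c where c: "p - smult a (ngeg l (Suc N)) = (\<Sum>k\<le>N. smult (c k) (ngeg l k))" by blast
  have "p = (\<Sum>k\<le>N. smult (c k) (ngeg l k)) + smult a (ngeg l (Suc N))" using c by (metis diff_add_cancel)
  also have "\<dots> = (\<Sum>k\<le>Suc N. smult ((c(Suc N := a)) k) (ngeg l k))" by simp
  finally show ?case by blast
qed

lemma continuous_on_gker: "continuous_on S (gker l N x)"
  unfolding gker_def divide_inverse by (intro continuous_intros)

lemma gint_gker:
  assumes l: "l > 0" and f: "continuous_on {-1..1} f"
  shows "gint l (\<lambda>t. gker l N x t * f t) = (\<Sum>k\<le>N. ng l k x * gint l (\<lambda>t. ng l k t * f t) / geta l k)"
proof -
  have "gint l (\<lambda>t. gker l N x t * f t) = gint l (\<lambda>t. \<Sum>k\<le>N. (ng l k x / geta l k) * (ng l k t * f t))"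
    by (simp add: gker_def sum_distrib_right mult.assoc)
  also have "\<dots> = (\<Sum>k\<le>N. gint l (\<lambda>t. (ng l k x / geta l k) * (ng l k t * f t)))"
    by (intro gint_sum[OF l] continuous_on_mult continuous_on_const continuous_on_poly continuous_on_id f) simp
  also have "\<dots> = (\<Sum>k\<le>N. (ng l k x / geta l k) * gint l (\<lambda>t. ng l k t * f t))" by (simp only: gint_cmult)
  finally show ?thesis by simp
qed

lemma gker_reproduces:
  assumes l: "l > 0" and p: "degree p \<le> N"
  shows "gint l (\<lambda>t. gker l N x t * poly p t) = poly p x"
proof -
  obtain c where c: "p = (\<Sum>k\<le>N. smult (c k) (ngeg l k))" using poly_ngeg_expansion[OF l p] by blast
  have "gint l (\<lambda>t. ng l k t * poly p t) = c k * geta l k" if "k \<le> N" for k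
  proof -
    have "gint l (\<lambda>t. ng l k t * poly p t) = gint l (\<lambda>t. \<Sum>j\<le>N. c j * (ng l k t * ng l j t))"
      by (simp add: c poly_sum sum_distrib_left mult_ac)
    also have "\<dots> = (\<Sum>j\<le>N. gint l (\<lambda>t. c j * (ng l k t * ng l j t)))"
      by (rule gint_sum[OF l]) (auto intro!: continuous_intros)
    also have "\<dots> = (\<Sum>j\<le>N. if k = j then c j * geta l k else 0)"
      by (intro sum.cong) (auto simp: gint_cmult ng_inner[OF l])
    also have "\<dots> = c k * geta l k" using that by simp
    finally show ?thesis .
  qed
  moreover have "geta l k \<noteq> 0" for k using geta_pos[OF l, of k] by simp
  ultimately have "gint l (\<lambda>t. gker l N x t * poly p t) = (\<Sum>k\<le>N. c k * ng l k x)"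
    unfolding gint_gker[OF l continuous_on_poly[OF continuous_on_id]] by (intro sum.cong) auto
  then show ?thesis by (simp add: c poly_sum)
qed

text \<open>The form with n - 1 includes n = 0: the coefficient n then annihilates the last term,
  whatever polynomial the truncated subtraction selects.\<close>

lemma ng_recurrence:
  assumes l: "l > 0"
  shows "2 * (real n + l) * (x * ng l n x) = (real n + 2 * l) * ng l (Suc n) x + real n * ng l (n - 1) x"
  using ng_three_term[OF l, of "n - 1" x] ng_three_term_0[OF l, of x] by (cases n) simp_all

text \<open>The integral of x p_n p_(n+1) is evaluated twice, applying the recurrence once to x p_n
  and once to x p_(n+1).\<close>

lemma geta_Suc:
  assumes l: "l > 0"
  shows "(real n + 2 * l) * (real n + 1 + l) * geta l (Suc n) = (real n + 1) * (real n + l) * geta l n"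
proof -
  let ?I = "gint l (\<lambda>x. x * ng l n x * ng l (Suc n) x)"
  have "2 * (real n + l) * ?I = gint l (\<lambda>x. 2 * (real n + l) * (x * ng l n x) * ng l (Suc n) x)"
    by (simp add: gint_cmult mult.assoc flip: gint_cmult)
  also have "\<dots> = gint l (\<lambda>x. (real n + 2 * l) * (ng l (Suc n) x * ng l (Suc n) x) + real n * (ng l (n - 1) x * ng l (Suc n) x))"
    unfolding ng_recurrence[OF l] by (simp add: algebra_simps)
  also have "\<dots> = (real n + 2 * l) * geta l (Suc n)"
    by (subst gint_add[OF l]) (auto intro!: continuous_intros simp: gint_cmult ng_inner[OF l])
  finally have 1: "2 * (real n + l) * ?I = (real n + 2 * l) * geta l (Suc n)" .
  have "2 * (real (Suc n) + l) * ?I = gint l (\<lambda>x. 2 * (real (Suc n) + l) * (x * ng l (Suc n) x) * ng l n x)"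
    by (simp add: gint_cmult mult_ac flip: gint_cmult)
  also have "\<dots> = gint l (\<lambda>x. (real (Suc n) + 2 * l) * (ng l (Suc (Suc n)) x * ng l n x) + real (Suc n) * (ng l n x * ng l n x))"
    unfolding ng_recurrence[OF l] by (simp add: algebra_simps)
  also have "\<dots> = real (Suc n) * geta l n"
    by (subst gint_add[OF l]) (auto intro!: continuous_intros simp: gint_cmult ng_inner[OF l])
  finally have 2: "2 * (real (Suc n) + l) * ?I = real (Suc n) * geta l n" .
  have "(real n + 1 + l) * (2 * (real n + l) * ?I) = (real n + l) * (2 * (real (Suc n) + l) * ?I)" by (simp add: algebra_simps)
  then show ?thesis unfolding 1 2 by (simp add: algebra_simps)
qed

text \<open>By the recurrence, x - t times the new diagonal term is a difference of two consecutive
  antisymmetric expressions. The norm ratio \<open>geta_Suc\<close> gives the older one the same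
  coefficient as in the induction hypothesis, so the sum telescopes.\<close>

lemma christoffel_darboux:
  assumes l: "l > 0"
  shows "(x - t) * gker l N x t = (real N + 2 * l) / (2 * (real N + l) * geta l N) * 
           (ng l (Suc N) x * ng l N t - ng l N x * ng l (Suc N) t)"
proof (induction N)
  case 0
  then show ?case using l by (simp add: gker_def ng_Suc field_simps)
next
  case (Suc N)
  define n where "n = real N"
  have n: "n + l > 0" "n + 1 + l > 0" "n + 2 * l > 0" "n + 1 > 0" using l by (auto simp: n_def add_nonneg_pos)
  note e = geta_pos[OF l, of N] geta_pos[OF l, of "Suc N"]
  define D where "D = ng l (Suc N) x * ng l N t - ng l N x * ng l (Suc N) t"
  define E where "E = ng l (Suc (Suc N)) x * ng l (Suc N) t - ng l (Suc N) x * ng l (Suc (Suc N)) t"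
  have r: "2 * (n + 1 + l) * (y * ng l (Suc N) y) = (n + 1 + 2 * l) * ng l (Suc (Suc N)) y + (n + 1) * ng l N y" for y
    using ng_recurrence[OF l, of "Suc N" y] by (simp add: n_def add_ac)
  have "2 * (n + 1 + l) * ((x - t) * (ng l (Suc N) x * ng l (Suc N) t)) = (n + 1 + 2 * l) * E - (n + 1) * D"
    using r[of x] r[of t] unfolding D_def E_def by algebra
  then have diag: "(x - t) * (ng l (Suc N) x * ng l (Suc N) t) = ((n + 1 + 2 * l) * E - (n + 1) * D) / (2 * (n + 1 + l))"
    using n by (simp add: field_simps)
  have coef: "(n + 2 * l) / (2 * (n + l) * geta l N) = (n + 1) / (2 * (n + 1 + l) * geta l (Suc N))"
  proof -
    have "(n + 2 * l) * (2 * (n + 1 + l) * geta l (Suc N)) = (n + 1) * (2 * (n + l) * geta l N)"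
      using geta_Suc[OF l, of N] unfolding n_def by algebra
    then show ?thesis using n e by (simp add: frac_eq_eq)
  qed
  have "(x - t) * gker l (Suc N) x t = (x - t) * gker l N x t + (x - t) * (ng l (Suc N) x * ng l (Suc N) t) / geta l (Suc N)"
    by (simp add: gker_def algebra_simps)
  also have "\<dots> = (n + 1) / (2 * (n + 1 + l) * geta l (Suc N)) * D + ((n + 1 + 2 * l) * E - (n + 1) * D) / (2 * (n + 1 + l)) / geta l (Suc N)"
    unfolding Suc diag n_def[symmetric] coef D_def ..
  also have "\<dots> = (n + 1 + 2 * l) / (2 * (n + 1 + l) * geta l (Suc N)) * E"
    by (simp add: diff_divide_distrib)
  finally show ?case by (simp add: n_def E_def add_ac)
qed

lemma inverse_geta:
  assumes l: "l > 0"
  shows "1 / geta l n = (real n + l) / (l * geta l 0) * (pochhammer (2 * l) n / fact n)"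
proof (induction n)
  case 0 then show ?case using l by simp
next
  case (Suc n)
  have n: "real n + l > 0" "real n + 1 + l > 0" "real n + 2 * l > 0" using l by (auto simp: add_nonneg_pos)
  note e = geta_pos[OF l, of n] geta_pos[OF l, of "Suc n"]
  have "1 / geta l (Suc n) = (real n + 2 * l) * (real n + 1 + l) / ((real n + 1) * (real n + l)) * (1 / geta l n)"
  proof -
    have "1 / b = A / B * (1 / a)" if "A * b = B * a" "a > 0" "b > 0" "B > 0" for A B a b :: real
      using that by (simp add: field_simps)
    from this[OF geta_Suc[OF l, of n]] show ?thesis using n e by simp
  qed
  also have "\<dots> = (real n + 2 * l) * (real n + 1 + l) / ((real n + 1) * (real n + l)) * ((real n + l) / (l * geta l 0) * (pochhammer (2 * l) n / fact n))"
    unfolding Suc ..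
  also have "\<dots> = (real (Suc n) + l) / (l * geta l 0) * (pochhammer (2 * l) (Suc n) / fact (Suc n))"
    using n by (simp add: pochhammer_Suc add_ac mult_ac divide_simps)
  finally show ?case .
qed

text \<open>In the closed form of \<open>inverse_geta\<close> the quotient of the Pochhammer symbol
  by n! grows like n^(2 l - 1), by the limit formula for the Gamma function; the linear factor adds
  the missing power of n.\<close>

lemma inverse_geta_le:
  assumes l: "l > 0"
  obtains C where "C > 0" "\<And>n. n \<ge> 1 \<Longrightarrow> 1 / geta l n \<le> C * real n powr (2 * l)"
proof -
  have "(\<lambda>n. 1 / Gamma_series' (2 * l) n) \<longlonglongrightarrow> 1 / Gamma (2 * l)"
    using Gamma_real_pos[of "2 * l"] l by (intro tendsto_divide Gamma_series'_LIMSEQ tendsto_const) linarith+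
  then have "Bseq (\<lambda>n. 1 / Gamma_series' (2 * l) n)" by (rule convergent_imp_Bseq[OF convergentI])
  then obtain K where K: "K > 0" "\<And>n. \<bar>1 / Gamma_series' (2 * l) n\<bar> \<le> K" unfolding Bseq_def by auto
  define C where "C = (1 + l) / (l * geta l 0) * K"
  show thesis
  proof (rule that[of C])
    show "C > 0" using K l geta_pos[OF l, of 0] by (auto simp: C_def intro!: mult_pos_pos divide_pos_pos)
    fix n :: nat assume n: "n \<ge> 1"
    then obtain m where m: "n = Suc m" by (cases n) auto
    have "pochhammer (2 * l) n / (fact m * real n powr (2 * l)) \<le> K"
      using order_trans[OF abs_ge_self K(2)[of n]] m by (simp add: Gamma_series'_def powr_def mult_ac)
    then have "pochhammer (2 * l) n / fact m \<le> K * real n powr (2 * l)"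
      using m by (simp add: pos_divide_le_eq mult_ac)
    then have "pochhammer (2 * l) n / fact m / real n \<le> K * real n powr (2 * l) / real n"
      by (rule divide_right_mono) simp
    then have poch: "pochhammer (2 * l) n / fact n \<le> K * real n powr (2 * l) / real n"
      using m by (simp add: mult.commute)
    have "(real n + l) / (l * geta l 0) \<le> (1 + l) * real n / (l * geta l 0)"
      using n l geta_pos[OF l, of 0] by (intro divide_right_mono) (auto simp: algebra_simps)
    then have "1 / geta l n \<le> (1 + l) * real n / (l * geta l 0) * (K * real n powr (2 * l) / real n)"
      unfolding inverse_geta[OF l, of n] using l geta_pos[OF l, of 0] K
      by (intro mult_mono poch) (auto intro!: divide_nonneg_pos pochhammer_nonneg)
    also have "\<dots> = C * real n powr (2 * l)" using n by (simp add: C_def)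
    finally show "1 / geta l n \<le> C * real n powr (2 * l)" .
  qed
qed

section \<open>The Lebesgue constant\<close>

text \<open>Here a stands for sin \<theta>, and Y is the natural size of y: 1 for values, k for
  derivatives. If a \<ge> 1/N the decay hypothesis applies; otherwise the trivial bound y \<le> D Y
  together with k \<le> N does. Using 1/N in place of 1/k gives a weight common to all k \<le> N, as
  needed for the kernel.\<close>

lemma amplitude_aux:
  fixes a y Y :: real
  assumes l: "l > 0" and a: "a \<ge> 0" and k: "1 \<le> k" "k \<le> N" and y: "0 \<le> y" "y \<le> D * Y" and Y: "0 \<le> Y" and D: "D \<ge> 0"
    and C: "C \<ge> 0" "(real k ^ 2 * a\<^sup>2) powr l * y\<^sup>2 \<le> C * Y\<^sup>2"
  shows "(1 / real N + a) powr l * (real k powr l * y) \<le> 2 powr l * (sqrt C + D) * Y"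
proof -
  have k0: "real k > 0" "real N > 0" using k by auto
  show ?thesis
  proof (cases "1 / real N \<le> a")
    case True
    have "((real k * a) powr l * y)\<^sup>2 = (real k ^ 2 * a\<^sup>2) powr l * y\<^sup>2"
      using a k0 by (simp add: power_mult_distrib powr_mult power2_eq_square mult_ac)
    also have "\<dots> \<le> (sqrt C * Y)\<^sup>2" using C by (simp add: power_mult_distrib)
    finally have *: "(real k * a) powr l * y \<le> sqrt C * Y"
      by (rule power2_le_imp_le) (use C Y in auto)
    have "(1 / real N + a) powr l \<le> (2 * a) powr l"
      using True a l k0 by (intro powr_mono2) auto
    also have "\<dots> = 2 powr l * a powr l" using a by (simp add: powr_mult)
    finally have "(1 / real N + a) powr l * (real k powr l * y) \<le> 2 powr l * a powr l * (real k powr l * y)"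
      using y by (intro mult_right_mono) auto
    also have "\<dots> = 2 powr l * ((real k * a) powr l * y)" using a by (simp add: powr_mult)
    also have "\<dots> \<le> 2 powr l * (sqrt C * Y)" using * by (intro mult_left_mono) auto
    also have "\<dots> \<le> 2 powr l * ((sqrt C + D) * Y)" using D Y by (intro mult_left_mono mult_right_mono) auto
    finally show ?thesis by (simp add: mult.assoc)
  next
    case False
    have "(1 / real N + a) powr l \<le> (2 * (1 / real N)) powr l"
      using False a l k0 by (intro powr_mono2) auto
    then have "(1 / real N + a) powr l * real k powr l \<le> (2 * (1 / real N)) powr l * real k powr l"
      by (rule mult_right_mono) simp
    also have "\<dots> = (2 * (real k / real N)) powr l" by (subst powr_mult[symmetric]) (auto simp: field_simps)
    also have "\<dots> \<le> 2 powr l" using k k0 l by (intro powr_mono2) (auto simp: divide_le_eq)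
    finally have "(1 / real N + a) powr l * (real k powr l * y) \<le> 2 powr l * (D * Y)"
      using mult_mono[of "(1 / real N + a) powr l * real k powr l" "2 powr l" y "D * Y"] y by (simp add: mult.assoc)
    also have "\<dots> \<le> 2 powr l * ((sqrt C + D) * Y)" using C Y by (intro mult_left_mono mult_right_mono) auto
    finally show ?thesis by (simp add: mult.assoc)
  qed
qed

lemma ng_amplitude:
  assumes l: "l > 0"
  obtains C where "C \<ge> 1"
    "\<And>N k x. 1 \<le> k \<Longrightarrow> k \<le> N \<Longrightarrow> x \<in> {-1..1} \<Longrightarrow> 
        (1 / real N + sqrt (1 - x\<^sup>2)) powr l * (real k powr l * \<bar>ng l k x\<bar>) \<le> C"
    "\<And>N k x. 1 \<le> k \<Longrightarrow> k \<le> N \<Longrightarrow> x \<in> {-1..1} \<Longrightarrow> 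
        (1 / real N + sqrt (1 - x\<^sup>2)) powr l * (real k powr l * (sqrt (1 - x\<^sup>2) * \<bar>ngd l k x\<bar>)) \<le> C * real k"
proof -
  obtain C0 where C0: "C0 \<ge> 0"
    "\<And>n x. n \<ge> 1 \<Longrightarrow> x \<in> {-1..1} \<Longrightarrow> (real n ^ 2 * (1 - x\<^sup>2)) powr l * (ng l n x)\<^sup>2 \<le> C0"
    "\<And>n x. n \<ge> 1 \<Longrightarrow> x \<in> {-1..1} \<Longrightarrow> (real n ^ 2 * (1 - x\<^sup>2)) powr l * ((1 - x\<^sup>2) * (ngd l n x)\<^sup>2) \<le> C0 * real n ^ 2"
    using ng_uniform_bounds[OF l] by blast
  define C where "C = 2 powr l * (sqrt C0 + (1 + 2 * l))"
  have sq: "0 \<le> 1 - x\<^sup>2" if "x \<in> {-1..1}" for x :: real using that by (auto simp: abs_square_le_1 abs_le_iff)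
  show thesis
  proof (rule that[of C])
    have "1 * 1 \<le> 2 powr l * (sqrt C0 + (1 + 2 * l))"
      using l C0 by (intro mult_mono ge_one_powr_ge_zero) auto
    then show "C \<ge> 1" by (simp add: C_def)
  next
    fix N k :: nat and x :: real assume k: "1 \<le> k" "k \<le> N" and x: "x \<in> {-1..1}"
    have "(1 / real N + sqrt (1 - x\<^sup>2)) powr l * (real k powr l * \<bar>ng l k x\<bar>) \<le> 2 powr l * (sqrt C0 + (1 + 2 * l)) * 1"
      using C0(2)[OF k(1) x] sq[OF x] ng_abs_le_1[OF l x, of k] l k C0(1)
      by (intro amplitude_aux) auto
    then show "(1 / real N + sqrt (1 - x\<^sup>2)) powr l * (real k powr l * \<bar>ng l k x\<bar>) \<le> C"
      by (simp add: C_def)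
    have "sqrt (1 - x\<^sup>2) * \<bar>ngd l k x\<bar> \<le> (1 + 2 * l) * real k"
    proof (rule power2_le_imp_le)
      have "real k * (real k + 2 * l) * (ng l k x)\<^sup>2 \<ge> 0" using l by (intro mult_nonneg_nonneg) auto
      then have "(sqrt (1 - x\<^sup>2) * \<bar>ngd l k x\<bar>)\<^sup>2 \<le> real k * (real k + 2 * l)"
        using ng_energy[OF l x, of k] sq[OF x] by (simp add: power_mult_distrib)
      also have "\<dots> \<le> (1 + 2 * l) * real k * ((1 + 2 * l) * real k)"
        using k l by (intro mult_mono) (auto simp: algebra_simps)
      finally show "(sqrt (1 - x\<^sup>2) * \<bar>ngd l k x\<bar>)\<^sup>2 \<le> ((1 + 2 * l) * real k)\<^sup>2" by (simp add: power2_eq_square)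
    qed (use l in auto)
    then have "(1 / real N + sqrt (1 - x\<^sup>2)) powr l * (real k powr l * (sqrt (1 - x\<^sup>2) * \<bar>ngd l k x\<bar>)) \<le> 2 powr l * (sqrt C0 + (1 + 2 * l)) * real k"
      using C0(3)[OF k(1) x] sq[OF x] l k C0(1)
      by (intro amplitude_aux) (auto simp: power_mult_distrib)
    then show "(1 / real N + sqrt (1 - x\<^sup>2)) powr l * (real k powr l * (sqrt (1 - x\<^sup>2) * \<bar>ngd l k x\<bar>)) \<le> C * real k"
      by (simp add: C_def)
  qed
qed

text \<open>The range is that of (\<alpha> + \<theta>) / 2 for \<alpha> \<le> pi/2 and \<theta>
  \<le> pi. The slope is crude: sin z \<ge> z/2 up to pi/6, and beyond that sin z \<ge> 1/2 while z
  \<le> 3.\<close>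

lemma sin_ge_linear:
  assumes "0 \<le> z" "z \<le> 3 * pi / 4"
  shows "z / 6 \<le> sin z"
proof (cases "z \<le> pi / 6")
  case True
  have "sin 0 - 0 / 2 \<le> sin z - z / 2"
  proof (rule DERIV_nonneg_imp_nondecreasing[OF assms(1), where f = "\<lambda>z. sin z - z / 2"])
    fix x assume x: "0 \<le> x" "x \<le> z"
    have "cos x \<ge> cos (pi / 3)" using x True pi_gt_zero by (intro cos_monotone_0_pi_le) linarith+
    then have "cos x - 1 / 2 \<ge> 0" by (simp add: cos_60)
    moreover have "((\<lambda>z. sin z - z / 2) has_real_derivative cos x - 1 / 2) (at x)"
      by (auto intro!: derivative_eq_intros)
    ultimately show "\<exists>y. ((\<lambda>z. sin z - z / 2) has_real_derivative y) (at x) \<and> 0 \<le> y" by blast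
  qed
  then show ?thesis using assms by simp
next
  case False
  have "sin z \<ge> 1 / 2"
  proof (cases "z \<le> pi / 2")
    case True
    have "sin (pi / 6) \<le> sin z" using True False pi_gt_zero by (intro sin_monotone_2pi_le) linarith+
    then show ?thesis by (simp add: sin_30)
  next
    case z: False
    have "sin (pi / 6) \<le> sin (pi - z)" using z assms pi_gt_zero by (intro sin_monotone_2pi_le) linarith+
    then show ?thesis by (simp add: sin_30)
  qed
  moreover have "z \<le> 3" using assms pi_less_4 by simp
  ultimately show ?thesis by simp
qed

text \<open>The product formula for a difference of cosines, with the linear lower bound on both
  sines; 72 = 12 * 12 / 2. The restriction \<alpha> \<le> pi/2 keeps (\<alpha> + \<theta>) / 2 away
  from pi, where the first sine vanishes.\<close>

lemma cos_diff_lower: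
  assumes "0 \<le> \<alpha>" "\<alpha> \<le> pi / 2" "0 \<le> \<theta>" "\<theta> \<le> pi"
  shows "(\<alpha> + \<theta>) * \<bar>\<alpha> - \<theta>\<bar> / 72 \<le> \<bar>cos \<alpha> - cos \<theta>\<bar>"
proof -
  have 1: "(\<alpha> + \<theta>) / 12 \<le> sin ((\<alpha> + \<theta>) / 2)"
    using sin_ge_linear[of "(\<alpha> + \<theta>) / 2"] assms by simp
  have 2: "\<bar>\<alpha> - \<theta>\<bar> / 12 \<le> \<bar>sin ((\<theta> - \<alpha>) / 2)\<bar>"
  proof -
    have "\<bar>\<alpha> - \<theta>\<bar> / 12 \<le> sin (\<bar>\<theta> - \<alpha>\<bar> / 2)"
    proof -
      have "d / 2 \<le> 3 * pi / 4" if "d \<le> pi" for d using that pi_gt_zero by linarith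
      moreover have "\<bar>\<theta> - \<alpha>\<bar> \<le> pi" using assms by auto
      ultimately have "\<bar>\<theta> - \<alpha>\<bar> / 2 \<le> 3 * pi / 4" by blast
      from sin_ge_linear[OF _ this] show ?thesis by (simp add: abs_minus_commute)
    qed
    also have "\<dots> \<le> \<bar>sin ((\<theta> - \<alpha>) / 2)\<bar>"
    proof (cases "\<theta> \<ge> \<alpha>")
      case False
      then have "\<bar>\<theta> - \<alpha>\<bar> / 2 = - ((\<theta> - \<alpha>) / 2)" by (simp add: field_simps)
      then show ?thesis by (simp only: sin_minus abs_ge_minus_self)
    qed simp
    finally show ?thesis .
  qed
  have "(\<alpha> + \<theta>) / 12 * (\<bar>\<alpha> - \<theta>\<bar> / 12) \<le> sin ((\<alpha> + \<theta>) / 2) * \<bar>sin ((\<theta> - \<alpha>) / 2)\<bar>"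
    by (rule mult_mono[OF 1 2]) (use 1 assms in auto)
  moreover have "\<bar>cos \<alpha> - cos \<theta>\<bar> = 2 * (sin ((\<alpha> + \<theta>) / 2) * \<bar>sin ((\<theta> - \<alpha>) / 2)\<bar>)"
    using 1 assms by (simp add: cos_diff_cos abs_mult)
  ultimately show ?thesis by simp
qed

lemma one_minus_cos_le:
  assumes "0 \<le> (\<alpha> :: real)" shows "1 - cos \<alpha> \<le> \<alpha>"
proof -
  have "1 - cos \<alpha> = 2 * (sin (\<alpha> / 2) * sin (\<alpha> / 2))" using cos_diff_cos[of 0 \<alpha>] by simp
  also have "\<dots> \<le> 2 * (\<bar>sin (\<alpha> / 2)\<bar> * \<bar>sin (\<alpha> / 2)\<bar>)" by (simp add: abs_mult[symmetric])
  also have "\<dots> \<le> 2 * (\<bar>\<alpha> / 2\<bar> * 1)" by (intro mult_left_mono mult_mono abs_sin_x_le_abs_x) auto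
  finally show ?thesis using assms by simp
qed

lemma gker_minus: "l > 0 \<Longrightarrow> gker l N (-x) (-t) = gker l N x t"
proof -
  assume l: "l > 0"
  have e: "(-1::real) ^ k * a * ((-1) ^ k * b) = a * b" for k a b
    by (cases "even k") auto
  show ?thesis by (simp only: gker_def ng_parity[OF l] e)
qed

text \<open>The two halves of |K| = O(min(N, 1 / |\<alpha> - \<theta>|)), up to amplitudes. The
  first adds up termwise bounds. The second divides the Christoffel-Darboux formula by cos \<alpha>
  - cos \<theta>, which is of size (\<alpha> + \<theta>) |\<alpha> - \<theta>|, so the numerator has
  to supply a factor \<alpha> + \<theta>. Points with \<alpha> > pi/2 are reflected.\<close>

lemma gker_bounds:
  assumes l: "l > 0"
  obtains C where "C > 0"
    "\<And>N \<alpha> \<theta>. N \<ge> 1 \<Longrightarrow> \<alpha> \<in> {0..pi} \<Longrightarrow> \<theta> \<in> {0..pi} \<Longrightarrow>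
       (1 / real N + sin \<alpha>) powr l * (sin \<theta> powr l * \<bar>gker l N (cos \<alpha>) (cos \<theta>)\<bar>) \<le> C * real N"
    "\<And>N \<alpha> \<theta>. N \<ge> 1 \<Longrightarrow> \<alpha> \<in> {0..pi} \<Longrightarrow> \<theta> \<in> {0..pi} \<Longrightarrow>
       (1 / real N + sin \<alpha>) powr l * (sin \<theta> powr l * \<bar>gker l N (cos \<alpha>) (cos \<theta>)\<bar>) * \<bar>\<alpha> - \<theta>\<bar> \<le> C"
proof -
  obtain C1 where C1: "C1 \<ge> 1"
    and amp: "\<And>N k x. 1 \<le> k \<Longrightarrow> k \<le> N \<Longrightarrow> x \<in> {-1..1} \<Longrightarrow> 
        (1 / real N + sqrt (1 - x\<^sup>2)) powr l * (real k powr l * \<bar>ng l k x\<bar>) \<le> C1"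
      "\<And>N k x. 1 \<le> k \<Longrightarrow> k \<le> N \<Longrightarrow> x \<in> {-1..1} \<Longrightarrow> 
        (1 / real N + sqrt (1 - x\<^sup>2)) powr l * (real k powr l * (sqrt (1 - x\<^sup>2) * \<bar>ngd l k x\<bar>)) \<le> C1 * real k"
    using ng_amplitude[OF l] by blast
  obtain C2 where C2: "C2 > 0" "\<And>n. n \<ge> 1 \<Longrightarrow> 1 / geta l n \<le> C2 * real n powr (2 * l)"
    using inverse_geta_le[OF l] by blast
  have sqs: "sqrt (1 - (cos \<alpha>)\<^sup>2) = sin \<alpha>" if "\<alpha> \<in> {0..pi}" for \<alpha>
    using that by (simp add: sin_squared_eq[symmetric] sin_ge_zero)
  have s0: "sin \<alpha> \<ge> 0" if "\<alpha> \<in> {0..pi}" for \<alpha> using that by (simp add: sin_ge_zero)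
  have cosr: "cos \<alpha> \<in> {-1..1}" for \<alpha> :: real by simp
  have e0: "geta l n > 0" for n by (rule geta_pos[OF l])
  have A: "(1 / real N + sin \<alpha>) powr l * (real k powr l * \<bar>ng l k (cos \<alpha>)\<bar>) \<le> C1" 
    if "1 \<le> k" "k \<le> N" "\<alpha> \<in> {0..pi}" for N k \<alpha>
    using amp(1)[OF that(1,2) cosr, of \<alpha>] sqs[OF that(3)] by simp
  have A': "(1 / real N + sin \<alpha>) powr l * (real k powr l * (sin \<alpha> * \<bar>ngd l k (cos \<alpha>)\<bar>)) \<le> C1 * real k"
    if "1 \<le> k" "k \<le> N" "\<alpha> \<in> {0..pi}" for N k \<alpha>
    using amp(2)[OF that(1,2) cosr, of \<alpha>] sqs[OF that(3)] by simp
  have le: "sin \<theta> powr l \<le> (1 / real N + sin \<theta>) powr l" if "\<theta> \<in> {0..pi}" for N \<theta>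
    using l s0[OF that] by (intro powr_mono2) auto
  \<comment> \<open>The first summand of \<open>K1\<close> pays for the term k = 0, which the
    amplitude bounds exclude, the second for every k \<ge> 1. The 72 in \<open>K2\<close> is that of
    \<open>cos_diff_lower\<close>.\<close>
  define K1 where "K1 = 2 powr l / geta l 0 + C1 * C1 * C2"
  define K2 where "K2 = 72 * (2 * C2 * C1\<^sup>2)"
  have K1: "K1 > 0" using C1 C2 e0 by (auto simp: K1_def less_imp_le intro!: add_nonneg_pos mult_pos_pos divide_nonneg_pos)
  have K2: "K2 > 0" using C1 C2 by (auto simp: K2_def intro!: mult_pos_pos)
  have b1: "(1 / real N + sin \<alpha>) powr l * (sin \<theta> powr l * \<bar>gker l N (cos \<alpha>) (cos \<theta>)\<bar>) \<le> 2 * K1 * real N"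
    if N: "N \<ge> 1" and \<alpha>: "\<alpha> \<in> {0..pi}" and \<theta>: "\<theta> \<in> {0..pi}" for N \<alpha> \<theta>
  proof -
    define P Q where "P = (1 / real N + sin \<alpha>) powr l" and "Q = sin \<theta> powr l"
    have PQ: "P \<ge> 0" "Q \<ge> 0" by (auto simp: P_def Q_def)
    have "1 / real N + sin \<alpha> \<le> 1 + 1" using N by (intro add_mono sin_le_one) auto
    then have P2: "P \<le> 2 powr l" using l s0[OF \<alpha>] N unfolding P_def 
      by (intro powr_mono2) auto
    have Q1: "Q \<le> 1" using l s0[OF \<theta>] powr_mono2[of l "sin \<theta>" 1] by (simp add: Q_def)
    have summand: "P * Q * \<bar>ng l k (cos \<alpha>) * ng l k (cos \<theta>) / geta l k\<bar> \<le> K1" if k: "k \<le> N" for k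
    proof (cases "k = 0")
      case True
      have "P * Q \<le> 2 powr l * 1" by (intro mult_mono P2 Q1 PQ) auto
      then have "P * Q / geta l 0 \<le> 2 powr l / geta l 0" using e0[of 0] by (simp add: divide_right_mono)
      moreover have "C1 * C1 * C2 \<ge> 0" using C1 C2 by auto
      ultimately show ?thesis using True e0[of 0] by (simp add: K1_def)
    next
      case False
      then have k1: "1 \<le> k" by simp
      define M where "M = real k powr l"
      have M: "M > 0" using k1 by (simp add: M_def)
      have M2: "1 / geta l k \<le> C2 * (M * M)" using C2(2)[OF k1] by (simp add: M_def powr_add[symmetric] mult_2[symmetric])
      have a1: "P * (M * \<bar>ng l k (cos \<alpha>)\<bar>) \<le> C1" using A[OF k1 k \<alpha>] by (simp add: P_def M_def)
      have "Q * (M * \<bar>ng l k (cos \<theta>)\<bar>) \<le> (1 / real N + sin \<theta>) powr l * (M * \<bar>ng l k (cos \<theta>)\<bar>)"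
        unfolding Q_def using le[OF \<theta>] M by (intro mult_right_mono) auto
      also have "\<dots> \<le> C1" using A[OF k1 k \<theta>] by (simp add: M_def)
      finally have a2: "Q * (M * \<bar>ng l k (cos \<theta>)\<bar>) \<le> C1" .
      have "P * Q * \<bar>ng l k (cos \<alpha>) * ng l k (cos \<theta>) / geta l k\<bar> = P * Q * (\<bar>ng l k (cos \<alpha>)\<bar> * \<bar>ng l k (cos \<theta>)\<bar>) * (1 / geta l k)"
        using e0[of k] by (simp add: abs_mult)
      also have "\<dots> \<le> P * Q * (\<bar>ng l k (cos \<alpha>)\<bar> * \<bar>ng l k (cos \<theta>)\<bar>) * (C2 * (M * M))"
        using PQ by (intro mult_left_mono M2) auto
      also have "\<dots> = C2 * ((P * (M * \<bar>ng l k (cos \<alpha>)\<bar>)) * (Q * (M * \<bar>ng l k (cos \<theta>)\<bar>)))" by (simp only: mult_ac)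
      also have "\<dots> \<le> C2 * (C1 * C1)" using C1 C2 PQ M by (intro mult_left_mono mult_mono a1 a2) auto
      also have "\<dots> \<le> K1" using e0[of 0] by (simp add: K1_def mult_ac)
      finally show ?thesis .
    qed
    have "P * (Q * \<bar>gker l N (cos \<alpha>) (cos \<theta>)\<bar>) \<le> P * Q * (\<Sum>k\<le>N. \<bar>ng l k (cos \<alpha>) * ng l k (cos \<theta>) / geta l k\<bar>)"
      unfolding gker_def mult.assoc using PQ by (intro mult_left_mono sum_abs) auto
    also have "\<dots> = (\<Sum>k\<le>N. P * Q * \<bar>ng l k (cos \<alpha>) * ng l k (cos \<theta>) / geta l k\<bar>)" by (rule sum_distrib_left)
    also have "\<dots> \<le> of_nat (card {..N}) * K1" by (rule sum_bounded_above) (use summand in auto)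
    also have "\<dots> \<le> 2 * K1 * real N" using N K1 by (simp add: algebra_simps)
    finally show ?thesis by (simp add: P_def Q_def)
  qed
  have b2: "(1 / real N + sin \<alpha>) powr l * (sin \<theta> powr l * \<bar>gker l N (cos \<alpha>) (cos \<theta>)\<bar>) * \<bar>\<alpha> - \<theta>\<bar> \<le> K2"
    if N: "N \<ge> 1" and \<alpha>: "\<alpha> \<in> {0..pi / 2}" and \<theta>: "\<theta> \<in> {0..pi}" for N \<alpha> \<theta>
  proof (cases "\<alpha> + \<theta> = 0")
    case True then have "\<alpha> = 0" "\<theta> = 0" using \<alpha> \<theta> by auto
    then show ?thesis using K2 by simp
  next
    case False
    then have pos: "\<alpha> + \<theta> > 0" using \<alpha> \<theta> by auto
    have \<alpha>': "\<alpha> \<in> {0..pi}" using \<alpha> by auto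
    define P Q where "P = (1 / real N + sin \<alpha>) powr l" and "Q = sin \<theta> powr l"
    have PQ: "P \<ge> 0" "Q \<ge> 0" by (auto simp: P_def Q_def)
    define M where "M = real N powr l"
    have M: "M > 0" using N by (simp add: M_def)
    have M2: "1 / geta l N \<le> C2 * (M * M)" using C2(2)[OF N] by (simp add: M_def powr_add[symmetric] mult_2[symmetric])
    \<comment> \<open>Replacing p_(N+1) by this difference leaves the antisymmetric numerator
      unchanged. Since the difference vanishes at 1, it yields a factor \<beta> at cos \<beta>,
      hence \<alpha> + \<theta> in the numerator.\<close>
    define \<Delta> where "\<Delta> = (\<lambda>x. ng l (Suc N) x - ng l N x)"
    have \<Delta>: "(1 / real N + sin \<beta>) powr l * (M * \<bar>\<Delta> (cos \<beta>)\<bar>) \<le> 2 * C1 * \<beta>" if \<beta>: "\<beta> \<in> {0..pi}" for \<beta>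
    proof -
      define R where "R = (1 / real N + sin \<beta>) powr l"
      have R: "R \<ge> 0" by (simp add: R_def)
      have N2: "real N + 2 * l \<ge> real N" "real N + 2 * l > 0" using l N by auto
      have "\<Delta> (cos \<beta>) = - (1 - cos \<beta>) * ng l N (cos \<beta>) - (sin \<beta>)\<^sup>2 * ngd l N (cos \<beta>) / (real N + 2 * l)"
        by (simp add: \<Delta>_def ng_Suc sin_squared_eq algebra_simps)
      also have "\<bar>\<dots>\<bar> \<le> \<bar>- (1 - cos \<beta>) * ng l N (cos \<beta>)\<bar> + \<bar>(sin \<beta>)\<^sup>2 * ngd l N (cos \<beta>) / (real N + 2 * l)\<bar>"
        by (rule abs_triangle_ineq4)
      also have "\<dots> = (1 - cos \<beta>) * \<bar>ng l N (cos \<beta>)\<bar> + sin \<beta> / (real N + 2 * l) * (sin \<beta> * \<bar>ngd l N (cos \<beta>)\<bar>)"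
        using N2 s0[OF \<beta>] by (simp add: abs_mult power2_eq_square)
      also have "\<dots> \<le> \<beta> * \<bar>ng l N (cos \<beta>)\<bar> + \<beta> / real N * (sin \<beta> * \<bar>ngd l N (cos \<beta>)\<bar>)"
        using N2 s0[OF \<beta>] \<beta> N sin_x_le_x[of \<beta>]
        by (intro add_mono mult_right_mono one_minus_cos_le frac_le) auto
      finally have "R * (M * \<bar>\<Delta> (cos \<beta>)\<bar>) \<le> R * (M * (\<beta> * \<bar>ng l N (cos \<beta>)\<bar> + \<beta> / real N * (sin \<beta> * \<bar>ngd l N (cos \<beta>)\<bar>)))"
        using R M by (intro mult_left_mono) auto
      also have "\<dots> = \<beta> * (R * (M * \<bar>ng l N (cos \<beta>)\<bar>)) + \<beta> / real N * (R * (M * (sin \<beta> * \<bar>ngd l N (cos \<beta>)\<bar>)))"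
        by (simp add: algebra_simps)
      also have "\<dots> \<le> \<beta> * C1 + \<beta> / real N * (C1 * real N)"
        using A[OF N order_refl \<beta>] A'[OF N order_refl \<beta>] \<beta> unfolding R_def M_def
        by (intro add_mono mult_left_mono) auto
      also have "\<dots> = 2 * C1 * \<beta>" using N by simp
      finally show ?thesis by (simp add: R_def)
    qed
    have mono: "Q * (M * y) \<le> (1 / real N + sin \<theta>) powr l * (M * y)" if "y \<ge> 0" for y
      unfolding Q_def using le[OF \<theta>] M that by (intro mult_right_mono) auto
    have q1: "P * (M * \<bar>ng l N (cos \<alpha>)\<bar>) \<le> C1" using A[OF N order_refl \<alpha>'] by (simp add: P_def M_def)
    have q2: "Q * (M * \<bar>ng l N (cos \<theta>)\<bar>) \<le> C1" using A[OF N order_refl \<theta>] mono[of "\<bar>ng l N (cos \<theta>)\<bar>"] by (simp add: M_def)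
    have d1: "P * (M * \<bar>\<Delta> (cos \<alpha>)\<bar>) \<le> 2 * C1 * \<alpha>" using \<Delta>[OF \<alpha>'] by (simp add: P_def)
    have d2: "Q * (M * \<bar>\<Delta> (cos \<theta>)\<bar>) \<le> 2 * C1 * \<theta>" using \<Delta>[OF \<theta>] mono[of "\<bar>\<Delta> (cos \<theta>)\<bar>"] by simp
    define x t where "x = cos \<alpha>" and "t = cos \<theta>"
    have NN: "real N + l > 0" using N l by simp
    have coef: "\<bar>(real N + 2 * l) / (2 * (real N + l) * geta l N)\<bar> \<le> 1 / geta l N"
    proof -
      have "(real N + 2 * l) / (2 * (real N + l) * geta l N) = (real N + 2 * l) / (2 * (real N + l)) * (1 / geta l N)" by simp
      also have "\<dots> \<le> 1 * (1 / geta l N)"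
        using NN l e0[of N] by (intro mult_right_mono) (auto simp: field_simps)
      finally show ?thesis using NN l e0[of N] by simp
    qed
    have "\<bar>x - t\<bar> * \<bar>gker l N x t\<bar> = \<bar>(real N + 2 * l) / (2 * (real N + l) * geta l N)\<bar> * \<bar>\<Delta> x * ng l N t - ng l N x * \<Delta> t\<bar>"
      unfolding abs_mult[symmetric] christoffel_darboux[OF l] by (simp add: \<Delta>_def algebra_simps)
    also have "\<dots> \<le> C2 * (M * M) * (\<bar>\<Delta> x\<bar> * \<bar>ng l N t\<bar> + \<bar>ng l N x\<bar> * \<bar>\<Delta> t\<bar>)"
      using abs_triangle_ineq4[of "\<Delta> x * ng l N t" "ng l N x * \<Delta> t"] C2(1) M
      by (intro mult_mono order_trans[OF coef M2]) (auto simp: abs_mult)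
    finally have "P * Q * (\<bar>x - t\<bar> * \<bar>gker l N x t\<bar>) \<le> P * Q * (C2 * (M * M) * (\<bar>\<Delta> x\<bar> * \<bar>ng l N t\<bar> + \<bar>ng l N x\<bar> * \<bar>\<Delta> t\<bar>))"
      using PQ by (intro mult_left_mono) auto
    also have "\<dots> = C2 * ((P * (M * \<bar>\<Delta> x\<bar>)) * (Q * (M * \<bar>ng l N t\<bar>)) + (P * (M * \<bar>ng l N x\<bar>)) * (Q * (M * \<bar>\<Delta> t\<bar>)))"
      by (simp add: algebra_simps)
    also have "\<dots> \<le> C2 * ((2 * C1 * \<alpha>) * C1 + C1 * (2 * C1 * \<theta>))"
      unfolding x_def t_def using C1 C2 PQ M \<alpha> \<theta>
      by (intro mult_left_mono add_mono mult_mono q1 q2 d1 d2) auto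
    also have "\<dots> = (2 * C2 * C1\<^sup>2) * (\<alpha> + \<theta>)" by (simp add: power2_eq_square algebra_simps)
    finally have main: "P * Q * (\<bar>x - t\<bar> * \<bar>gker l N x t\<bar>) \<le> (2 * C2 * C1\<^sup>2) * (\<alpha> + \<theta>)" .
    have "P * Q * ((\<alpha> + \<theta>) * \<bar>\<alpha> - \<theta>\<bar> / 72 * \<bar>gker l N x t\<bar>) \<le> P * Q * (\<bar>x - t\<bar> * \<bar>gker l N x t\<bar>)"
      unfolding x_def t_def using PQ \<alpha> \<theta> by (intro mult_left_mono mult_right_mono cos_diff_lower) auto
    then have "(\<alpha> + \<theta>) * (P * (Q * \<bar>gker l N x t\<bar>) * \<bar>\<alpha> - \<theta>\<bar>) \<le> (\<alpha> + \<theta>) * K2"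
      using main by (simp add: K2_def mult_ac)
    then show ?thesis using pos by (simp add: P_def Q_def x_def t_def)
  qed
  show thesis
  proof (rule that[of "2 * K1 + K2"])
    show "2 * K1 + K2 > 0" using K1 K2 by simp
  next
    fix N :: nat and \<alpha> \<theta> :: real assume *: "N \<ge> 1" "\<alpha> \<in> {0..pi}" "\<theta> \<in> {0..pi}"
    have "2 * K1 * real N \<le> (2 * K1 + K2) * real N" using K2 by (intro mult_right_mono) auto
    then show "(1 / real N + sin \<alpha>) powr l * (sin \<theta> powr l * \<bar>gker l N (cos \<alpha>) (cos \<theta>)\<bar>) \<le> (2 * K1 + K2) * real N"
      using b1[OF *] by linarith
    have "(1 / real N + sin \<alpha>) powr l * (sin \<theta> powr l * \<bar>gker l N (cos \<alpha>) (cos \<theta>)\<bar>) * \<bar>\<alpha> - \<theta>\<bar> \<le> K2"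
    proof (cases "\<alpha> \<le> pi / 2")
      case True then show ?thesis using b2[of N \<alpha> \<theta>] * by auto
    next
      case False
      have "\<bar>pi - \<alpha> - (pi - \<theta>)\<bar> = \<bar>\<alpha> - \<theta>\<bar>" by linarith
      moreover have "pi - \<alpha> \<in> {0..pi / 2}" "pi - \<theta> \<in> {0..pi}" using False * by auto
      note b2[OF *(1) this]
      ultimately show ?thesis by (simp add: gker_minus[OF l])
    qed
    then show "(1 / real N + sin \<alpha>) powr l * (sin \<theta> powr l * \<bar>gker l N (cos \<alpha>) (cos \<theta>)\<bar>) * \<bar>\<alpha> - \<theta>\<bar> \<le> 2 * K1 + K2"
      using K1 by linarith
  qed
qed

text \<open>For p < 1 the integrand is singular at \<alpha>. The antiderivatives on the two sides
  are continuous up to \<alpha>, which is all that the fundamental theorem in its interior form asks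
  for.\<close>

lemma has_integral_abs_powr:
  fixes a b \<alpha> p :: real
  assumes p: "p > 0" and \<alpha>: "a \<le> \<alpha>" "\<alpha> \<le> b"
  shows "((\<lambda>\<theta>. \<bar>\<theta> - \<alpha>\<bar> powr (p - 1)) has_integral ((\<alpha> - a) powr p / p + (b - \<alpha>) powr p / p)) {a..b}"
proof (rule has_integral_combine[OF \<alpha>])
  have c1: "continuous_on {a..\<alpha>} (\<lambda>\<theta>. - ((\<alpha> - \<theta>) powr p / p))"
    by (intro continuous_intros continuous_on_powr') (use p in auto)
  have "((\<lambda>\<theta>. \<bar>\<theta> - \<alpha>\<bar> powr (p - 1)) has_integral (- ((\<alpha> - \<alpha>) powr p / p) - - ((\<alpha> - a) powr p / p))) {a..\<alpha>}"
  proof (rule fundamental_theorem_of_calculus_interior[OF \<alpha>(1) c1])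
    fix x assume x: "x \<in> {a<..<\<alpha>}"
    have "((\<lambda>\<theta>. - ((\<alpha> - \<theta>) powr p / p)) has_real_derivative \<bar>x - \<alpha>\<bar> powr (p - 1)) (at x)"
      using DERIV_powr[of "\<lambda>\<theta>. \<alpha> - \<theta>" "-1" x "\<lambda>_. p" 0] x p
      by (auto intro!: derivative_eq_intros simp: field_simps powr_diff abs_if)
    then show "((\<lambda>\<theta>. - ((\<alpha> - \<theta>) powr p / p)) has_vector_derivative \<bar>x - \<alpha>\<bar> powr (p - 1)) (at x)"
      by (simp add: has_real_derivative_iff_has_vector_derivative)
  qed
  then show "((\<lambda>\<theta>. \<bar>\<theta> - \<alpha>\<bar> powr (p - 1)) has_integral (\<alpha> - a) powr p / p) {a..\<alpha>}" by simp
  have c2: "continuous_on {\<alpha>..b} (\<lambda>\<theta>. (\<theta> - \<alpha>) powr p / p)"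
    by (intro continuous_intros continuous_on_powr') (use p in auto)
  have "((\<lambda>\<theta>. \<bar>\<theta> - \<alpha>\<bar> powr (p - 1)) has_integral ((b - \<alpha>) powr p / p - (\<alpha> - \<alpha>) powr p / p)) {\<alpha>..b}"
  proof (rule fundamental_theorem_of_calculus_interior[OF \<alpha>(2) c2])
    fix x assume x: "x \<in> {\<alpha><..<b}"
    have "((\<lambda>\<theta>. (\<theta> - \<alpha>) powr p / p) has_real_derivative \<bar>x - \<alpha>\<bar> powr (p - 1)) (at x)"
      using x p by (auto intro!: derivative_eq_intros simp: field_simps powr_diff abs_if)
    then show "((\<lambda>\<theta>. (\<theta> - \<alpha>) powr p / p) has_vector_derivative \<bar>x - \<alpha>\<bar> powr (p - 1)) (at x)"
      by (simp add: has_real_derivative_iff_has_vector_derivative)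
  qed
  then show "((\<lambda>\<theta>. \<bar>\<theta> - \<alpha>\<bar> powr (p - 1)) has_integral (b - \<alpha>) powr p / p) {\<alpha>..b}" by simp
qed

text \<open>Of the density sin^(2 l) \<theta>, one factor sin^l \<theta> is consumed by the kernel
  bounds. The other is at most a constant times (1/N + sin \<alpha>)^l + |\<theta> - \<alpha>|^l,
  since sine is 1-Lipschitz. The two summands lead to \<open>E1\<close> and
  \<open>E2\<close>.\<close>

lemma lebesgue_constant:
  assumes l: "l > 0"
  obtains C where "C > 0" "\<And>N x. N \<ge> 1 \<Longrightarrow> x \<in> {-1..1} \<Longrightarrow> gint l (\<lambda>t. \<bar>gker l N x t\<bar>) \<le> C * real N powr l"
proof -
  obtain C where C: "C > 0"
    and b1: "\<And>N \<alpha> \<theta>. N \<ge> 1 \<Longrightarrow> \<alpha> \<in> {0..pi} \<Longrightarrow> \<theta> \<in> {0..pi} \<Longrightarrow>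
       (1 / real N + sin \<alpha>) powr l * (sin \<theta> powr l * \<bar>gker l N (cos \<alpha>) (cos \<theta>)\<bar>) \<le> C * real N"
    and b2: "\<And>N \<alpha> \<theta>. N \<ge> 1 \<Longrightarrow> \<alpha> \<in> {0..pi} \<Longrightarrow> \<theta> \<in> {0..pi} \<Longrightarrow>
       (1 / real N + sin \<alpha>) powr l * (sin \<theta> powr l * \<bar>gker l N (cos \<alpha>) (cos \<theta>)\<bar>) * \<bar>\<alpha> - \<theta>\<bar> \<le> C"
    using gker_bounds[OF l] by blast
  \<comment> \<open>For 0 < \<mu> \<le> 1 one has min(N, 1/u) \<le> N^\<mu> u^(\<mu> - 1). A
    positive \<mu> makes the singularity integrable in place of a logarithm, and \<mu> \<le> l keeps
    the price below N^l.\<close>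
  define \<mu> where "\<mu> = min l 1"
  have \<mu>: "0 < \<mu>" "\<mu> \<le> 1" "\<mu> \<le> l" using l by (auto simp: \<mu>_def)
  define K where "K = 2 powr l * C * (2 * pi powr \<mu> / \<mu> + 2 * pi powr l / l)"
  show thesis
  proof (rule that[of K])
    show "K > 0" using C l \<mu> by (auto simp: K_def intro!: mult_pos_pos add_pos_pos divide_pos_pos)
    fix N :: nat and x :: real assume N: "N \<ge> 1" and x: "x \<in> {-1..1}"
    define \<alpha> where "\<alpha> = arccos x"
    have \<alpha>: "\<alpha> \<in> {0..pi}" "x = cos \<alpha>" using x by (auto simp: \<alpha>_def arccos_bounded)
    define h where "h = (\<lambda>\<theta>. \<bar>gker l N x (cos \<theta>)\<bar> * sin \<theta> powr (2 * l))"
    have hint: "h integrable_on {0..pi}"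
      unfolding h_def by (rule gint_integrable[OF l]) (intro continuous_intros continuous_on_gker)
    define g where "g = (\<lambda>\<theta>. 2 powr l * C * real N powr l * (\<bar>\<theta> - \<alpha>\<bar> powr (\<mu> - 1) + \<bar>\<theta> - \<alpha>\<bar> powr (l - 1)))"
    have le: "h \<theta> \<le> g \<theta>" if \<theta>: "\<theta> \<in> {0..pi}" "\<theta> \<noteq> \<alpha>" for \<theta>
    proof -
      define u where "u = \<bar>\<theta> - \<alpha>\<bar>"
      define P where "P = (1 / real N + sin \<alpha>) powr l"
      define S where "S = sin \<theta> powr l"
      define D where "D = \<bar>gker l N x (cos \<theta>)\<bar>"
      have u: "u > 0" using \<theta> by (simp add: u_def)
      have D: "D \<ge> 0" by (simp add: D_def)
      have S: "S \<ge> 0" by (simp add: S_def)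
      have s\<alpha>: "sin \<alpha> \<ge> 0" using \<alpha> by (simp add: sin_ge_zero)
      have base: "1 / real N + sin \<alpha> > 0" using N s\<alpha> by (intro add_pos_nonneg) auto
      have P: "P > 0" using base by (simp add: P_def)
      have B1: "P * (S * D) \<le> C * real N" using b1[OF N \<alpha>(1) \<theta>(1)] by (simp add: P_def S_def D_def \<alpha>)
      have B2: "P * (S * D) * u \<le> C" using b2[OF N \<alpha>(1) \<theta>(1)] by (simp add: P_def S_def D_def \<alpha> u_def abs_minus_commute)
      have SP: "S \<le> 2 powr l * (P + u powr l)"
      proof -
        have "sin \<theta> \<le> sin \<alpha> + u"
        proof -
          have "sin \<theta> - sin \<alpha> = 2 * sin ((\<theta> - \<alpha>) / 2) * cos ((\<theta> + \<alpha>) / 2)" by (rule sin_diff_sin)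
          also have "\<dots> \<le> \<bar>2 * sin ((\<theta> - \<alpha>) / 2) * cos ((\<theta> + \<alpha>) / 2)\<bar>" by simp
          also have "\<dots> = 2 * (\<bar>sin ((\<theta> - \<alpha>) / 2)\<bar> * \<bar>cos ((\<theta> + \<alpha>) / 2)\<bar>)" by (simp add: abs_mult)
          also have "\<dots> \<le> 2 * (\<bar>(\<theta> - \<alpha>) / 2\<bar> * 1)" by (intro mult_left_mono mult_mono abs_sin_x_le_abs_x) auto
          finally show ?thesis by (simp add: u_def)
        qed
        also have "\<dots> \<le> (1 / real N + sin \<alpha>) + u" by simp
        also have "\<dots> \<le> 2 * max (1 / real N + sin \<alpha>) u" by (simp add: max_def)
        finally have "S \<le> (2 * max (1 / real N + sin \<alpha>) u) powr l"
          unfolding S_def using l \<theta> by (intro powr_mono2) (auto simp: sin_ge_zero)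
        also have "\<dots> = 2 powr l * (max (1 / real N + sin \<alpha>) u) powr l" using base by (simp add: powr_mult)
        also have "\<dots> \<le> 2 powr l * (P + u powr l)" by (intro mult_left_mono) (auto simp: P_def max_def)
        finally show ?thesis .
      qed
      have E1: "P * (S * D) \<le> C * (real N powr l * u powr (\<mu> - 1))"
      proof -
        have N\<mu>: "real N powr \<mu> \<le> real N powr l" using N \<mu> by (intro powr_mono) auto
        have "P * (S * D) \<le> C * (real N powr \<mu> * u powr (\<mu> - 1))"
        proof (cases "real N * u \<le> 1")
          case True
          have "real N = real N powr \<mu> * real N powr (1 - \<mu>)" using N by (simp flip: powr_add)
          also have "\<dots> \<le> real N powr \<mu> * (1 / u) powr (1 - \<mu>)"
            using True N u \<mu> by (intro mult_left_mono powr_mono2) (auto simp: field_simps)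
          also have "(1 / u) powr (1 - \<mu>) = u powr (\<mu> - 1)" using u by (simp add: powr_divide powr_minus_divide[symmetric])
          finally have "C * real N \<le> C * (real N powr \<mu> * u powr (\<mu> - 1))" using C by simp
          then show ?thesis using B1 by linarith
        next
          case False
          have "P * (S * D) \<le> C * (1 / u)" using B2 u by (simp add: field_simps)
          also have "1 / u = (1 / u) powr \<mu> * u powr (\<mu> - 1)" 
            using u by (simp add: powr_divide powr_diff)
          also have "C * \<dots> \<le> C * (real N powr \<mu> * u powr (\<mu> - 1))"
            using False N u \<mu> C by (intro mult_left_mono mult_right_mono powr_mono2) (auto simp: field_simps)
          finally show ?thesis .
        qed
        also have "\<dots> \<le> C * (real N powr l * u powr (\<mu> - 1))"
          using C N\<mu> by (intro mult_left_mono mult_right_mono) auto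
        finally show ?thesis .
      qed
      \<comment> \<open>The amplitude factor \<open>P\<close> is missing on the left; it is inserted
        at the price N^l, because N (1/N + sin \<alpha>) \<ge> 1.\<close>
      have E2: "u powr l * (S * D) \<le> C * (real N powr l * u powr (l - 1))"
      proof -
        have "1 \<le> real N powr l * P"
        proof -
          have "1 \<le> real N * (1 / real N + sin \<alpha>)" using N s\<alpha> by (simp add: field_simps)
          then have "1 powr l \<le> (real N * (1 / real N + sin \<alpha>)) powr l" using l by (intro powr_mono2) auto
          also have "\<dots> = real N powr l * P" using base by (simp add: powr_mult P_def)
          finally show ?thesis by simp
        qed
        then have "S * D * 1 \<le> S * D * (real N powr l * P)" using S D by (intro mult_left_mono) auto
        then have "S * D * u \<le> S * D * (real N powr l * P) * u" using u by (intro mult_right_mono) auto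
        then have "S * D * u \<le> real N powr l * (P * (S * D) * u)" by (simp only: mult_ac)
        also have "\<dots> \<le> real N powr l * C" by (intro mult_left_mono B2) auto
        finally have "u powr (l - 1) * (S * D * u) \<le> u powr (l - 1) * (real N powr l * C)" by (intro mult_left_mono) auto
        moreover have "u powr l = u powr (l - 1) * u" using u by (simp add: powr_diff)
        ultimately show ?thesis by (simp add: mult_ac)
      qed
      have "h \<theta> = S * (S * D)" by (simp add: h_def S_def D_def powr_add[symmetric] mult_2 mult_ac)
      also have "\<dots> \<le> 2 powr l * (P + u powr l) * (S * D)" using S D by (intro mult_right_mono SP) auto
      also have "\<dots> = 2 powr l * (P * (S * D) + u powr l * (S * D))" by (simp add: algebra_simps)
      also have "\<dots> \<le> 2 powr l * (C * (real N powr l * u powr (\<mu> - 1)) + C * (real N powr l * u powr (l - 1)))"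
        by (intro mult_left_mono add_mono E1 E2) auto
      also have "\<dots> = g \<theta>" by (simp add: g_def u_def algebra_simps)
      finally show ?thesis .
    qed
    define J where "J = 2 powr l * C * real N powr l * (((\<alpha> - 0) powr \<mu> / \<mu> + (pi - \<alpha>) powr \<mu> / \<mu>) + ((\<alpha> - 0) powr l / l + (pi - \<alpha>) powr l / l))"
    have gi: "(g has_integral J) {0..pi}"
      unfolding g_def J_def using \<alpha> \<mu> l
      by (intro has_integral_mult_right has_integral_add has_integral_abs_powr) auto
    \<comment> \<open>At \<theta> = \<alpha> the convention \<open>0 powr x = 0\<close> gives
      \<open>g\<close> the value 0, which need not dominate \<open>h\<close>; the majorant is
      altered at that point.\<close>
    then have "((\<lambda>\<theta>. if \<theta> = \<alpha> then h \<alpha> else g \<theta>) has_integral J) {0..pi}"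
      by (rule has_integral_spike_finite[of "{\<alpha>}", rotated 2]) auto
    then have "integral {0..pi} h \<le> J"
      by (rule has_integral_le[OF integrable_integral[OF hint]]) (use le in auto)
    also have "J \<le> 2 powr l * C * real N powr l * ((pi powr \<mu> / \<mu> + pi powr \<mu> / \<mu>) + (pi powr l / l + pi powr l / l))"
      unfolding J_def using \<alpha> \<mu> l C
      by (intro mult_left_mono add_mono divide_right_mono powr_mono2) auto
    also have "\<dots> = K * real N powr l" by (simp add: K_def algebra_simps)
    finally show "gint l (\<lambda>t. \<bar>gker l N x t\<bar>) \<le> K * real N powr l" by (simp add: gint_def h_def)
  qed
qed

section \<open>Jackson's theorem on an interval\<close>

text \<open>Chebyshev polynomials of the first kind, from cos ((k + 2) \<theta>) = 2 cos \<theta>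
  cos ((k + 1) \<theta>) - cos (k \<theta>).\<close>

lemma cos_multiple_poly: "\<exists>p :: real poly. degree p \<le> m \<and> (\<forall>\<theta>. poly p (cos \<theta>) = cos (real m * \<theta>))"
proof (induction m rule: less_induct)
  case (less m)
  consider "m = 0" | "m = 1" | k where "m = Suc (Suc k)" by (metis One_nat_def not0_implies_Suc)
  then show ?case
  proof cases
    case 1 then show ?thesis by (intro exI[of _ 1]) simp
  next
    case 2 then show ?thesis by (intro exI[of _ "[:0, 1:]"]) simp
  next
    case 3
    obtain p where p: "degree p \<le> Suc k" "\<And>\<theta>. poly p (cos \<theta>) = cos (real (Suc k) * \<theta>)" using less[of "Suc k"] 3 by auto
    obtain q where q: "degree q \<le> k" "\<And>\<theta>. poly q (cos \<theta>) = cos (real k * \<theta>)" using less[of k] 3 by auto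
    have "degree ([:0, 2:] * p - q) \<le> m"
      using p(1) q(1) 3 degree_mult_le[of "[:0, 2 :: real:]" p] by (intro degree_diff_le) auto
    moreover have "poly ([:0, 2:] * p - q) (cos \<theta>) = cos (real m * \<theta>)" for \<theta>
    proof -
      define \<phi> where "\<phi> = real (Suc k) * \<theta>"
      have a: "real k * \<theta> = \<phi> - \<theta>" "real m * \<theta> = \<phi> + \<theta>" by (auto simp: \<phi>_def 3 algebra_simps)
      have "poly ([:0, 2:] * p - q) (cos \<theta>) = 2 * cos \<theta> * cos \<phi> - cos (\<phi> - \<theta>)"
        by (simp add: p(2) q(2) a(1) \<phi>_def[symmetric] del: of_nat_Suc)
      then show ?thesis unfolding a by (simp add: cos_add cos_diff)
    qed
    ultimately show ?thesis by blast
  qed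
qed

lemma integral_cos_shift:
  fixes m :: int
  shows "((\<lambda>s. cos (of_int m * (s - \<alpha>))) has_integral (if m = 0 then 2 * pi else 0)) {-pi..pi}"
proof (cases "m = 0")
  case True
  then show ?thesis using has_integral_const_real[of "1::real" "-pi" pi] pi_gt_zero by simp
next
  case False
  have "((\<lambda>s. cos (of_int m * (s - \<alpha>))) has_integral 
     (sin (of_int m * (pi - \<alpha>)) / of_int m - sin (of_int m * (- pi - \<alpha>)) / of_int m)) {-pi..pi}"
  proof (rule fundamental_theorem_of_calculus)
    fix x
    have "((\<lambda>s. sin (of_int m * (s - \<alpha>)) / of_int m) has_real_derivative cos (of_int m * (x - \<alpha>))) (at x within {-pi..pi})"
      using False by (auto intro!: derivative_eq_intros)
    then show "((\<lambda>s. sin (of_int m * (s - \<alpha>)) / of_int m) has_vector_derivative cos (of_int m * (x - \<alpha>))) (at x within {-pi..pi})"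
      by (simp add: has_real_derivative_iff_has_vector_derivative)
  qed simp
  moreover have "sin (of_int m * (pi - \<alpha>)) = sin (of_int m * (- pi - \<alpha>))"
  proof -
    have "of_int m * (pi - \<alpha>) = of_int m * (- pi - \<alpha>) + 2 * pi * of_int m" by (simp add: algebra_simps)
    then show ?thesis by (simp add: sin_int_2pin[of m] sin_add cos_int_2pin)
  qed
  ultimately show ?thesis using False by simp
qed

text \<open>The Fejer--Korovkin kernel \<open>\<bar>\<Sum>\<^sub>k a\<^sub>k e\<^sup>i\<^sup>k\<^sup>z\<bar>\<^sup>2\<close> with \<open>a\<^sub>k = sin ((k + 1) \<delta>)\<close>, \<open>\<delta> = \<pi> / (n + 2)\<close>: since
  \<open>a\<^sub>k\<^sub>+\<^sub>1 + a\<^sub>k\<^sub>-\<^sub>1 = 2 cos \<delta> a\<^sub>k\<close> with zero boundary values, its first Fourier coefficient is exactly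
  \<open>cos \<delta>\<close> times its mean, which controls its first moment.\<close>

lemma positive_cosine_kernel:
  fixes n :: nat
  defines "\<delta> \<equiv> pi / (real n + 2)"
  obtains S :: real and c :: "nat \<Rightarrow> nat \<Rightarrow> real" and K :: "real \<Rightarrow> real" where
    "S > 0" "\<And>z. K z = (\<Sum>j\<le>n. \<Sum>k\<le>n. c j k * cos (of_int (int j - int k) * z))" "\<And>z. K z \<ge> 0"
    "\<And>\<alpha>. ((\<lambda>s. K (s - \<alpha>)) has_integral 2 * pi * S) {-pi..pi}"
    "\<And>\<alpha>. ((\<lambda>s. K (s - \<alpha>) * cos (s - \<alpha>)) has_integral 2 * pi * S * cos \<delta>) {-pi..pi}"
proof -
  define a where "a = (\<lambda>k::nat. sin ((real k + 1) * \<delta>))"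
  define K where "K = (\<lambda>z. \<Sum>j\<le>n. \<Sum>k\<le>n. a j * a k * cos (of_int (int j - int k) * z))"
  define S where "S = (\<Sum>k\<le>n. (a k)\<^sup>2)"
  have \<delta>: "0 < \<delta>" "\<delta> < pi" using pi_gt_zero by (auto simp: \<delta>_def divide_less_eq)
  have "0 < (a 0)\<^sup>2" using sin_gt_zero[OF \<delta>] by (simp add: a_def)
  also have "\<dots> \<le> S" unfolding S_def by (rule member_le_sum) auto
  finally have S: "S > 0" .
  have K0: "K z \<ge> 0" for z
  proof -
    have "K z = (\<Sum>j\<le>n. a j * cos (real j * z)) * (\<Sum>k\<le>n. a k * cos (real k * z)) + (\<Sum>j\<le>n. a j * sin (real j * z)) * (\<Sum>k\<le>n. a k * sin (real k * z))"
      by (simp add: K_def sum_product sum.distrib[symmetric] left_diff_distrib cos_diff algebra_simps)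
    then show ?thesis by simp
  qed
  have I1: "((\<lambda>s. K (s - \<alpha>)) has_integral 2 * pi * S) {-pi..pi}" for \<alpha>
  proof -
    have "((\<lambda>s. K (s - \<alpha>)) has_integral (\<Sum>j\<le>n. \<Sum>k\<le>n. a j * a k * (if int j - int k = 0 then 2 * pi else 0))) {-pi..pi}"
      unfolding K_def by (intro has_integral_sum has_integral_mult_right integral_cos_shift) auto
    also have "(\<Sum>j\<le>n. \<Sum>k\<le>n. a j * a k * (if int j - int k = 0 then 2 * pi else 0)) = (\<Sum>j\<le>n. \<Sum>k\<le>n. if j = k then a j * a k * (2 * pi) else 0)"
      by (intro sum.cong) auto
    also have "\<dots> = 2 * pi * S"
      by (simp add: S_def sum_distrib_left power2_eq_square mult_ac)
    finally show ?thesis .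
  qed
  have conv: "2 * (\<Sum>j<n. a j * a (Suc j)) = 2 * cos \<delta> * S"
  proof -
    define b where "b = (\<lambda>k::nat. sin (real k * \<delta>))"
    have ab: "a k = b (Suc k)" for k by (simp add: a_def b_def add.commute)
    have b0: "b 0 = 0" "b (Suc (Suc n)) = 0"
    proof -
      have "real (Suc (Suc n)) * \<delta> = pi" by (simp add: \<delta>_def field_simps)
      then show "b (Suc (Suc n)) = 0" by (simp only: b_def sin_pi)
    qed (simp add: b_def)
    have rec: "2 * cos \<delta> * b (Suc k) = b (Suc (Suc k)) + b k" for k
    proof -
      define \<phi> where "\<phi> = real (Suc k) * \<delta>"
      have "real k * \<delta> = \<phi> - \<delta>" "real (Suc (Suc k)) * \<delta> = \<phi> + \<delta>" by (auto simp: \<phi>_def algebra_simps)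
      then show ?thesis unfolding b_def by (simp only: \<phi>_def[symmetric] sin_add sin_diff) simp
    qed
    have "2 * cos \<delta> * S = (\<Sum>k\<le>n. b (Suc k) * (2 * cos \<delta> * b (Suc k)))"
      by (simp add: S_def ab sum_distrib_left power2_eq_square mult_ac)
    also have "\<dots> = (\<Sum>k\<le>n. b (Suc k) * b (Suc (Suc k))) + (\<Sum>k\<le>n. b k * b (Suc k))"
      unfolding rec by (simp add: sum.distrib[symmetric] algebra_simps)
    also have "(\<Sum>k\<le>n. b (Suc k) * b (Suc (Suc k))) = (\<Sum>k<n. b (Suc k) * b (Suc (Suc k)))"
      unfolding lessThan_Suc_atMost[symmetric] sum.lessThan_Suc by (simp add: b0)
    also have "(\<Sum>k\<le>n. b k * b (Suc k)) = (\<Sum>k<n. b (Suc k) * b (Suc (Suc k)))"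
      unfolding lessThan_Suc_atMost[symmetric] sum.lessThan_Suc_shift by (simp add: b0)
    finally show ?thesis by (simp add: ab)
  qed
  have I2: "((\<lambda>s. K (s - \<alpha>) * cos (s - \<alpha>)) has_integral 2 * pi * S * cos \<delta>) {-pi..pi}" for \<alpha>
  proof -
    have eq: "K z * cos z = (\<Sum>j\<le>n. \<Sum>k\<le>n. a j * a k / 2 * cos (of_int (int j - int k + 1) * z) + a j * a k / 2 * cos (of_int (int j - int k - 1) * z))" for z
    proof -
      have "cos (of_int m * z) * cos z = cos (of_int (m + 1) * z) / 2 + cos (of_int (m - 1) * z) / 2" for m
        by (simp add: distrib_right left_diff_distrib cos_add cos_diff add_divide_distrib diff_divide_distrib)
      then have "a j * a k * cos (of_int (int j - int k) * z) * cos z = a j * a k / 2 * cos (of_int (int j - int k + 1) * z) + a j * a k / 2 * cos (of_int (int j - int k - 1) * z)" for j k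
        unfolding mult.assoc by (simp only:) (simp add: algebra_simps)
      then show ?thesis unfolding K_def sum_distrib_right by (intro sum.cong refl) blast
    qed
    have "((\<lambda>s. K (s - \<alpha>) * cos (s - \<alpha>)) has_integral (\<Sum>j\<le>n. \<Sum>k\<le>n. a j * a k / 2 * (if int j - int k + 1 = 0 then 2 * pi else 0) + a j * a k / 2 * (if int j - int k - 1 = 0 then 2 * pi else 0))) {-pi..pi}"
      unfolding eq by (intro has_integral_sum has_integral_add has_integral_mult_right integral_cos_shift) auto
    also have "(\<Sum>j\<le>n. \<Sum>k\<le>n. a j * a k / 2 * (if int j - int k + 1 = 0 then 2 * pi else 0) + a j * a k / 2 * (if int j - int k - 1 = 0 then 2 * pi else 0))
      = (\<Sum>j\<le>n. \<Sum>k\<le>n. a j * a k / 2 * (if int j - int k + 1 = 0 then 2 * pi else 0)) + (\<Sum>k\<le>n. \<Sum>j\<le>n. a j * a k / 2 * (if int j - int k - 1 = 0 then 2 * pi else 0))"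
      by (subst (3) sum.swap) (simp only: sum.distrib)
    also have "(\<Sum>k\<le>n. \<Sum>j\<le>n. a j * a k / 2 * (if int j - int k - 1 = 0 then 2 * pi else 0)) = (\<Sum>k\<le>n. \<Sum>j\<le>n. if j = Suc k then a k * a (Suc k) * pi else 0)"
      by (intro sum.cong) auto
    also have "\<dots> = (\<Sum>k\<le>n. if Suc k \<le> n then a k * a (Suc k) * pi else 0)" by (simp add: sum.delta)
    also have "\<dots> = (\<Sum>k<n. a k * a (Suc k) * pi)"
      unfolding lessThan_Suc_atMost[symmetric] by simp
    also have "(\<Sum>j\<le>n. \<Sum>k\<le>n. a j * a k / 2 * (if int j - int k + 1 = 0 then 2 * pi else 0)) = (\<Sum>k\<le>n. \<Sum>j\<le>n. if j = Suc k then a k * a (Suc k) * pi else 0)"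
      by (intro sum.cong) auto
    also have "\<dots> = (\<Sum>k\<le>n. if Suc k \<le> n then a k * a (Suc k) * pi else 0)" by (simp add: sum.delta)
    also have "\<dots> = (\<Sum>k<n. a k * a (Suc k) * pi)"
      unfolding lessThan_Suc_atMost[symmetric] by simp
    also have "(\<Sum>k<n. a k * a (Suc k) * pi) + (\<Sum>k<n. a k * a (Suc k) * pi) = pi * (2 * (\<Sum>j<n. a j * a (Suc j)))"
      by (simp add: sum_distrib_left mult_ac)
    also have "\<dots> = 2 * pi * S * cos \<delta>" unfolding conv by simp
    finally show ?thesis .
  qed
  show thesis
    by (rule that[of S K "\<lambda>j k. a j * a k"]) (use S K0 I1 I2 in \<open>auto simp: K_def\<close>)
qed

text \<open>The approximant is the convolution of h(cos s) with the positive kernel. The error is at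
  most L times the mean of |cos \<alpha> - cos s|, and this first moment is bounded through the mean
  of 1 - cos (s - \<alpha>), which is known exactly. The outcome L (\<delta> + (1 - cos \<delta>) /
  (2 \<delta>)) is at most 5/4 L \<delta>, and pi < 4 produces the constant 5.\<close>

lemma jackson_lipschitz:
  fixes h :: "real \<Rightarrow> real"
  assumes lip: "\<And>x y. x \<in> {-1..1} \<Longrightarrow> y \<in> {-1..1} \<Longrightarrow> \<bar>h x - h y\<bar> \<le> L * \<bar>x - y\<bar>"
  shows "\<exists>p. degree p \<le> n \<and> (\<forall>x\<in>{-1..1}. \<bar>h x - poly p x\<bar> \<le> 5 * L / (real n + 2))"
proof -
  define \<delta> where "\<delta> = pi / (real n + 2)"
  obtain S :: real and c :: "nat \<Rightarrow> nat \<Rightarrow> real" and K :: "real \<Rightarrow> real" where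
    S: "S > 0" and Kdef: "\<And>z. K z = (\<Sum>j\<le>n. \<Sum>k\<le>n. c j k * cos (of_int (int j - int k) * z))" 
    and K0: "\<And>z. K z \<ge> 0"
    and I1: "\<And>\<alpha>. ((\<lambda>s. K (s - \<alpha>)) has_integral 2 * pi * S) {-pi..pi}"
    and I2: "\<And>\<alpha>. ((\<lambda>s. K (s - \<alpha>) * cos (s - \<alpha>)) has_integral 2 * pi * S * cos \<delta>) {-pi..pi}"
    by (rule positive_cosine_kernel[of n, folded \<delta>_def]) (rule that)
  have L: "L \<ge> 0" using lip[of 0 1] by simp
  have conth: "continuous_on {-1..1} h"
    by (rule lipschitz_on_continuous_on[of L]) (use lip L in \<open>auto intro!: lipschitz_onI simp: dist_real_def\<close>)
  define g where "g = (\<lambda>s. h (cos s))"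
  have contg: "continuous_on A g" for A unfolding g_def by (rule continuous_on_comp_cos[OF conth])
  have contK: "continuous_on A (\<lambda>s. K (s - \<alpha>))" for A \<alpha> unfolding Kdef by (intro continuous_intros)
  have \<delta>: "\<delta> > 0" by (simp add: \<delta>_def)
  define G where "G = (\<lambda>m::int. integral {-pi..pi} (\<lambda>s. g s * cos (of_int m * s)))"
  \<comment> \<open>h(cos s) is even, so the sine parts of the convolution disappear and a
    polynomial in cos \<alpha> remains.\<close>
  have odd: "integral {-pi..pi} (\<lambda>s. g s * sin (of_int m * s)) = 0" for m
    using Henstock_Kurzweil_Integration.integral_reflect_real[of pi "-pi" "\<lambda>s. g s * sin (of_int m * s)"] by (simp add: g_def)
  have T: "\<forall>j k. \<exists>p :: real poly. (j \<le> n \<longrightarrow> k \<le> n \<longrightarrow> degree p \<le> n) \<and> (\<forall>\<theta>. poly p (cos \<theta>) = cos (of_int (int j - int k) * \<theta>))"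
  proof (intro allI)
    fix j k
    define m where "m = nat \<bar>int j - int k\<bar>"
    obtain p where p: "degree p \<le> m" "\<And>\<theta>. poly p (cos \<theta>) = cos (real m * \<theta>)" using cos_multiple_poly[of m] by blast
    have "cos (real m * \<theta>) = cos (of_int (int j - int k) * \<theta>)" for \<theta>
    proof (cases "j \<ge> k")
      case True then show ?thesis by (simp add: m_def of_nat_diff)
    next
      case False
      then have "real m * \<theta> = - (of_int (int j - int k) * \<theta>)" by (simp add: m_def algebra_simps)
      then show ?thesis by (simp only: cos_minus)
    qed
    moreover have "j \<le> n \<longrightarrow> k \<le> n \<longrightarrow> m \<le> n" by (auto simp: m_def)
    ultimately show "\<exists>p :: real poly. (j \<le> n \<longrightarrow> k \<le> n \<longrightarrow> degree p \<le> n) \<and> (\<forall>\<theta>. poly p (cos \<theta>) = cos (of_int (int j - int k) * \<theta>))"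
      using p by (intro exI[of _ p]) auto
  qed
  then obtain T where T: "\<And>j k. j \<le> n \<Longrightarrow> k \<le> n \<Longrightarrow> degree (T j k :: real poly) \<le> n" "\<And>j k \<theta>. poly (T j k) (cos \<theta>) = cos (of_int (int j - int k) * \<theta>)"
    by metis
  define p where "p = (\<Sum>j\<le>n. \<Sum>k\<le>n. smult (c j k * G (int j - int k) / (2 * pi * S)) (T j k))"
  have "degree p \<le> n" unfolding p_def
    by (intro degree_sum_le) (auto intro!: order_trans[OF degree_smult_le] T(1))
  moreover have "\<bar>h x - poly p x\<bar> \<le> 5 * L / (real n + 2)" if x: "x \<in> {-1..1}" for x
  proof -
    define \<alpha> where "\<alpha> = arccos x"
    have x\<alpha>: "x = cos \<alpha>" using x by (simp add: \<alpha>_def)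
    have iK: "(\<lambda>s. g s * K (s - \<alpha>)) integrable_on {-pi..pi}"
      by (intro integrable_continuous_real continuous_intros contg contK)
    have "integral {-pi..pi} (\<lambda>s. g s * K (s - \<alpha>)) = (\<Sum>j\<le>n. \<Sum>k\<le>n. c j k * (G (int j - int k) * cos (of_int (int j - int k) * \<alpha>)))"
    proof (rule integral_unique)
      have one: "((\<lambda>s. g s * cos (of_int m * (s - \<alpha>))) has_integral G m * cos (of_int m * \<alpha>)) {-pi..pi}" for m
      proof -
        have "((\<lambda>s. g s * cos (of_int m * s)) has_integral G m) {-pi..pi}"
          unfolding G_def by (intro integrable_integral integrable_continuous_real continuous_intros contg)
        moreover have "((\<lambda>s. g s * sin (of_int m * s)) has_integral 0) {-pi..pi}"
          unfolding odd[of m, symmetric] by (intro integrable_integral integrable_continuous_real continuous_intros contg)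
        ultimately have "((\<lambda>s. g s * cos (of_int m * s) * cos (of_int m * \<alpha>) + g s * sin (of_int m * s) * sin (of_int m * \<alpha>)) 
           has_integral (G m * cos (of_int m * \<alpha>) + 0 * sin (of_int m * \<alpha>))) {-pi..pi}"
          by (intro has_integral_add has_integral_mult_left)
        then show ?thesis by (simp add: right_diff_distrib cos_diff algebra_simps)
      qed
      have "((\<lambda>s. \<Sum>j\<le>n. \<Sum>k\<le>n. c j k * (g s * cos (of_int (int j - int k) * (s - \<alpha>)))) has_integral
         (\<Sum>j\<le>n. \<Sum>k\<le>n. c j k * (G (int j - int k) * cos (of_int (int j - int k) * \<alpha>)))) {-pi..pi}"
        by (intro has_integral_sum has_integral_mult_right one) auto
      then show "((\<lambda>s. g s * K (s - \<alpha>)) has_integral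
         (\<Sum>j\<le>n. \<Sum>k\<le>n. c j k * (G (int j - int k) * cos (of_int (int j - int k) * \<alpha>)))) {-pi..pi}"
        unfolding Kdef sum_distrib_left by (simp only: mult_ac)
    qed
    also have "\<dots> = 2 * pi * S * poly p x"
      using S by (simp add: p_def x\<alpha> poly_sum T(2) sum_distrib_left mult.assoc)
    finally have Ip: "integral {-pi..pi} (\<lambda>s. g s * K (s - \<alpha>)) = 2 * pi * S * poly p x" .
    have "((\<lambda>s. g \<alpha> * K (s - \<alpha>) - g s * K (s - \<alpha>)) has_integral (g \<alpha> * (2 * pi * S) - 2 * pi * S * poly p x)) {-pi..pi}"
      unfolding Ip[symmetric] by (intro has_integral_diff has_integral_mult_right I1 integrable_integral iK)
    then have D: "((\<lambda>s. (g \<alpha> - g s) * K (s - \<alpha>)) has_integral (2 * pi * S * (h x - poly p x))) {-pi..pi}"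
      by (simp add: g_def x\<alpha>[symmetric] algebra_simps)
    define J where "J = L * (\<delta> * (2 * pi * S) + (1 / (2 * \<delta>)) * (2 * pi * S - 2 * pi * S * cos \<delta>))"
    have E: "((\<lambda>s. L * (\<delta> * K (s - \<alpha>) + (1 / (2 * \<delta>)) * (K (s - \<alpha>) - K (s - \<alpha>) * cos (s - \<alpha>)))) has_integral J) {-pi..pi}"
      unfolding J_def by (intro has_integral_mult_right has_integral_add has_integral_diff I1 I2)
    have bound: "\<bar>(g \<alpha> - g s) * K (s - \<alpha>)\<bar> \<le> L * (\<delta> * K (s - \<alpha>) + (1 / (2 * \<delta>)) * (K (s - \<alpha>) - K (s - \<alpha>) * cos (s - \<alpha>)))" for s
    proof -
      define y where "y = \<bar>sin ((s - \<alpha>) / 2)\<bar>"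
      have "\<bar>g \<alpha> - g s\<bar> \<le> L * \<bar>cos \<alpha> - cos s\<bar>" unfolding g_def by (rule lip) auto
      also have "\<bar>cos \<alpha> - cos s\<bar> = 2 * (\<bar>sin ((\<alpha> + s) / 2)\<bar> * y)" by (simp add: cos_diff_cos abs_mult y_def)
      also have "\<dots> \<le> 2 * (1 * y)" by (intro mult_left_mono mult_right_mono) (auto simp: y_def)
      \<comment> \<open>The arithmetic-geometric mean inequality trades the first power for y^2,
        which is linear in cos (s - \<alpha>) and can be integrated exactly; \<delta> is the
        balancing scale.\<close>
      also have "2 * (1 * y) \<le> \<delta> + y\<^sup>2 / \<delta>"
      proof -
        have "(2 * y) * \<delta> \<le> \<delta> * \<delta> + y\<^sup>2" 
          using zero_le_power2[of "\<delta> - y"] by (simp add: power2_eq_square algebra_simps)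
        then have "2 * y \<le> (\<delta> * \<delta> + y\<^sup>2) / \<delta>" using \<delta> by (simp add: pos_le_divide_eq)
        then show ?thesis using \<delta> by (simp add: add_divide_distrib)
      qed
      also have "y\<^sup>2 = (1 - cos (s - \<alpha>)) / 2"
      proof -
        have "2 * ((s - \<alpha>) / 2) = s - \<alpha>" by simp
        from cos_double_sin[of "(s - \<alpha>) / 2", unfolded this] show ?thesis by (simp add: y_def)
      qed
      finally have "\<bar>g \<alpha> - g s\<bar> \<le> L * (\<delta> + (1 - cos (s - \<alpha>)) / 2 / \<delta>)" using L by (simp add: mult_left_mono)
      then have "\<bar>g \<alpha> - g s\<bar> * K (s - \<alpha>) \<le> L * (\<delta> + (1 - cos (s - \<alpha>)) / 2 / \<delta>) * K (s - \<alpha>)"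
        by (rule mult_right_mono[OF _ K0])
      also have "L * (\<delta> + (1 - cos (s - \<alpha>)) / 2 / \<delta>) * K (s - \<alpha>) = L * (\<delta> * K (s - \<alpha>) + (1 / (2 * \<delta>)) * (K (s - \<alpha>) - K (s - \<alpha>) * cos (s - \<alpha>)))"
        using \<delta> by (simp add: field_simps)
      finally show ?thesis using K0[of "s - \<alpha>"] unfolding abs_mult by simp
    qed
    have "\<bar>2 * pi * S * (h x - poly p x)\<bar> \<le> J"
    proof (rule abs_leI)
      show "2 * pi * S * (h x - poly p x) \<le> J"
        by (rule has_integral_le[OF D E]) (use bound abs_le_D1 in blast)
      show "- (2 * pi * S * (h x - poly p x)) \<le> J"
        by (rule has_integral_le[OF has_integral_neg[OF D] E]) (use bound abs_le_D2 in blast)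
    qed
    moreover have "J = 2 * pi * S * (L * (\<delta> + (1 - cos \<delta>) / (2 * \<delta>)))"
      using \<delta> by (simp add: J_def field_simps)
    ultimately have "2 * pi * S * \<bar>h x - poly p x\<bar> \<le> 2 * pi * S * (L * (\<delta> + (1 - cos \<delta>) / (2 * \<delta>)))"
      using S by (simp add: abs_mult)
    then have "\<bar>h x - poly p x\<bar> \<le> L * (\<delta> + (1 - cos \<delta>) / (2 * \<delta>))"
      using S by simp
    also have "\<dots> \<le> L * (5 / 4 * \<delta>)"
    proof (rule mult_left_mono[OF _ L])
      have "1 - cos \<delta> = 2 * (sin (\<delta> / 2) * sin (\<delta> / 2))" using cos_diff_cos[of 0 \<delta>] by simp
      also have "\<dots> \<le> 2 * (\<bar>sin (\<delta> / 2)\<bar> * \<bar>sin (\<delta> / 2)\<bar>)" by (simp add: abs_mult[symmetric])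
      also have "\<dots> \<le> 2 * (\<bar>\<delta> / 2\<bar> * \<bar>\<delta> / 2\<bar>)" by (intro mult_left_mono mult_mono abs_sin_x_le_abs_x) auto
      finally have "1 - cos \<delta> \<le> \<delta> * \<delta> / 2" by simp
      then have "(1 - cos \<delta>) / (2 * \<delta>) \<le> \<delta> * \<delta> / 2 / (2 * \<delta>)" using \<delta> by (intro divide_right_mono) auto
      then show "\<delta> + (1 - cos \<delta>) / (2 * \<delta>) \<le> 5 / 4 * \<delta>" using \<delta> by simp
    qed
    also have "\<dots> \<le> L * (5 / (real n + 2))"
    proof (rule mult_left_mono[OF _ L])
      have "\<delta> \<le> 4 / (real n + 2)" unfolding \<delta>_def using pi_less_4 by (intro divide_right_mono) auto
      then show "5 / 4 * \<delta> \<le> 5 / (real n + 2)" by simp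
    qed
    finally show ?thesis by (simp add: mult.commute)
  qed
  ultimately show ?thesis by blast
qed

section \<open>From Lipschitz functions to r derivatives\<close>

lemma poly_antiderivative: "\<exists>q :: real poly. pderiv q = p \<and> degree q \<le> Suc (degree p)"
proof -
  define q where "q = (\<Sum>i\<le>degree p. monom (coeff p i / real (Suc i)) (Suc i))"
  have "pderiv q = (\<Sum>i\<le>degree p. monom (coeff p i) i)"
  proof -
    have "pderiv (\<Sum>i\<le>n. f i) = (\<Sum>i\<le>n. pderiv (f i))" for n and f :: "nat \<Rightarrow> real poly"
      by (induction n) (simp_all add: pderiv_add)
    then show ?thesis unfolding q_def by (simp add: pderiv_monom del: of_nat_Suc)
  qed
  also have "\<dots> = p" by (rule poly_as_sum_of_monoms)
  finally have "pderiv q = p" .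
  moreover have "degree q \<le> Suc (degree p)"
    unfolding q_def by (intro degree_sum_le) (auto intro!: order_trans[OF degree_monom_le])
  ultimately show ?thesis by blast
qed

text \<open>If p approximates the derivative up to \<epsilon> and P is an antiderivative of p, then
  h - P is Lipschitz with constant \<epsilon>, and the Lipschitz case gains another factor 5 / (n +
  2). Along the induction n and r drop together, so n - r + 1 is a common lower bound for all
  denominators.\<close>

lemma jackson:
  fixes h :: "nat \<Rightarrow> real \<Rightarrow> real"
  assumes "\<And>j x. j < r \<Longrightarrow> x \<in> {-1..1} \<Longrightarrow> (h j has_real_derivative h (Suc j) x) (at x within {-1..1})"
    and "\<And>x. x \<in> {-1..1} \<Longrightarrow> \<bar>h r x\<bar> \<le> M" and "r \<le> n"
  shows "\<exists>p. degree p \<le> n \<and> (\<forall>x\<in>{-1..1}. \<bar>h 0 x - poly p x\<bar> \<le> M * (5 / real (n - r + 1)) ^ r)"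
  using assms
proof (induction r arbitrary: h n)
  case 0
  then show ?case by (intro exI[of _ 0]) auto
next
  case (Suc r)
  obtain m where n: "n = Suc m" and m: "r \<le> m" using Suc.prems(3) by (cases n) auto
  define \<epsilon> where "\<epsilon> = M * (5 / real (m - r + 1)) ^ r"
  have "\<exists>p. degree p \<le> m \<and> (\<forall>x\<in>{-1..1}. \<bar>h (Suc 0) x - poly p x\<bar> \<le> M * (5 / real (m - r + 1)) ^ r)"
    by (rule Suc.IH[of "\<lambda>j. h (Suc j)"]) (use Suc.prems m in auto)
  then obtain p where p: "degree p \<le> m" "\<And>x. x \<in> {-1..1} \<Longrightarrow> \<bar>h (Suc 0) x - poly p x\<bar> \<le> \<epsilon>" unfolding \<epsilon>_def by auto
  obtain P where P: "pderiv P = p" "degree P \<le> Suc (degree p)" using poly_antiderivative by blast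
  have der: "((\<lambda>x. h 0 x - poly P x) has_field_derivative (h (Suc 0) x - poly p x)) (at x within {-1..1})" if "x \<in> {-1..1}" for x
    using Suc.prems(1)[of 0 x] that P(1) by (auto intro!: derivative_eq_intros has_field_derivative_at_within[OF poly_DERIV])
  have "\<bar>(h 0 x - poly P x) - (h 0 y - poly P y)\<bar> \<le> \<epsilon> * \<bar>x - y\<bar>" if "x \<in> {-1..1}" "y \<in> {-1..1}" for x y
    using field_differentiable_bound[of "{-1..1}" "\<lambda>x. h 0 x - poly P x" "\<lambda>x. h (Suc 0) x - poly p x" \<epsilon> x y] der p(2) that by auto
  then obtain q where q: "degree q \<le> n" "\<And>x. x \<in> {-1..1} \<Longrightarrow> \<bar>h 0 x - poly P x - poly q x\<bar> \<le> 5 * \<epsilon> / (real n + 2)"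
    using jackson_lipschitz[of "\<lambda>x. h 0 x - poly P x" \<epsilon> n] by auto
  have \<epsilon>: "\<epsilon> \<ge> 0" using p(2)[of 0] by auto
  have "degree (P + q) \<le> n" using P(2) p(1) q(1) n by (intro degree_add_le) auto
  moreover have "\<bar>h 0 x - poly (P + q) x\<bar> \<le> M * (5 / real (n - Suc r + 1)) ^ Suc r" if "x \<in> {-1..1}" for x
  proof -
    have "\<bar>h 0 x - poly (P + q) x\<bar> \<le> 5 * \<epsilon> / (real n + 2)" using q(2)[OF that] by (simp add: algebra_simps)
    also have "\<dots> \<le> 5 * \<epsilon> / real (m - r + 1)" using \<epsilon> n by (intro divide_left_mono) auto
    also have "\<dots> = M * (5 / real (n - Suc r + 1)) ^ Suc r" by (simp add: \<epsilon>_def n)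
    finally show ?thesis .
  qed
  ultimately show ?case by blast
qed

text \<open>The partial sum reproduces polynomials of degree at most N, so the error is at most 1
  plus the Lebesgue constant times the Jackson error. \<open>C\<close> and \<open>N0\<close> are
  chosen before \<open>h\<close> and \<open>M\<close>; the induction over the variables relies on
  this.\<close>

lemma projection_error:
  assumes l: "l > 0"
  obtains C N0 where "C > 0" 
   "\<And>N h M x. N \<ge> N0 \<Longrightarrow> 
      (\<And>j x. j < r \<Longrightarrow> x \<in> {-1..1} \<Longrightarrow> (h j has_real_derivative h (Suc j) x) (at x within {-1..1})) \<Longrightarrow>
      continuous_on {-1..1} (h 0) \<Longrightarrow>
      (\<And>x. x \<in> {-1..1} \<Longrightarrow> \<bar>h r x\<bar> \<le> M) \<Longrightarrow> x \<in> {-1..1} \<Longrightarrow>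
      \<bar>h 0 x - gint l (\<lambda>t. gker l N x t * h 0 t)\<bar> \<le> C * M * real N powr (l - real r)"
proof -
  obtain C where C: "C > 0" and leb: "\<And>N x. N \<ge> 1 \<Longrightarrow> x \<in> {-1..1} \<Longrightarrow> gint l (\<lambda>t. \<bar>gker l N x t\<bar>) \<le> C * real N powr l"
    using lebesgue_constant[OF l] by blast
  show thesis
  \<comment> \<open>N \<ge> 2 r gives N - r + 1 \<ge> N / 2, which turns the 5 of Jackson's bound
    into 10; the 1 in 1 + C is the approximation error itself.\<close>
  proof (rule that[of "10 ^ r * (1 + C)" "max 1 (2 * r)"])
    show "10 ^ r * (1 + C) > 0" using C by auto
    fix N :: nat and h :: "nat \<Rightarrow> real \<Rightarrow> real" and M x :: real
    assume N: "N \<ge> max 1 (2 * r)"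
      and der: "\<And>j x. j < r \<Longrightarrow> x \<in> {-1..1} \<Longrightarrow> (h j has_real_derivative h (Suc j) x) (at x within {-1..1})"
      and cont: "continuous_on {-1..1} (h 0)"
      and bd: "\<And>x. x \<in> {-1..1} \<Longrightarrow> \<bar>h r x\<bar> \<le> M" and x: "x \<in> {-1..1}"
    have M: "M \<ge> 0" using bd[of 0] by auto
    define \<epsilon> where "\<epsilon> = M * (5 / real (N - r + 1)) ^ r"
    obtain p where p: "degree p \<le> N" "\<And>x. x \<in> {-1..1} \<Longrightarrow> \<bar>h 0 x - poly p x\<bar> \<le> \<epsilon>"
      using jackson[of r h M N, OF der bd] N unfolding \<epsilon>_def by auto
    have \<epsilon>: "\<epsilon> \<ge> 0" using M by (auto simp: \<epsilon>_def)
    define e where "e = (\<lambda>t. h 0 t - poly p t)"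
    have conte: "continuous_on {-1..1} e" unfolding e_def by (intro continuous_intros cont)
    have "gint l (\<lambda>t. gker l N x t * e t) = gint l (\<lambda>t. gker l N x t * h 0 t) - gint l (\<lambda>t. gker l N x t * poly p t)"
      unfolding e_def right_diff_distrib by (intro gint_diff[OF l] continuous_intros continuous_on_gker cont)
    also have "gint l (\<lambda>t. gker l N x t * poly p t) = poly p x" by (rule gker_reproduces[OF l p(1)])
    finally have "h 0 x - gint l (\<lambda>t. gker l N x t * h 0 t) = e x - gint l (\<lambda>t. gker l N x t * e t)"
      by (simp add: e_def)
    also have "\<bar>\<dots>\<bar> \<le> \<bar>e x\<bar> + \<bar>gint l (\<lambda>t. gker l N x t * e t)\<bar>" by (rule abs_triangle_ineq4)
    also have "\<bar>gint l (\<lambda>t. gker l N x t * e t)\<bar> \<le> \<epsilon> * gint l (\<lambda>t. \<bar>gker l N x t\<bar>)"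
      by (rule gint_mult_abs_le[OF l continuous_on_gker conte]) (use p(2) in \<open>simp add: e_def\<close>)
    also have "\<dots> \<le> \<epsilon> * (C * real N powr l)"
      using leb[of N x] N x \<epsilon> by (intro mult_left_mono) auto
    also have "\<bar>e x\<bar> \<le> \<epsilon> * real N powr l"
    proof -
      have "1 \<le> real N powr l" using N l by (intro ge_one_powr_ge_zero) auto
      then have "\<epsilon> * 1 \<le> \<epsilon> * real N powr l" using \<epsilon> by (intro mult_left_mono) auto
      then show ?thesis using p(2)[OF x] by (simp add: e_def)
    qed
    also have "\<epsilon> * real N powr l + \<epsilon> * (C * real N powr l) = \<epsilon> * ((1 + C) * real N powr l)" by (simp add: algebra_simps)
    also have "\<epsilon> \<le> M * (10 ^ r * real N powr (- real r))"
    proof -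
      have "5 / real (N - r + 1) \<le> 10 / real N" using N by (simp add: frac_le_eq divide_le_0_iff of_nat_diff)
      then have "\<epsilon> \<le> M * (10 / real N) ^ r" unfolding \<epsilon>_def using M by (intro mult_left_mono power_mono) auto
      also have "(10 / real N) ^ r = 10 ^ r * real N powr (- real r)"
        using N by (simp add: power_divide powr_minus powr_realpow divide_inverse power_inverse)
      finally show ?thesis .
    qed
    finally have "\<bar>h 0 x - gint l (\<lambda>t. gker l N x t * h 0 t)\<bar> \<le> M * (10 ^ r * real N powr (- real r)) * ((1 + C) * real N powr l)"
      using C by (simp add: mult_right_mono)
    also have "\<dots> = 10 ^ r * (1 + C) * M * real N powr (l - real r)"
      by (simp add: powr_diff powr_minus divide_inverse mult_ac)
    finally show "\<bar>h 0 x - gint l (\<lambda>t. gker l N x t * h 0 t)\<bar> \<le> 10 ^ r * (1 + C) * M * real N powr (l - real r)" .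
  qed
qed

section \<open>Tensor product test functions\<close>

text \<open>The functions p(1/x) e^(-1/x), extended by 0: a family containing the standard flat
  function and closed under differentiation, so that smoothness needs no separate treatment of
  higher orders.\<close>

definition efun :: "real poly \<Rightarrow> real \<Rightarrow> real" where
  "efun p x = (if x > 0 then poly p (inverse x) * exp (- inverse x) else 0)"

lemma poly_exp_minus_tendsto:
  fixes p :: "real poly"
  shows "((\<lambda>u. poly p u * exp (- u)) \<longlongrightarrow> 0) at_top"
proof -
  have "((\<lambda>u. \<Sum>i\<le>degree p. coeff p i * (u ^ i / exp u)) \<longlongrightarrow> (\<Sum>i\<le>degree p. coeff p i * 0)) at_top"
    by (intro tendsto_sum tendsto_mult tendsto_const tendsto_power_div_exp_0)
  then show ?thesis by (simp add: poly_altdef sum_distrib_right exp_minus divide_inverse mult.assoc)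
qed

lemma efun_tendsto_0: "(efun p \<longlongrightarrow> 0) (at 0)"
proof (rule filterlim_split_at)
  have "eventually (\<lambda>x. efun p x = 0) (at_left 0)"
    by (auto simp: eventually_at_filter efun_def)
  then show "(efun p \<longlongrightarrow> 0) (at_left 0)" by (rule tendsto_eventually)
  have "((\<lambda>x. poly p (inverse x) * exp (- inverse x)) \<longlongrightarrow> 0) (at_right 0)"
    by (rule filterlim_compose[OF poly_exp_minus_tendsto filterlim_inverse_at_top_right])
  moreover have "eventually (\<lambda>x. poly p (inverse x) * exp (- inverse x) = efun p x) (at_right 0)"
    by (auto simp: eventually_at_filter efun_def)
  ultimately show "(efun p \<longlongrightarrow> 0) (at_right 0)" by (rule Lim_transform_eventually)
qed

text \<open>For x > 0 this is the product rule with u = 1/x, where differentiation in x is -u^2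
  times differentiation in u. At 0 the difference quotient is again a member of the family, with p
  multiplied by its variable, and tends to 0.\<close>

lemma DERIV_efun: "(efun p has_real_derivative efun ([:0, 0, 1:] * (p - pderiv p)) x) (at x)"
proof -
  consider "x > 0" | "x < 0" | "x = 0" by linarith
  then show ?thesis
  proof cases
    case 1
    have "((\<lambda>x. poly p (inverse x) * exp (- inverse x)) has_real_derivative efun ([:0, 0, 1:] * (p - pderiv p)) x) (at x)"
      using 1 by (auto intro!: derivative_eq_intros DERIV_chain2[OF poly_DERIV] simp: efun_def power2_eq_square algebra_simps)
    then show ?thesis
      by (rule has_field_derivative_transform_within_open[of _ _ _ "{0<..}"]) (use 1 in \<open>auto simp: efun_def\<close>)
  next
    case 2
    have "((\<lambda>x. 0) has_real_derivative efun ([:0, 0, 1:] * (p - pderiv p)) x) (at x)" using 2 by (simp add: efun_def)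
    then show ?thesis
      by (rule has_field_derivative_transform_within_open[of _ _ _ "{..<0}"]) (use 2 in \<open>auto simp: efun_def\<close>)
  next
    case 3
    have "(\<lambda>y. (efun p y - efun p 0) / (y - 0)) = efun ([:0, 1:] * p)"
      by (auto simp: efun_def fun_eq_iff divide_inverse)
    then show ?thesis using efun_tendsto_0[of "[:0, 1:] * p"] 3
      by (simp add: has_field_derivative_iff efun_def)
  qed
qed

text \<open>A syntactic class of smooth functions: closure under derivatives follows by rule
  induction and makes every member infinitely differentiable. Products are included because a bump
  of compact support is a product of two flat functions.\<close>

inductive exp_smooth :: "(real \<Rightarrow> real) \<Rightarrow> bool" where
  exp_smooth_efun: "exp_smooth (\<lambda>x. efun p (a * x + b))"
| exp_smooth_add: "exp_smooth f \<Longrightarrow> exp_smooth g \<Longrightarrow> exp_smooth (\<lambda>x. f x + g x)"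
| exp_smooth_mult: "exp_smooth f \<Longrightarrow> exp_smooth g \<Longrightarrow> exp_smooth (\<lambda>x. f x * g x)"

lemma exp_smooth_derivative:
  assumes "exp_smooth f"
  shows "\<exists>f'. exp_smooth f' \<and> (\<forall>x. (f has_real_derivative f' x) (at x))"
  using assms
proof induction
  case (exp_smooth_efun p a b)
  define q where "q = [:0, 0, 1:] * (p - pderiv p)"
  have "((\<lambda>x. efun p (a * x + b)) has_real_derivative efun (smult a q) (a * x + b)) (at x)" for x
  proof -
    have "((\<lambda>x. efun p (a * x + b)) has_real_derivative efun q (a * x + b) * a) (at x)"
      unfolding q_def by (rule DERIV_chain2[OF DERIV_efun]) (auto intro!: derivative_eq_intros)
    also have "efun q (a * x + b) * a = efun (smult a q) (a * x + b)" by (simp add: efun_def)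
    finally show ?thesis .
  qed
  then show ?case using exp_smooth.exp_smooth_efun[of "smult a q" a b] by blast
next
  case (exp_smooth_add f g)
  then obtain f' g' where "exp_smooth f'" "exp_smooth g'" "\<And>x. (f has_real_derivative f' x) (at x)" "\<And>x. (g has_real_derivative g' x) (at x)"
    by blast
  then show ?case by (intro exI[of _ "\<lambda>x. f' x + g' x"]) (auto intro: exp_smooth.exp_smooth_add DERIV_add)
next
  case (exp_smooth_mult f g)
  then obtain f' g' where *: "exp_smooth f'" "exp_smooth g'" "\<And>x. (f has_real_derivative f' x) (at x)" "\<And>x. (g has_real_derivative g' x) (at x)"
    by blast
  show ?case
    by (intro exI[of _ "\<lambda>x. f' x * g x + g' x * f x"] conjI allI exp_smooth.exp_smooth_add exp_smooth.exp_smooth_mult DERIV_mult *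
        exp_smooth_mult.hyps)
qed

lemma exp_smooth_deriv:
  assumes "exp_smooth f"
  shows "exp_smooth (deriv f)" "(f has_real_derivative deriv f x) (at x)"
proof -
  obtain f' where f': "exp_smooth f'" "\<And>x. (f has_real_derivative f' x) (at x)" using exp_smooth_derivative[OF assms] by blast
  have "deriv f = f'" using DERIV_imp_deriv[OF f'(2)] by (rule ext)
  then show "exp_smooth (deriv f)" "(f has_real_derivative deriv f x) (at x)" using f' by auto
qed

lemma exp_smooth_higher_deriv: "exp_smooth f \<Longrightarrow> exp_smooth ((deriv ^^ n) f)"
  by (induction n) (auto intro: exp_smooth_deriv)

lemma exp_smooth_continuous: "exp_smooth f \<Longrightarrow> continuous_on S f"
  by (meson DERIV_isCont continuous_at_imp_continuous_on exp_smooth_deriv(2))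

lemma exp_smooth_shift: "exp_smooth f \<Longrightarrow> exp_smooth (\<lambda>x. f (x - c))"
proof (induction rule: exp_smooth.induct)
  case (exp_smooth_efun p a b)
  have "(\<lambda>x. efun p (a * (x - c) + b)) = (\<lambda>x. efun p (a * x + (b - a * c)))" by (simp add: algebra_simps)
  then show ?case by (simp only:) (rule exp_smooth.exp_smooth_efun)
qed (auto intro: exp_smooth.intros)

lemma deriv_shift:
  assumes "exp_smooth f"
  shows "deriv (\<lambda>x. f (x - c)) = (\<lambda>x. deriv f (x - c))"
proof
  fix x
  have "((\<lambda>x. f (x - c)) has_real_derivative deriv f (x - c) * 1) (at x)"
    by (rule DERIV_chain2[OF exp_smooth_deriv(2)[OF assms]]) (auto intro!: derivative_eq_intros)
  then show "deriv (\<lambda>x. f (x - c)) x = deriv f (x - c)" by (simp add: DERIV_imp_deriv)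
qed

lemma bump_exists:
  assumes "e > 0"
  obtains \<beta> where "exp_smooth \<beta>" "\<And>t. \<beta> t \<ge> 0" "\<And>t. \<beta> t > 0 \<longleftrightarrow> \<bar>t\<bar> < e"
proof -
  define \<beta> where "\<beta> = (\<lambda>t. efun 1 (1 / e * t + 1) * efun 1 (- 1 / e * t + 1))"
  have "exp_smooth \<beta>" unfolding \<beta>_def by (intro exp_smooth.intros)
  moreover have "\<beta> t \<ge> 0" for t by (auto simp: \<beta>_def efun_def)
  moreover have "\<beta> t > 0 \<longleftrightarrow> \<bar>t\<bar> < e" for t using assms 
    by (auto simp: \<beta>_def efun_def field_simps zero_less_mult_iff abs_if)
  ultimately show thesis by (rule that)
qed

section \<open>Products of one-variable functions and their mixed derivatives\<close>

definition tensor :: "('d \<Rightarrow> real \<Rightarrow> real) \<Rightarrow> real ^ 'd \<Rightarrow> real" where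
  "tensor b x = (\<Prod>j\<in>UNIV. b j (x $ j))"

lemma tensor_split: "tensor b x = b i (x $ i) * (\<Prod>j\<in>UNIV - {i}. b j (x $ j))"
  unfolding tensor_def by (rule prod.remove) auto

lemma partial_derivative_tensor:
  fixes b :: "'d::finite \<Rightarrow> real \<Rightarrow> real"
  assumes "\<And>j. exp_smooth (b j)"
  shows "partial_derivative i (tensor b) = tensor (b(i := deriv (b i)))"
proof
  fix x :: "real ^ 'd"
  have "(\<lambda>t. tensor b (x + t *\<^sub>R axis i 1)) = (\<lambda>t. b i (x $ i + t) * (\<Prod>j\<in>UNIV - {i}. b j (x $ j)))"
    by (subst tensor_split[of _ _ i]) (auto simp: axis_def intro!: ext prod.cong)
  moreover have "((\<lambda>t. b i (x $ i + t) * (\<Prod>j\<in>UNIV - {i}. b j (x $ j))) has_real_derivative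
      deriv (b i) (x $ i) * (\<Prod>j\<in>UNIV - {i}. b j (x $ j))) (at 0)"
  proof (rule DERIV_cmult_right)
    have "((\<lambda>t. b i (x $ i + t)) has_real_derivative deriv (b i) (x $ i) * 1) (at 0)"
      by (rule DERIV_chain2) (use exp_smooth_deriv(2)[OF assms, of i "x $ i"] in \<open>auto intro!: derivative_eq_intros\<close>)
    then show "((\<lambda>t. b i (x $ i + t)) has_real_derivative deriv (b i) (x $ i)) (at 0)" by simp
  qed
  ultimately have "partial_derivative i (tensor b) x = deriv (b i) (x $ i) * (\<Prod>j\<in>UNIV - {i}. b j (x $ j))"
    unfolding partial_derivative_def by (simp add: DERIV_imp_deriv)
  also have "\<dots> = tensor (b(i := deriv (b i))) x"
    by (subst tensor_split[of _ _ i]) (auto intro!: prod.cong)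
  finally show "partial_derivative i (tensor b) x = tensor (b(i := deriv (b i))) x" .
qed

lemma foldr_partial_derivative_tensor:
  assumes "\<And>j. exp_smooth (b j)"
  shows "foldr partial_derivative is (tensor b) = tensor (\<lambda>j. (deriv ^^ count_list is j) (b j))"
proof (induction "is")
  case (Cons i "is")
  have "foldr partial_derivative (i # is) (tensor b) = partial_derivative i (tensor (\<lambda>j. (deriv ^^ count_list is j) (b j)))"
    using Cons by simp
  also have "\<dots> = tensor ((\<lambda>j. (deriv ^^ count_list is j) (b j))(i := deriv ((deriv ^^ count_list is i) (b i))))"
    by (rule partial_derivative_tensor) (intro exp_smooth_higher_deriv assms)
  also have "(\<lambda>j. (deriv ^^ count_list is j) (b j))(i := deriv ((deriv ^^ count_list is i) (b i))) = (\<lambda>j. (deriv ^^ count_list (i # is) j) (b j))"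
    by (auto simp: fun_eq_iff)
  finally show ?case .
qed simp

text \<open>Discharges the choice in \<open>multi_derivative\<close>: a list of directions with the
  prescribed multiplicities exists.\<close>

lemma ex_count_list: "\<exists>is. \<forall>i::'d::finite. count_list is i = f i"
proof -
  obtain xs where xs: "mset xs = Abs_multiset f" using ex_mset by blast
  have "count (mset xs) i = f i" for i unfolding xs by (subst count_Abs_multiset) simp_all
  then show ?thesis by (intro exI[of _ xs]) (simp add: count_mset)
qed

lemma multi_derivative_tensor:
  assumes "\<And>j. exp_smooth (b j)"
  shows "multi_derivative n (tensor b) = tensor (\<lambda>j. (deriv ^^ (n $ j)) (b j))"
proof -
  have "\<forall>i. count_list (SOME is. \<forall>i. count_list is i = n $ i) i = n $ i"
    by (rule someI_ex[OF ex_count_list])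
  then show ?thesis unfolding multi_derivative_def by (simp add: foldr_partial_derivative_tensor[OF assms])
qed

lemma smooth_tensor:
  assumes "\<And>j. exp_smooth (b j)"
  shows "smooth (tensor b)"
proof -
  have "tensor b differentiable_on UNIV" if b: "\<And>j. exp_smooth (b j)" for b :: "'a \<Rightarrow> real \<Rightarrow> real"
  proof -
    have "(\<lambda>x::real^'a. b j (x $ j)) differentiable (at x)" for j x
    proof -
      have "((\<lambda>x::real^'a. x $ j) has_derivative (\<lambda>h. h $ j)) (at x)"
        by (rule bounded_linear.has_derivative[OF bounded_linear_vec_nth has_derivative_ident])
      moreover have "(b j has_derivative (*) (deriv (b j) (x $ j))) (at (x $ j))"
        using exp_smooth_deriv(2)[OF b] by (simp add: has_field_derivative_def)
      ultimately have "(b j \<circ> (\<lambda>x. x $ j) has_derivative (*) (deriv (b j) (x $ j)) \<circ> (\<lambda>h. h $ j)) (at x)"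
        by (rule diff_chain_at)
      then show ?thesis by (auto simp: differentiable_def o_def)
    qed
    then obtain D where D: "\<And>j x. ((\<lambda>x::real^'a. b j (x $ j)) has_derivative D j x) (at x)"
      unfolding differentiable_def by metis
    have "tensor b differentiable (at x)" for x
      unfolding tensor_def differentiable_def
      using has_derivative_prod[of UNIV "\<lambda>j x. b j (x $ j)" "\<lambda>j. D j x" x UNIV] D by blast
    then show ?thesis by (auto simp: differentiable_on_def intro: differentiable_at_withinI)
  qed
  then show ?thesis unfolding smooth_def foldr_partial_derivative_tensor[OF assms]
    by (simp add: exp_smooth_higher_deriv[OF assms])
qed

lemma Omega_iff: "x \<in> Omega \<longleftrightarrow> (\<forall>j. x $ j \<in> {-1..1})"
  by (auto simp: Omega_def mem_box_cart)

lemma test_function_tensor: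
  assumes "\<And>j. exp_smooth (b j)" "\<And>j t. t \<notin> {p $ j..q $ j} \<Longrightarrow> b j t = 0" "\<And>j. -1 < p $ j" "\<And>j. q $ j < 1"
  shows "test_function (tensor b)"
proof -
  have "{x. tensor b x \<noteq> 0} \<subseteq> cbox p q"
  proof clarify
    fix x assume "tensor b x \<noteq> 0"
    then have "b j (x $ j) \<noteq> 0" for j by (simp add: tensor_def)
    then have "x $ j \<in> {p $ j..q $ j}" for j using assms(2)[of "x $ j" j] by blast
    then show "x \<in> cbox p q" by (simp add: mem_box_cart)
  qed
  then have "closure {x. tensor b x \<noteq> 0} \<subseteq> cbox p q" by (rule closure_minimal) (rule closed_cbox)
  also have "\<dots> \<subseteq> interior Omega"
  proof
    fix x assume "x \<in> cbox p q"
    then have "p $ j \<le> x $ j" "x $ j \<le> q $ j" for j by (auto simp: mem_box_cart)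
    then have "-1 < x $ j \<and> x $ j < 1" for j using assms(3,4)[of j] by (meson order.strict_trans1 order.strict_trans2)
    then show "x \<in> interior Omega" by (simp add: Omega_def mem_box_cart)
  qed
  finally show ?thesis using smooth_tensor[OF assms(1)] by (simp add: test_function_def)
qed

lemma continuous_on_tensor: "(\<And>j. exp_smooth (b j)) \<Longrightarrow> continuous_on S (tensor b)"
  unfolding tensor_def
proof (rule continuous_on_prod)
  fix j assume b: "\<And>j. exp_smooth (b j)"
  have "continuous_on S (\<lambda>x. x $ j)" by (intro continuous_intros)
  then show "continuous_on S (\<lambda>x. b j (x $ j))"
    by (rule continuous_on_compose2[OF exp_smooth_continuous[OF b, of UNIV]]) simp
qed

lemma set_lebesgue_integral_Omega:
  fixes f :: "real ^ 'd \<Rightarrow> real"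
  assumes "continuous_on Omega f"
  shows "set_integrable lborel Omega f" "(LINT x:Omega|lborel. f x) = integral Omega f"
proof -
  have "compact (Omega :: (real ^ 'd) set)" by (simp add: Omega_def)
  from borel_integrable_compact[OF this assms] show *: "set_integrable lborel Omega f"
    by (simp add: set_integrable_def scaleR_conv_of_real indicator_def if_distrib cong: if_cong)
  from set_borel_integral_eq_integral(2)[OF *] show "(LINT x:Omega|lborel. f x) = integral Omega f" .
qed

text \<open>The derivative of order n + e_i of a product test function is the derivative of order n
  of the same product with its i-th factor differentiated. Testing \<open>F\<close> with the latter
  and \<open>G\<close> with the former gives the same integral of f, with opposite signs.\<close>

lemma weak_partial_derivative:
  fixes f F G :: "real ^ 'd \<Rightarrow> real"
  assumes F: "continuous_on Omega F" and G: "continuous_on Omega G"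
    and dF: "has_distributional_derivative f n F"
    and dG: "has_distributional_derivative f (n + axis i 1) G"
    and b: "\<And>j. exp_smooth (b j)" "\<And>j t. t \<notin> {p $ j..q $ j} \<Longrightarrow> b j t = 0" "\<And>j. -1 < p $ j" "\<And>j. q $ j < 1"
  shows "integral Omega (\<lambda>x. F x * tensor (b(i := deriv (b i))) x) = - integral Omega (\<lambda>x. G x * tensor b x)"
proof -
  define b' where "b' = b(i := deriv (b i))"
  have b': "exp_smooth (b' j)" for j by (simp add: b'_def b exp_smooth_deriv)
  have supp: "deriv (b j) t = 0" if "t \<notin> {p $ j..q $ j}" for j t
  proof -
    have "((\<lambda>_. 0) has_real_derivative 0) (at t)" by simp
    then have "(b j has_real_derivative 0) (at t)"
      by (rule has_field_derivative_transform_within_open[of _ _ _ "- {p $ j..q $ j}"]) (use that b(2) in auto)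
    then show ?thesis by (rule DERIV_imp_deriv)
  qed
  have t: "test_function (tensor b)" by (rule test_function_tensor[OF b])
  have t': "test_function (tensor b')" by (rule test_function_tensor[OF b', of p q]) (use supp b in \<open>auto simp: b'_def\<close>)
  have sgn: "(-1::real) ^ (\<Sum>j\<in>UNIV. (n + axis i 1) $ j) = - ((-1) ^ (\<Sum>j\<in>UNIV. n $ j))"
    by (simp add: sum.distrib axis_def power_add)
  have "multi_derivative (n + axis i 1) (tensor b) = multi_derivative n (tensor b')"
    unfolding multi_derivative_tensor[OF b(1)] multi_derivative_tensor[OF b']
    by (intro arg_cong[of _ _ tensor] ext) (simp add: b'_def axis_def funpow_swap1)
  then have "- ((-1) ^ (\<Sum>j\<in>UNIV. n $ j)) * (LINT x:Omega|lborel. G x * tensor b x) = (-1) ^ (\<Sum>j\<in>UNIV. n $ j) * (LINT x:Omega|lborel. F x * tensor b' x)"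
    using dF[unfolded has_distributional_derivative_def, rule_format, OF t']
      dG[unfolded has_distributional_derivative_def, rule_format, OF t] unfolding sgn by (simp only:)
  then have "(LINT x:Omega|lborel. F x * tensor b' x) = - (LINT x:Omega|lborel. G x * tensor b x)"
  proof -
    have "B = - A" if "- s * A = s * B" "s \<noteq> 0" for A B s :: real
    proof -
      have "s * B = s * (- A)" using that(1) by simp
      then show ?thesis using that(2) unfolding mult_cancel_left by simp
    qed
    from this[OF \<open>- _ * _ = _\<close>] show ?thesis by simp
  qed
  then show ?thesis unfolding b'_def[symmetric]
    by (subst (asm) (1 2) set_lebesgue_integral_Omega(2)) (auto intro!: continuous_intros F G continuous_on_tensor b b')
qed

section \<open>Classical partial derivatives from weak ones\<close>

definition vupd :: "real ^ 'd \<Rightarrow> 'd \<Rightarrow> real \<Rightarrow> real ^ 'd" where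
  "vupd x i s = (\<chi> j. if j = i then s else x $ j)"

lemma vupd_nth: "vupd x i s $ j = (if j = i then s else x $ j)"
  by (simp add: vupd_def)

lemma vupd_same [simp]: "vupd x i (x $ i) = x"
  by (simp add: vupd_def vec_eq_iff)

lemma vupd_vupd [simp]: "vupd (vupd x i s) i t = vupd x i t"
  by (simp add: vupd_def vec_eq_iff)

lemma vupd_commute: "i \<noteq> j \<Longrightarrow> vupd (vupd x i s) j t = vupd (vupd x j t) i s"
  by (auto simp: vupd_def vec_eq_iff)

lemma vupd_Omega: "x \<in> Omega \<Longrightarrow> s \<in> {-1..1} \<Longrightarrow> vupd x i s \<in> Omega"
  by (auto simp: Omega_iff vupd_nth)

lemma continuous_on_vupd [continuous_intros]:
  assumes "continuous_on S f" "continuous_on S g"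
  shows "continuous_on S (\<lambda>x. vupd (f x) i (g x))"
  unfolding vupd_def
proof (rule continuous_on_vec_lambda)
  fix j show "continuous_on S (\<lambda>x. if j = i then g x else f x $ j)"
    using assms by (cases "j = i") (auto intro: continuous_intros)
qed

lemma continuous_on_vupd_line:
  assumes "continuous_on Omega F" "c \<in> Omega" "S \<subseteq> {-1..1}"
  shows "continuous_on S (\<lambda>s. F (vupd c i s))"
  by (rule continuous_on_compose2[OF assms(1)]) (use assms in \<open>auto intro!: continuous_intros vupd_Omega\<close>)

lemma uniform_modulus_Omega:
  fixes F :: "real ^ 'd \<Rightarrow> real"
  assumes "continuous_on Omega F" "\<eta> > 0"
  obtains \<delta> where "\<delta> > 0" "\<And>x y. x \<in> Omega \<Longrightarrow> y \<in> Omega \<Longrightarrow> (\<And>j. \<bar>x $ j - y $ j\<bar> < \<delta>) \<Longrightarrow> \<bar>F x - F y\<bar> < \<eta>"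
proof -
  have "uniformly_continuous_on Omega F"
    by (rule compact_uniformly_continuous[OF assms(1)]) (simp add: Omega_def)
  then obtain d where d: "d > 0" "\<And>x y. x \<in> Omega \<Longrightarrow> y \<in> Omega \<Longrightarrow> dist y x < d \<Longrightarrow> dist (F y) (F x) < \<eta>"
    unfolding uniformly_continuous_on_def using assms(2) by metis
  define \<delta> where "\<delta> = d / real CARD('d)"
  have \<delta>: "\<delta> > 0" using d by (simp add: \<delta>_def)
  show thesis
  proof (rule that[OF \<delta>])
    fix x y :: "real ^ 'd" assume xy: "x \<in> Omega" "y \<in> Omega" "\<And>j. \<bar>x $ j - y $ j\<bar> < \<delta>"
    have "dist x y \<le> (\<Sum>j\<in>UNIV. \<bar>(x - y) $ j\<bar>)" unfolding dist_norm by (rule norm_le_l1_cart)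
    also have "\<dots> < (\<Sum>j\<in>(UNIV::'d set). \<delta>)" by (rule sum_strict_mono) (use xy(3) in auto)
    also have "\<dots> = d" by (simp add: \<delta>_def)
    finally show "\<bar>F x - F y\<bar> < \<eta>" using d(2)[OF xy(2,1)] by (simp add: dist_real_def)
  qed
qed

lemma bounded_Omega:
  fixes F :: "real ^ 'd \<Rightarrow> real"
  assumes "continuous_on Omega F"
  obtains M where "M > 0" "\<And>x. x \<in> Omega \<Longrightarrow> \<bar>F x\<bar> \<le> M"
proof -
  have "compact (F ` Omega)" by (rule compact_continuous_image[OF assms]) (simp add: Omega_def)
  then have "bounded (F ` Omega)" by (rule compact_imp_bounded)
  then show thesis using that unfolding bounded_pos by auto
qed

text \<open>Mollification at scale \<open>e\<close>, composed with the contraction \<open>c \<mapsto> (1 - 2 e) c\<close> so that it is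
  defined on all of \<open>Omega\<close>.\<close>

lemma weak_partial_imp_integral:
  fixes F G :: "real ^ 'd \<Rightarrow> real"
  assumes F: "continuous_on Omega F" and G: "continuous_on Omega G"
    and weak: "\<And>b p q. (\<And>j. exp_smooth (b j)) \<Longrightarrow> (\<And>j t. t \<notin> {p $ j..q $ j} \<Longrightarrow> b j t = 0) \<Longrightarrow>
       (\<And>j. -1 < p $ j) \<Longrightarrow> (\<And>j. q $ j < 1) \<Longrightarrow>
       integral Omega (\<lambda>x. F x * tensor (b(i := deriv (b i))) x) = - integral Omega (\<lambda>x. G x * tensor b x)"
    and c: "c \<in> Omega" and ab: "-1 \<le> u" "u \<le> v" "v \<le> 1"
  shows "integral {u..v} (\<lambda>s. G (vupd c i s)) = F (vupd c i v) - F (vupd c i u)"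
proof -
  obtain M where M: "M > 0" "\<And>x. x \<in> Omega \<Longrightarrow> \<bar>G x\<bar> \<le> M" using bounded_Omega[OF G] by blast
  have small: "\<bar>integral {u..v} (\<lambda>s. G (vupd c i s)) - (F (vupd c i v) - F (vupd c i u))\<bar> \<le> (4 + 4 * M) * \<eta>" 
    if \<eta>: "0 < \<eta>" "\<eta> < 1" for \<eta>
  proof -
    obtain d1 where d1: "d1 > 0" "\<And>x y. x \<in> Omega \<Longrightarrow> y \<in> Omega \<Longrightarrow> (\<And>j. \<bar>x $ j - y $ j\<bar> < d1) \<Longrightarrow> \<bar>F x - F y\<bar> < \<eta>"
      using uniform_modulus_Omega[OF F \<eta>(1)] by blast
    obtain d2 where d2: "d2 > 0" "\<And>x y. x \<in> Omega \<Longrightarrow> y \<in> Omega \<Longrightarrow> (\<And>j. \<bar>x $ j - y $ j\<bar> < d2) \<Longrightarrow> \<bar>G x - G y\<bar> < \<eta>"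
      using uniform_modulus_Omega[OF G \<eta>(1)] by blast
    \<comment> \<open>Averaging at radius e around r y, with r = 1 - 2 e, displaces a coordinate by
      at most e + 2 e < 4 e, within both moduli of continuity. The bound by \<eta> / 4 also controls
      the term 2 e G below.\<close>
    define e where "e = min (min d1 d2) \<eta> / 4"
    have e: "0 < e" "e < 1 / 4" "4 * e \<le> d1" "4 * e \<le> d2" "4 * e \<le> \<eta>" using \<eta> d1 d2 by (auto simp: e_def)
    define r where "r = 1 - 2 * e"
    have r: "0 < r" "r < 1" using e by (auto simp: r_def)
    obtain \<beta> where \<beta>: "exp_smooth \<beta>" "\<And>t. \<beta> t \<ge> 0" "\<And>t. \<beta> t > 0 \<longleftrightarrow> \<bar>t\<bar> < e" using bump_exists[OF e(1)] by blast
    have \<beta>0: "\<beta> t = 0 \<longleftrightarrow> e \<le> \<bar>t\<bar>" for t using \<beta>(2)[of t] \<beta>(3)[of t] by linarith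
    define b where "b = (\<lambda>y :: real ^ 'd. \<lambda>j t. \<beta> (t - r * y $ j))"
    define \<phi> where "\<phi> = (\<lambda>y. tensor (b y))"
    have bs: "exp_smooth (b y j)" for y j unfolding b_def by (rule exp_smooth_shift[OF \<beta>(1)])
    have cont\<phi>: "continuous_on S (\<phi> y)" for S y unfolding \<phi>_def by (rule continuous_on_tensor[OF bs])
    have \<phi>0: "\<phi> y x \<ge> 0" for y x unfolding \<phi>_def tensor_def b_def by (intro prod_nonneg) (use \<beta>(2) in auto)
    have supp: "\<bar>x $ j - r * y $ j\<bar> < e" if "\<phi> y x \<noteq> 0" for x y j
    proof -
      have "b y j (x $ j) \<noteq> 0" using that by (simp add: \<phi>_def tensor_def)
      then show ?thesis unfolding b_def \<beta>0 by simp
    qed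
    have rin: "\<bar>r * t\<bar> \<le> 1 - 2 * e" if "t \<in> {-1..1}" for t
    proof -
      have "\<bar>t\<bar> \<le> 1" using that by auto
      then have "r * \<bar>t\<bar> \<le> r * 1" using r by (intro mult_left_mono) auto
      then show ?thesis using r by (simp add: abs_mult r_def)
    qed
    \<comment> \<open>The mass of the kernel does not depend on its centre, since |r y_j| + e \<le>
      1 - e keeps the support inside the cube for every y in \<open>Omega\<close>.\<close>
    define Z where "Z = integral (cbox (\<chi> j. -e) (\<chi> j. e)) (\<phi> 0)"
    have Zeq: "((\<phi> y) has_integral Z) Omega" if y: "y \<in> Omega" for y
    proof -
      have "\<phi> y = (\<lambda>x. \<phi> 0 (x + - (r *\<^sub>R y)))" by (simp add: \<phi>_def tensor_def b_def fun_eq_iff)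
      moreover have "((\<lambda>x. \<phi> 0 (x + - (r *\<^sub>R y))) has_integral Z) (cbox ((\<chi> j. -e) - - (r *\<^sub>R y)) ((\<chi> j. e) - - (r *\<^sub>R y)))"
        unfolding Z_def by (intro has_integral_shift_cbox integrable_integral integrable_continuous cont\<phi>)
      ultimately have "(\<phi> y has_integral Z) (cbox ((\<chi> j. -e) - - (r *\<^sub>R y)) ((\<chi> j. e) - - (r *\<^sub>R y)))" by simp
      then show ?thesis
      proof (rule has_integral_on_superset)
        fix x assume x: "x \<notin> cbox ((\<chi> j. -e) - - (r *\<^sub>R y)) ((\<chi> j. e) - - (r *\<^sub>R y))"
        show "\<phi> y x = 0"
        proof (rule ccontr)
          assume nz: "\<phi> y x \<noteq> 0"
          have "- e + r * y $ j \<le> x $ j \<and> x $ j \<le> e + r * y $ j" for j using supp[OF nz, of j] by linarith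
          then show False using x by (simp add: mem_box_cart)
        qed
      next
        show "cbox ((\<chi> j. -e) - - (r *\<^sub>R y)) ((\<chi> j. e) - - (r *\<^sub>R y)) \<subseteq> Omega"
        proof
          fix x assume "x \<in> cbox ((\<chi> j. -e) - - (r *\<^sub>R y)) ((\<chi> j. e) - - (r *\<^sub>R y))"
          then have "- e + r * y $ j \<le> x $ j \<and> x $ j \<le> e + r * y $ j" for j by (simp add: mem_box_cart)
          moreover have "\<bar>r * y $ j\<bar> \<le> 1 - 2 * e" for j using rin y by (auto simp: Omega_iff)
          ultimately have "-1 \<le> x $ j \<and> x $ j \<le> 1" for j using e by (smt (verit))
          then show "x \<in> Omega" by (simp add: Omega_iff)
        qed
      qed
    qed
    have Z: "Z > 0"
    proof -
      have "Z \<noteq> 0"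
      proof
        assume "Z = 0"
        then have "(\<phi> 0 has_integral 0) (cbox (\<chi> j. -e) (\<chi> j. e))" unfolding Z_def[symmetric]
          by (metis Z_def integrable_integral integrable_continuous cont\<phi>)
        moreover have in0: "0 \<in> box ((\<chi> j. -e) :: real ^ 'd) (\<chi> j. e)" using e by (simp add: mem_box_cart)
        ultimately have "\<phi> 0 0 = 0"
          using has_integral_0_cbox_imp_0[OF cont\<phi>, of "\<chi> j. -e" "\<chi> j. e" 0 0] \<phi>0 box_subset_cbox by blast
        moreover have "\<phi> 0 0 \<noteq> 0" using e by (simp add: \<phi>_def tensor_def b_def \<beta>0)
        ultimately show False by simp
      qed
      moreover have "Z \<ge> 0" unfolding Z_def by (rule integral_nonneg) (auto intro: integrable_continuous cont\<phi> \<phi>0)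
      ultimately show ?thesis by simp
    qed
    define A where "A = (\<lambda>H y. integral Omega (\<lambda>x. H x * \<phi> y x) / Z)"
    have intH: "(\<lambda>x. H x * \<phi> y x) integrable_on Omega" if "continuous_on Omega H" for H y
      unfolding Omega_def by (intro integrable_continuous continuous_intros cont\<phi>) (use that in \<open>simp add: Omega_def\<close>)
    have approx: "\<bar>A H y - H y\<bar> \<le> \<eta>" 
      if H: "continuous_on Omega H" and y: "y \<in> Omega" 
        and mod: "\<And>x y. x \<in> Omega \<Longrightarrow> y \<in> Omega \<Longrightarrow> (\<And>j. \<bar>x $ j - y $ j\<bar> < 4 * e) \<Longrightarrow> \<bar>H x - H y\<bar> < \<eta>" for H y
    proof -
      have "((\<lambda>x. H x * \<phi> y x - H y * \<phi> y x) has_integral (Z * A H y - H y * Z)) Omega"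
        using Z integrable_integral[OF intH[OF H]] 
        by (intro has_integral_diff has_integral_mult_right Zeq[OF y]) (auto simp: A_def)
      then have D: "((\<lambda>x. (H x - H y) * \<phi> y x) has_integral (Z * (A H y - H y))) Omega"
        by (simp add: algebra_simps)
      have bd: "\<bar>(H x - H y) * \<phi> y x\<bar> \<le> \<eta> * \<phi> y x" if x: "x \<in> Omega" for x
      proof (cases "\<phi> y x = 0")
        case False
        have "\<bar>x $ j - y $ j\<bar> < 4 * e" for j
        proof -
          have "\<bar>y $ j\<bar> \<le> 1" using y by (auto simp: Omega_iff abs_le_iff minus_le_iff)
          then have "2 * e * \<bar>y $ j\<bar> \<le> 2 * e * 1" using e by (intro mult_left_mono) auto
          then have "\<bar>2 * e * y $ j\<bar> \<le> 2 * e" using e by (simp add: abs_mult)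
          moreover have "x $ j - y $ j = (x $ j - r * y $ j) - 2 * e * y $ j" by (simp add: r_def algebra_simps)
          ultimately show ?thesis using supp[OF False, of j] e by linarith
        qed
        then have "\<bar>H x - H y\<bar> < \<eta>" by (rule mod[OF x y])
        then show ?thesis using \<phi>0[of y x] by (simp add: abs_mult mult_right_mono)
      qed simp
      have "\<bar>Z * (A H y - H y)\<bar> \<le> \<eta> * Z"
      proof (rule abs_leI)
        show "Z * (A H y - H y) \<le> \<eta> * Z"
          by (rule has_integral_le[OF D has_integral_mult_right[OF Zeq[OF y]]]) (use bd abs_le_D1 in blast)
        show "- (Z * (A H y - H y)) \<le> \<eta> * Z"
          by (rule has_integral_le[OF has_integral_neg[OF D] has_integral_mult_right[OF Zeq[OF y]]]) (use bd abs_le_D2 in blast)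
      qed
      then show ?thesis using Z by (simp add: abs_mult mult.commute)
    qed
    have AF: "\<bar>A F y - F y\<bar> \<le> \<eta>" if "y \<in> Omega" for y
      by (rule approx[OF F that]) (use d1(2) e(3) in \<open>meson order_less_le_trans\<close>)
    have AG: "\<bar>A G y - G y\<bar> \<le> \<eta>" if "y \<in> Omega" for y
      by (rule approx[OF G that]) (use d2(2) e(4) in \<open>meson order_less_le_trans\<close>)
    \<comment> \<open>Moving the centre along axis i differentiates only the i-th factor of the
      kernel, with inner derivative -r; the weak identity moves that derivative onto
      \<open>G\<close> and changes the sign.\<close>
    have derA: "((\<lambda>s. A F (vupd c i s)) has_real_derivative r * A G (vupd c i s)) (at s within {-1..1})" if s: "s \<in> {-1..1}" for s
    proof -
      define P where "P = (\<lambda>x::real^'d. \<Prod>j\<in>UNIV - {i}. \<beta> (x $ j - r * c $ j))"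
      have contP: "continuous_on S P" for S
        unfolding P_def
      proof (rule continuous_on_prod)
        fix j
        have "continuous_on S (\<lambda>x. x $ j - r * c $ j)" by (intro continuous_intros)
        then show "continuous_on S (\<lambda>x. \<beta> (x $ j - r * c $ j))"
          by (rule continuous_on_compose2[OF exp_smooth_continuous[OF \<beta>(1), of UNIV]]) simp
      qed
      have contd: "continuous_on S (\<lambda>(s, x::real^'d). deriv \<beta> (x $ i - r * s))" for S
        unfolding split_def
      proof (rule continuous_on_compose2[OF exp_smooth_continuous[OF exp_smooth_deriv(1)[OF \<beta>(1)], of UNIV]])
        show "continuous_on S (\<lambda>z. snd z $ i - r * fst z)" by (intro continuous_intros)
      qed simp
      have \<phi>s: "\<phi> (vupd c i s) x = \<beta> (x $ i - r * s) * P x" for s x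
        unfolding \<phi>_def P_def tensor_split[of _ _ i] b_def by (auto simp: vupd_nth intro!: prod.cong)
      have d\<phi>: "tensor ((b (vupd c i s))(i := deriv (b (vupd c i s) i))) x = deriv \<beta> (x $ i - r * s) * P x" for s x
        unfolding P_def tensor_split[of _ _ i] b_def by (auto simp: vupd_nth deriv_shift[OF \<beta>(1)] intro!: prod.cong)
      have "((\<lambda>s. integral Omega (\<lambda>x. F x * (\<beta> (x $ i - r * s) * P x))) has_field_derivative 
          integral Omega (\<lambda>x. F x * ((- r) * deriv \<beta> (x $ i - r * s) * P x))) (at s within {-1..1})"
        unfolding Omega_def
      proof (rule leibniz_rule_field_derivative[where fx = "\<lambda>s x. F x * ((- r) * deriv \<beta> (x $ i - r * s) * P x)"])
        fix s :: real and x :: "real ^ 'd"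
        have "((\<lambda>s. x $ i - r * s) has_real_derivative - r) (at s)" by (auto intro!: derivative_eq_intros)
        then have "((\<lambda>s. \<beta> (x $ i - r * s)) has_real_derivative deriv \<beta> (x $ i - r * s) * (- r)) (at s)"
          by (rule DERIV_chain2[where f = \<beta> and g = "\<lambda>s. x $ i - r * s", OF exp_smooth_deriv(2)[OF \<beta>(1)]])
        then have "((\<lambda>s. F x * (\<beta> (x $ i - r * s) * P x)) has_real_derivative F x * (deriv \<beta> (x $ i - r * s) * (- r) * P x)) (at s)"
          by (intro DERIV_cmult DERIV_cmult_right)
        also have "deriv \<beta> (x $ i - r * s) * (- r) = (- r) * deriv \<beta> (x $ i - r * s)" by (rule mult.commute)
        finally show "((\<lambda>s. F x * (\<beta> (x $ i - r * s) * P x)) has_real_derivative F x * ((- r) * deriv \<beta> (x $ i - r * s) * P x)) (at s within {-1..1})"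
          by (rule has_field_derivative_at_within)
      next
        fix s :: real
        show "(\<lambda>x. F x * (\<beta> (x $ i - r * s) * P x)) integrable_on cbox (\<chi> i. - 1) (\<chi> i. 1)"
          using intH[OF F, of "vupd c i s"] by (simp add: \<phi>s Omega_def)
      next
        have "continuous_on ({-1..1} \<times> Omega) (\<lambda>z. F (snd z) * ((- r) * (\<lambda>(s, x). deriv \<beta> (x $ i - r * s)) z * P (snd z)))"
        proof (intro continuous_on_mult continuous_on_const contd)
          show "continuous_on ({-1..1} \<times> Omega) (\<lambda>z. F (snd z))"
            by (rule continuous_on_compose2[OF F]) (auto intro: continuous_on_snd continuous_on_id)
          show "continuous_on ({-1..1} \<times> Omega) (\<lambda>z. P (snd z))"
            by (rule continuous_on_compose2[OF contP[of UNIV]]) (auto intro: continuous_on_snd continuous_on_id)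
        qed
        then show "continuous_on ({-1..1} \<times> cbox (\<chi> i. - 1) (\<chi> i. 1)) (\<lambda>(s, x). F x * (- r * deriv \<beta> (x $ i - r * s) * P x))"
          by (simp add: split_def Omega_def)
      qed (use s in auto)
      also have "integral Omega (\<lambda>x. F x * ((- r) * deriv \<beta> (x $ i - r * s) * P x)) = 
         (- r) * integral Omega (\<lambda>x. F x * tensor ((b (vupd c i s))(i := deriv (b (vupd c i s) i))) x)"
        unfolding d\<phi> integral_mult_right[symmetric] by (simp only: mult_ac)
      also have "\<dots> = r * integral Omega (\<lambda>x. G x * \<phi> (vupd c i s) x)"
      proof -
        define y where "y = vupd c i s"
        have y: "y \<in> Omega" using vupd_Omega[OF c s] by (simp add: y_def)
        have "integral Omega (\<lambda>x. F x * tensor ((b y)(i := deriv (b y i))) x) = - integral Omega (\<lambda>x. G x * tensor (b y) x)"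
        proof (rule weak[of "b y" "\<chi> j. r * y $ j - e" "\<chi> j. r * y $ j + e", OF bs])
          fix j t assume "t \<notin> {(\<chi> j. r * y $ j - e) $ j..(\<chi> j. r * y $ j + e) $ j}"
          then show "b y j t = 0" by (auto simp: b_def \<beta>0)
        next
          fix j
          have "\<bar>r * y $ j\<bar> \<le> 1 - 2 * e" using rin y by (auto simp: Omega_iff)
          then show "-1 < (\<chi> j. r * y $ j - e) $ j" "(\<chi> j. r * y $ j + e) $ j < 1" using e by (auto simp: abs_le_iff)
        qed
        then show ?thesis by (simp add: \<phi>_def y_def)
      qed
      finally have "((\<lambda>s. integral Omega (\<lambda>x. F x * \<phi> (vupd c i s) x)) has_real_derivative r * integral Omega (\<lambda>x. G x * \<phi> (vupd c i s) x)) (at s within {-1..1})"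
        by (simp add: \<phi>s)
      from DERIV_cdivide[OF this, of Z] show ?thesis by (simp add: A_def)
    qed
    have I: "((\<lambda>s. r * A G (vupd c i s)) has_integral (A F (vupd c i v) - A F (vupd c i u))) {u..v}"
    proof (rule fundamental_theorem_of_calculus[OF ab(2)])
      fix s assume s: "s \<in> {u..v}"
      have s': "s \<in> {-1..1}" and sub: "{u..v} \<subseteq> {-1..1}" using s ab by auto
      have "((\<lambda>s. A F (vupd c i s)) has_real_derivative r * A G (vupd c i s)) (at s within {u..v})"
        by (rule DERIV_subset[OF derA[OF s'] sub])
      then show "((\<lambda>s. A F (vupd c i s)) has_vector_derivative r * A G (vupd c i s)) (at s within {u..v})"
        by (simp add: has_real_derivative_iff_has_vector_derivative)
    qed
    have IG: "((\<lambda>s. G (vupd c i s)) has_integral (integral {u..v} (\<lambda>s. G (vupd c i s)))) {u..v}"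
      by (intro integrable_integral integrable_continuous_real continuous_on_vupd_line G c) (use ab in auto)
    have "\<bar>integral {u..v} (\<lambda>s. G (vupd c i s)) - (A F (vupd c i v) - A F (vupd c i u))\<bar> \<le> (\<eta> + \<eta> * M) * (v - u)"
    proof -
      have D: "((\<lambda>s. G (vupd c i s) - r * A G (vupd c i s)) has_integral (integral {u..v} (\<lambda>s. G (vupd c i s)) - (A F (vupd c i v) - A F (vupd c i u)))) (cbox u v)"
        using has_integral_diff[OF IG I] by (simp only: cbox_interval)
      have "norm (integral {u..v} (\<lambda>s. G (vupd c i s)) - (A F (vupd c i v) - A F (vupd c i u))) \<le> (\<eta> + \<eta> * M) * (v - u)"
      proof -
        have "norm (integral {u..v} (\<lambda>s. G (vupd c i s)) - (A F (vupd c i v) - A F (vupd c i u))) \<le> (\<eta> + \<eta> * M) * measure lborel (cbox u v)"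
        proof (rule has_integral_bound[OF _ D])
        fix s assume "s \<in> cbox u v"
        then have y: "vupd c i s \<in> Omega" using ab by (intro vupd_Omega c) auto
        \<comment> \<open>The contraction contributes the factor r to the derivative; since 1 - r =
          2 e, its effect is a small multiple of the bounded function \<open>G\<close>.\<close>
        have "G (vupd c i s) - r * A G (vupd c i s) = r * (G (vupd c i s) - A G (vupd c i s)) + 2 * e * G (vupd c i s)"
          by (simp add: r_def algebra_simps)
        also have "\<bar>\<dots>\<bar> \<le> \<bar>r * (G (vupd c i s) - A G (vupd c i s))\<bar> + \<bar>2 * e * G (vupd c i s)\<bar>" by (rule abs_triangle_ineq)
        also have "\<dots> = r * \<bar>G (vupd c i s) - A G (vupd c i s)\<bar> + 2 * e * \<bar>G (vupd c i s)\<bar>" using r e by (simp add: abs_mult)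
        also have "\<dots> \<le> 1 * \<eta> + \<eta> * M"
          using AG[OF y] M(2)[OF y] r e \<eta> by (intro add_mono mult_mono) (auto simp: abs_minus_commute)
        finally show "norm (G (vupd c i s) - r * A G (vupd c i s)) \<le> \<eta> + \<eta> * M" by simp
      qed (use \<eta> M in auto)
      then show ?thesis using ab by simp
      qed
      then show ?thesis by simp
    qed
    also have "\<dots> \<le> (\<eta> + \<eta> * M) * 2" using ab \<eta> M by (intro mult_left_mono) auto
    finally have 1: "\<bar>integral {u..v} (\<lambda>s. G (vupd c i s)) - (A F (vupd c i v) - A F (vupd c i u))\<bar> \<le> (\<eta> + \<eta> * M) * 2" .
    have 2: "\<bar>A F (vupd c i v) - F (vupd c i v)\<bar> \<le> \<eta>" "\<bar>A F (vupd c i u) - F (vupd c i u)\<bar> \<le> \<eta>"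
      using ab by (auto intro!: AF vupd_Omega c)
    have "\<bar>integral {u..v} (\<lambda>s. G (vupd c i s)) - (F (vupd c i v) - F (vupd c i u))\<bar> \<le> (\<eta> + \<eta> * M) * 2 + 2 * \<eta>"
      using 1 2 by linarith
    also have "\<dots> \<le> (4 + 4 * M) * \<eta>" using \<eta> M by (simp add: algebra_simps)
    finally show ?thesis .
  qed
  define D where "D = \<bar>integral {u..v} (\<lambda>s. G (vupd c i s)) - (F (vupd c i v) - F (vupd c i u))\<bar>"
  have "D \<le> 0"
  proof (rule field_le_epsilon)
    fix \<epsilon> :: real assume \<epsilon>: "\<epsilon> > 0"
    define \<eta> where "\<eta> = min (1 / 2) (\<epsilon> / (4 + 4 * M))"
    have \<eta>: "0 < \<eta>" "\<eta> < 1" using \<epsilon> M by (auto simp: \<eta>_def)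
    have "D \<le> (4 + 4 * M) * \<eta>" unfolding D_def by (rule small[OF \<eta>])
    also have "\<dots> \<le> (4 + 4 * M) * (\<epsilon> / (4 + 4 * M))" using M by (intro mult_left_mono) (auto simp: \<eta>_def)
    also have "\<dots> = \<epsilon>" using M by simp
    finally show "D \<le> 0 + \<epsilon>" by simp
  qed
  then show ?thesis by (simp add: D_def)
qed

text \<open>The integral identity survives the uniform limit of the mollifications; the derivative
  is then recovered from the continuity of \<open>G\<close>. At the faces of the cube it is
  one-sided, so the result covers the closed cube.\<close>

lemma weak_partial_imp_derivative:
  fixes f F G :: "real ^ 'd \<Rightarrow> real"
  assumes F: "continuous_on Omega F" and G: "continuous_on Omega G"
    and dF: "has_distributional_derivative f n F"
    and dG: "has_distributional_derivative f (n + axis i 1) G"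
    and c: "c \<in> Omega"
  shows "((\<lambda>s. F (vupd c i s)) has_real_derivative G c) (at (c $ i) within {-1..1})"
proof -
  have contG: "continuous_on {-1..1} (\<lambda>s. G (vupd c i s))"
    by (rule continuous_on_vupd_line[OF G c]) simp
  have ci: "c $ i \<in> {-1..1}" using c by (simp add: Omega_iff)
  have eq: "F (vupd c i v) = F (vupd c i (-1)) + integral {-1..v} (\<lambda>s. G (vupd c i s))" if "v \<in> {-1..1}" for v
  proof -
    have "integral {-1..v} (\<lambda>s. G (vupd c i s)) = F (vupd c i v) - F (vupd c i (-1))"
      by (rule weak_partial_imp_integral[OF F G weak_partial_derivative[OF F G dF dG] c]) (use that in auto)
    then show ?thesis by simp
  qed
  have "((\<lambda>v. F (vupd c i (-1)) + integral {-1..v} (\<lambda>s. G (vupd c i s))) has_real_derivative 0 + G (vupd c i (c $ i))) (at (c $ i) within {-1..1})"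
    by (intro DERIV_add DERIV_const integral_has_real_derivative[OF contG ci])
  then have "((\<lambda>v. F (vupd c i v)) has_real_derivative 0 + G (vupd c i (c $ i))) (at (c $ i) within {-1..1})"
    by (rule has_field_derivative_transform_within[where d = 1]) (use ci in \<open>auto simp: eq[symmetric]\<close>)
  then show ?thesis by simp
qed

section \<open>Partial sums in several variables\<close>

definition gproj :: "real \<Rightarrow> nat \<Rightarrow> 'd \<Rightarrow> (real ^ 'd \<Rightarrow> real) \<Rightarrow> real ^ 'd \<Rightarrow> real" where
  "gproj l N i f x = gint l (\<lambda>t. gker l N (x $ i) t * f (vupd x i t))"

lemma gproj_cong:
  assumes "\<And>x. x \<in> Omega \<Longrightarrow> f x = g x" "x \<in> Omega"
  shows "gproj l N i f x = gproj l N i g x"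
  using assms by (auto simp: gproj_def gint_def vupd_Omega intro!: integral_cong)

lemma continuous_on_gker_joint:
  assumes "continuous_on S f" "continuous_on S g"
  shows "continuous_on S (\<lambda>z. gker l N (f z) (g z))"
  unfolding gker_def divide_inverse by (intro continuous_intros assms)

lemma continuous_on_gproj:
  fixes f :: "real ^ 'd \<Rightarrow> real"
  assumes l: "l > 0" and f: "continuous_on Omega f"
  shows "continuous_on Omega (gproj l N i f)"
proof -
  have "continuous_on (Omega \<times> cbox 0 pi) (\<lambda>z. gker l N (fst z $ i) (cos (snd z)) * f (vupd (fst z) i (cos (snd z))) * sin (snd z) powr (2 * l))"
  proof (intro continuous_on_mult continuous_on_gker_joint)
    show "continuous_on (Omega \<times> cbox 0 pi) (\<lambda>z::(real^'d) \<times> real. fst z $ i)" by (intro continuous_intros)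
    show "continuous_on (Omega \<times> cbox 0 pi) (\<lambda>z::(real^'d) \<times> real. cos (snd z))" by (intro continuous_intros)
    show "continuous_on (Omega \<times> cbox 0 pi) (\<lambda>z. f (vupd (fst z) i (cos (snd z))))"
      by (rule continuous_on_compose2[OF f]) (auto intro!: continuous_intros vupd_Omega)
    have "continuous_on (cbox 0 pi) (\<lambda>\<theta>. sin \<theta> powr (2 * l))" using continuous_on_sin_powr[of "2 * l"] l by simp
    then show "continuous_on (Omega \<times> cbox 0 pi) (\<lambda>z::(real^'d) \<times> real. sin (snd z) powr (2 * l))"
      by (rule continuous_on_compose2) (auto intro!: continuous_intros)
  qed
  then have "continuous_on Omega (\<lambda>x. integral (cbox 0 pi) (\<lambda>\<theta>. gker l N (x $ i) (cos \<theta>) * f (vupd x i (cos \<theta>)) * sin \<theta> powr (2 * l)))"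
    by (intro integral_continuous_on_param) (simp add: split_def)
  then show ?thesis by (simp add: gproj_def[abs_def] gint_def)
qed

lemma gproj_integrand:
  assumes "continuous_on Omega f" "x \<in> Omega"
  shows "continuous_on {-1..1} (\<lambda>t. gker l N (x $ i) t * f (vupd x i t))"
  by (intro continuous_on_mult continuous_on_gker continuous_on_vupd_line assms order_refl)

lemma gproj_diff:
  assumes "l > 0" "continuous_on Omega f" "continuous_on Omega g" "x \<in> Omega"
  shows "gproj l N i (\<lambda>x. f x - g x) x = gproj l N i f x - gproj l N i g x"
  unfolding gproj_def right_diff_distrib
  by (intro gint_diff gproj_integrand assms)

lemma fold_gproj_cong:
  "(\<And>x. x \<in> Omega \<Longrightarrow> f x = g x) \<Longrightarrow> x \<in> Omega \<Longrightarrow> fold (gproj l N) is f x = fold (gproj l N) is g x"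
proof (induction "is" arbitrary: f g)
  case (Cons i "is")
  have "fold (gproj l N) is (gproj l N i f) x = fold (gproj l N) is (gproj l N i g) x"
    by (rule Cons.IH) (auto intro: gproj_cong Cons.prems)
  then show ?case by simp
qed auto

lemma fold_gproj_diff:
  assumes "l > 0" "continuous_on Omega f" "continuous_on Omega g" "x \<in> Omega"
  shows "fold (gproj l N) is (\<lambda>x. f x - g x) x = fold (gproj l N) is f x - fold (gproj l N) is g x"
  using assms(2,3)
proof (induction "is" arbitrary: f g)
  case (Cons i "is")
  have "fold (gproj l N) (i # is) (\<lambda>x. f x - g x) x = fold (gproj l N) is (gproj l N i (\<lambda>x. f x - g x)) x" by simp
  also have "\<dots> = fold (gproj l N) is (\<lambda>x. gproj l N i f x - gproj l N i g x) x"
    by (rule fold_gproj_cong) (auto intro!: gproj_diff assms Cons.prems)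
  also have "\<dots> = fold (gproj l N) is (gproj l N i f) x - fold (gproj l N) is (gproj l N i g) x"
    by (intro Cons.IH continuous_on_gproj assms Cons.prems)
  finally show ?case by simp
qed auto

text \<open>The kernel involves only the i-th coordinate, so a derivative in another direction
  passes under the integral. This lets the error in one variable keep the mixed derivatives in the
  others.\<close>

lemma gproj_derivative:
  fixes F G :: "real ^ 'd \<Rightarrow> real"
  assumes l: "l > 0" and F: "continuous_on Omega F" and G: "continuous_on Omega G" and ij: "i \<noteq> j"
    and der: "\<And>x. x \<in> Omega \<Longrightarrow> ((\<lambda>s. F (vupd x j s)) has_real_derivative G x) (at (x $ j) within {-1..1})"
    and x: "x \<in> Omega"
  shows "((\<lambda>s. gproj l N i F (vupd x j s)) has_real_derivative gproj l N i G x) (at (x $ j) within {-1..1})"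
proof -
  define h where "h = (\<lambda>H s \<theta>. gker l N (x $ i) (cos \<theta>) * H (vupd (vupd x j s) i (cos \<theta>)) * sin \<theta> powr (2 * l))"
  have p: "gproj l N i H (vupd x j s) = integral (cbox 0 pi) (h H s)" for H s
    using ij by (simp add: gproj_def gint_def h_def vupd_nth)
  have contpt: "vupd (vupd x j s) i (cos \<theta>) \<in> Omega" if "s \<in> {-1..1}" for s \<theta>
    using x that by (intro vupd_Omega) auto
  have "((\<lambda>s. integral (cbox 0 pi) (h F s)) has_field_derivative integral (cbox 0 pi) (h G (x $ j))) (at (x $ j) within {-1..1})"
  proof (rule leibniz_rule_field_derivative)
    fix s \<theta> :: real assume s: "s \<in> {-1..1}"
    define y where "y = vupd (vupd x j s) i (cos \<theta>)"
    have y: "y \<in> Omega" "y $ j = s" using contpt[OF s] ij by (auto simp: y_def vupd_nth)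
    have "vupd y j u = vupd (vupd x j u) i (cos \<theta>)" for u
      using ij by (simp add: y_def vupd_commute)
    then have "((\<lambda>s. F (vupd (vupd x j s) i (cos \<theta>))) has_real_derivative G y) (at s within {-1..1})"
      using der[OF y(1)] y(2) by simp
    then show "((\<lambda>s. h F s \<theta>) has_real_derivative h G s \<theta>) (at s within {-1..1})"
      unfolding h_def y_def by (intro DERIV_cmult_right DERIV_cmult)
  next
    fix s :: real assume s: "s \<in> {-1..1}"
    have "(\<lambda>\<theta>. gker l N (x $ i) (cos \<theta>) * F (vupd (vupd x j s) i (cos \<theta>)) * sin \<theta> powr (2 * l)) integrable_on {0..pi}"
      by (rule gint_integrable[OF l]) (intro continuous_on_mult continuous_on_gker continuous_on_vupd_line F vupd_Omega x s order_refl)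
    then show "h F s integrable_on cbox 0 pi" by (simp add: h_def)
  next
    have "continuous_on ({-1..1} \<times> cbox 0 pi) (\<lambda>z. gker l N (x $ i) (cos (snd z)) * G (vupd (vupd x j (fst z)) i (cos (snd z))) * sin (snd z) powr (2 * l))"
    proof (intro continuous_on_mult continuous_on_gker_joint continuous_on_const)
      show "continuous_on ({-1..1} \<times> cbox 0 pi) (\<lambda>z::real \<times> real. cos (snd z))" by (intro continuous_intros)
      show "continuous_on ({-1..1} \<times> cbox 0 pi) (\<lambda>z. G (vupd (vupd x j (fst z)) i (cos (snd z))))"
        by (rule continuous_on_compose2[OF G]) (auto intro!: continuous_intros vupd_Omega x)
      have "continuous_on (cbox 0 pi) (\<lambda>\<theta>. sin \<theta> powr (2 * l))" using continuous_on_sin_powr[of "2 * l"] l by simp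
      then show "continuous_on ({-1..1} \<times> cbox 0 pi) (\<lambda>z::real \<times> real. sin (snd z) powr (2 * l))"
        by (rule continuous_on_compose2) (auto intro!: continuous_intros)
    qed
    then show "continuous_on ({-1..1} \<times> cbox 0 pi) (\<lambda>(s, \<theta>). h G s \<theta>)"
      by (simp add: h_def split_def)
  qed (use x in \<open>auto simp: Omega_iff\<close>)
  then show ?thesis unfolding p[symmetric] by simp
qed

text \<open>\<open>F n\<close> plays the role of the mixed partial derivative of \<open>F 0\<close> of order \<open>n\<close>, for \<open>n\<close> supported in
  \<open>A\<close> and bounded by \<open>r\<close>.\<close>

definition mixed_family :: "'d set \<Rightarrow> nat ^ 'd \<Rightarrow> real \<Rightarrow> (nat ^ 'd \<Rightarrow> real ^ 'd \<Rightarrow> real) \<Rightarrow> bool" where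
  "mixed_family A r M F \<longleftrightarrow> (\<forall>n. (\<forall>j. n $ j \<le> (if j \<in> A then r $ j else 0)) \<longrightarrow>
     continuous_on Omega (F n) \<and> (\<forall>x\<in>Omega. \<bar>F n x\<bar> \<le> M) \<and>
     (\<forall>i\<in>A. n $ i < r $ i \<longrightarrow> (\<forall>x\<in>Omega.
        ((\<lambda>s. F n (vupd x i s)) has_real_derivative F (n + axis i 1) x) (at (x $ i) within {-1..1}))))"

lemma mixed_family_subset:
  assumes "mixed_family B r M F" "A \<subseteq> B" shows "mixed_family A r M F"
proof -
  have "\<forall>j. n $ j \<le> (if j \<in> B then r $ j else 0)" if n: "\<forall>j. n $ j \<le> (if j \<in> A then r $ j else 0)" for n
  proof
    fix j show "n $ j \<le> (if j \<in> B then r $ j else 0)" using n[rule_format, of j] assms(2) by (auto split: if_splits)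
  qed
  then show ?thesis using assms unfolding mixed_family_def by blast
qed

text \<open>The constants precede \<open>F\<close> and \<open>M\<close> because the induction
  hypothesis is used twice: for the given family, and for the family of errors in the new variable
  i. The latter is bounded by a constant times \<open>M\<close> without any rate, since r_i > l; the
  rate of that term comes from the remaining variables.\<close>

lemma tensor_projection_error:
  fixes r :: "nat ^ 'd" and \<rho> :: real
  assumes l: "l > 0" and r: "\<And>j. real (r $ j) > l" and \<rho>: "\<And>j. \<rho> \<le> real (r $ j)" and dist: "distinct is"
  shows "\<exists>C N0. C > 0 \<and> (\<forall>N\<ge>N0. \<forall>F M. mixed_family (set is) r M F \<longrightarrow>
     (\<forall>x\<in>Omega. \<bar>F 0 x - fold (gproj l N) is (F 0) x\<bar> \<le> C * M * real N powr (l - \<rho>)))"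
  using dist
proof (induction "is")
  case Nil
  have "M \<ge> 0" if "mixed_family {} r M F" for F M
  proof -
    have "\<bar>F 0 (0 :: real ^ 'd)\<bar> \<le> M" using that by (auto simp: mixed_family_def Omega_iff)
    then show ?thesis by linarith
  qed
  then show ?case by (intro exI[of _ 1]) auto
next
  case (Cons i "is")
  define A where "A = set is"
  have iA: "i \<notin> A" using Cons.prems by (simp add: A_def)
  obtain C N0 where C: "C > 0" 
    and "\<forall>N\<ge>N0. \<forall>F M. mixed_family A r M F \<longrightarrow>
     (\<forall>x\<in>Omega. \<bar>F 0 x - fold (gproj l N) is (F 0) x\<bar> \<le> C * M * real N powr (l - \<rho>))"
    using Cons unfolding A_def by auto
  then have IH: "\<And>N F M x. N \<ge> N0 \<Longrightarrow> mixed_family A r M F \<Longrightarrow> x \<in> Omega \<Longrightarrow> \<bar>F 0 x - fold (gproj l N) is (F 0) x\<bar> \<le> C * M * real N powr (l - \<rho>)"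
    by blast
  obtain C1 N1 where C1: "C1 > 0" and pe:
   "\<And>N h M x. N \<ge> N1 \<Longrightarrow> 
      (\<And>j x. j < r $ i \<Longrightarrow> x \<in> {-1..1} \<Longrightarrow> (h j has_real_derivative h (Suc j) x) (at x within {-1..1})) \<Longrightarrow>
      continuous_on {-1..1} (h 0) \<Longrightarrow>
      (\<And>x. x \<in> {-1..1} \<Longrightarrow> \<bar>h (r $ i) x\<bar> \<le> M) \<Longrightarrow> x \<in> {-1..1} \<Longrightarrow>
      \<bar>h 0 x - gint l (\<lambda>t. gker l N x t * h 0 t)\<bar> \<le> C1 * M * real N powr (l - real (r $ i))"
    using projection_error[OF l, of "r $ i"] by blast
  show ?case
  \<comment> \<open>The three summands belong to the error in the old variables, the error in the
    new one, and the old-variable error of the new-variable error.\<close>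
  proof (intro exI[of _ "C + C1 + C * C1"] exI[of _ "max 1 (max N0 N1)"] conjI allI impI ballI)
    show "C + C1 + C * C1 > 0" using C C1 by (simp add: add_pos_pos)
    fix N F M and x :: "real ^ 'd"
    assume N: "max 1 (max N0 N1) \<le> N" and fam: "mixed_family (set (i # is)) r M F" and x: "x \<in> Omega"
    have fam': "continuous_on Omega (F n)" "x \<in> Omega \<Longrightarrow> \<bar>F n x\<bar> \<le> M"
       "j \<in> insert i A \<Longrightarrow> n $ j < r $ j \<Longrightarrow> x \<in> Omega \<Longrightarrow>
          ((\<lambda>s. F n (vupd x j s)) has_real_derivative F (n + axis j 1) x) (at (x $ j) within {-1..1})"
      if n: "\<And>j. n $ j \<le> (if j \<in> insert i A then r $ j else 0)" for n x j
      using fam n unfolding mixed_family_def A_def by auto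
    have M: "M \<ge> 0" using fam'(2)[of 0 0] by (auto simp: Omega_iff)
    \<comment> \<open>Since n_i = 0, the derivatives of \<open>F n\<close> in direction i up to
      order r_i belong to the family for the enlarged set, so the one-variable estimate applies to
      every mixed derivative in the old variables.\<close>
    have T: "\<bar>F n y - gproj l N i (F n) y\<bar> \<le> C1 * M * real N powr (l - real (r $ i))"
      if n: "\<And>j. n $ j \<le> (if j \<in> A then r $ j else 0)" and y: "y \<in> Omega" for n y
    proof -
      have ni: "n $ i = 0" using n[of i] iA by simp
      define h where "h = (\<lambda>k t. F (n + axis i k) (vupd y i t))"
      have le: "(n + axis i k) $ j \<le> (if j \<in> insert i A then r $ j else 0)" if "k \<le> r $ i" for k j
        using n[of j] that ni by (auto simp: axis_def split: if_splits)
      have ax0: "axis i (0::nat) = (0 :: nat ^ 'd)" by (simp add: axis_def vec_eq_iff)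
      have h0: "h 0 = (\<lambda>t. F n (vupd y i t))" by (simp only: h_def ax0 add_0_right)
      have "\<bar>h 0 (y $ i) - gint l (\<lambda>t. gker l N (y $ i) t * h 0 t)\<bar> \<le> C1 * M * real N powr (l - real (r $ i))"
      proof (rule pe)
        show "N \<ge> N1" using N by simp
      next
        fix k t assume k: "k < r $ i" and t: "(t::real) \<in> {-1..1}"
        have ax: "n + axis i k + axis i 1 = n + axis i (Suc k)" by (auto simp: vec_eq_iff axis_def)
        have "((\<lambda>s. F (n + axis i k) (vupd (vupd y i t) i s)) has_real_derivative F (n + axis i k + axis i 1) (vupd y i t)) (at (vupd y i t $ i) within {-1..1})"
          by (rule fam'(3)[OF le]) (use k ni t y in \<open>auto intro: vupd_Omega simp: axis_def\<close>)
        then show "(h k has_real_derivative h (Suc k) t) (at t within {-1..1})"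
          unfolding ax by (simp add: h_def[abs_def] vupd_nth)
      next
        show "continuous_on {-1..1} (h 0)" unfolding h_def
          by (intro continuous_on_vupd_line fam'(1)[OF le] y) auto
      next
        fix t :: real assume "t \<in> {-1..1}"
        then show "\<bar>h (r $ i) t\<bar> \<le> M" unfolding h_def by (intro fam'(2)[OF le] vupd_Omega y) auto
      qed (use y in \<open>auto simp: Omega_iff\<close>)
      then show ?thesis by (simp add: h0 gproj_def)
    qed
    have Nr: "real N powr (l - real (r $ i)) \<le> 1"
      using N r[of i] powr_mono[of "l - real (r $ i)" 0 "real N"] by simp
    have N\<rho>: "real N powr (l - real (r $ i)) \<le> real N powr (l - \<rho>)"
      using N \<rho>[of i] by (intro powr_mono) auto
    define H where "H = (\<lambda>n y. F n y - gproj l N i (F n) y)"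
    have Hfam: "mixed_family A r (C1 * M) H"
      unfolding mixed_family_def
    proof (intro allI impI conjI ballI)
      fix n assume n: "\<forall>j. n $ j \<le> (if j \<in> A then r $ j else 0)"
      then have n': "\<And>j. n $ j \<le> (if j \<in> insert i A then r $ j else 0)" by (metis insertCI le_zero_eq zero_le)
      show "continuous_on Omega (H n)" unfolding H_def
        by (intro continuous_on_diff continuous_on_gproj l fam'(1) n')
      show "\<bar>H n y\<bar> \<le> C1 * M" if y: "y \<in> Omega" for y
      proof -
        have "\<bar>H n y\<bar> \<le> C1 * M * real N powr (l - real (r $ i))" unfolding H_def using T[OF _ y] n by blast
        also have "\<dots> \<le> C1 * M * 1" using C1 M Nr by (intro mult_left_mono) auto
        finally show ?thesis by simp
      qed
      fix j and y :: "real ^ 'd" assume j: "j \<in> A" "n $ j < r $ j" and y: "y \<in> Omega"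
      have ij: "i \<noteq> j" using j iA by auto
      have n2: "(n + axis j 1) $ k \<le> (if k \<in> insert i A then r $ k else 0)" for k
        using n'[of k] j by (auto simp: axis_def)
      have d: "((\<lambda>s. F n (vupd x j s)) has_real_derivative F (n + axis j 1) x) (at (x $ j) within {-1..1})" if "x \<in> Omega" for x
        by (rule fam'(3)[OF n']) (use j that in auto)
      show "((\<lambda>s. H n (vupd y j s)) has_real_derivative H (n + axis j 1) y) (at (y $ j) within {-1..1})"
        unfolding H_def by (intro DERIV_diff d gproj_derivative l fam'(1) n' n2 ij y)
    qed
    have cF: "continuous_on Omega (F 0)" by (rule fam'(1)) simp
    have cH: "continuous_on Omega (H 0)" unfolding H_def by (intro continuous_on_diff continuous_on_gproj l cF)
    have "fold (gproj l N) (i # is) (F 0) x = fold (gproj l N) is (\<lambda>y. F 0 y - H 0 y) x"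
      by (simp add: H_def)
    also have "\<dots> = fold (gproj l N) is (F 0) x - fold (gproj l N) is (H 0) x"
      by (rule fold_gproj_diff[OF l cF cH x])
    finally have "F 0 x - fold (gproj l N) (i # is) (F 0) x = 
       (F 0 x - fold (gproj l N) is (F 0) x) + H 0 x - (H 0 x - fold (gproj l N) is (H 0) x)" by simp
    moreover have "\<bar>F 0 x - fold (gproj l N) is (F 0) x\<bar> \<le> C * M * real N powr (l - \<rho>)"
      using N by (intro IH[OF _ _ x] mixed_family_subset[OF fam]) (auto simp: A_def)
    moreover have "\<bar>H 0 x - fold (gproj l N) is (H 0) x\<bar> \<le> C * (C1 * M) * real N powr (l - \<rho>)"
      using N by (intro IH[OF _ Hfam x]) auto
    moreover have "\<bar>H 0 x\<bar> \<le> C1 * M * real N powr (l - \<rho>)"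
    proof -
      have "\<bar>H 0 x\<bar> \<le> C1 * M * real N powr (l - real (r $ i))" unfolding H_def by (rule T[OF _ x]) simp
      also have "\<dots> \<le> C1 * M * real N powr (l - \<rho>)" using C1 M N\<rho> by (intro mult_left_mono) auto
      finally show ?thesis .
    qed
    ultimately have "\<bar>F 0 x - fold (gproj l N) (i # is) (F 0) x\<bar> \<le> C * M * real N powr (l - \<rho>) + C1 * M * real N powr (l - \<rho>) + C * (C1 * M) * real N powr (l - \<rho>)"
      by linarith
    also have "\<dots> = (C + C1 + C * C1) * M * real N powr (l - \<rho>)" by (simp add: algebra_simps)
    finally show "\<bar>F 0 x - fold (gproj l N) (i # is) (F 0) x\<bar> \<le> (C + C1 + C * C1) * M * real N powr (l - \<rho>)" .
  qed
qed

section \<open>Identification with the Gegenbauer coefficients\<close>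

lemma gweight_nonneg: "gweight l x \<ge> 0"
  by (simp add: gweight_def)

lemma gweight_cos:
  "gweight l (cos \<theta>) * \<bar>sin \<theta>\<bar> = \<bar>sin \<theta>\<bar> powr (2 * l)"
proof (cases "sin \<theta> = 0")
  case False
  have "1 - (cos \<theta>)\<^sup>2 = \<bar>sin \<theta>\<bar> powr 2" using False by (simp add: sin_squared_eq[symmetric])
  then have "gweight l (cos \<theta>) = \<bar>sin \<theta>\<bar> powr (2 * (l - 1 / 2))" by (simp only: gweight_def powr_powr)
  moreover have "\<bar>sin \<theta>\<bar> = \<bar>sin \<theta>\<bar> powr 1" using False by simp
  ultimately have "gweight l (cos \<theta>) * \<bar>sin \<theta>\<bar> = \<bar>sin \<theta>\<bar> powr (2 * (l - 1 / 2)) * \<bar>sin \<theta>\<bar> powr 1" by metis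
  also have "\<dots> = \<bar>sin \<theta>\<bar> powr (2 * l)" by (simp only: powr_add[symmetric]) (simp add: algebra_simps)
  finally show ?thesis .
qed simp

text \<open>On [-pi, 0] the cosine increases from -1 to 1, as the substitution rules below want it;
  on [0, pi] the orientation would be reversed.\<close>

lemma cos_substitution:
  "\<And>s. s \<in> {-pi..0} \<Longrightarrow> (cos has_real_derivative - sin s) (at s)"
  "continuous_on {-pi..0} (\<lambda>s. - sin s :: real)"
  "\<And>s. s \<in> {-pi..0} \<Longrightarrow> - sin s \<ge> 0"
proof -
  fix s :: real assume "s \<in> {-pi..0}"
  then have "sin (- s) \<ge> 0" by (intro sin_ge_zero) auto
  then show "- sin s \<ge> 0" by simp
qed (auto intro!: derivative_eq_intros continuous_intros)

text \<open>For l < 1/2 the weight is unbounded at the endpoints. After the substitution the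
  integrand is a nonnegative power of |sin s|, at most 1.\<close>

lemma gweight_integrable:
  assumes l: "l > 0"
  shows "set_integrable lborel {-1..1} (gweight l)"
proof -
  have meas: "gweight l \<in> borel_measurable borel" unfolding gweight_def[abs_def] by measurable
  have "(\<integral>\<^sup>+x. ennreal (gweight l x * indicator {cos (-pi)..cos 0} x) \<partial>lborel) =
     (\<integral>\<^sup>+s. ennreal (gweight l (cos s) * (- sin s) * indicator {-pi..0} s) \<partial>lborel)"
    by (rule nn_integral_substitution[where f = "gweight l" and g = cos and g' = "\<lambda>s. - sin s" and a = "-pi" and b = 0, OF _ cos_substitution])
       (use meas in \<open>simp_all add: set_borel_measurable_def\<close>)
  also have "\<dots> \<le> (\<integral>\<^sup>+s. indicator {-pi..0} s \<partial>lborel)"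
  proof (intro nn_integral_mono)
    fix s :: real
    show "ennreal (gweight l (cos s) * (- sin s) * indicator {-pi..0} s) \<le> indicator {-pi..0} s"
    proof (cases "s \<in> {-pi..0}")
      case True
      then have "- sin s = \<bar>sin s\<bar>" using cos_substitution(3)[of s] by linarith
      then have "gweight l (cos s) * (- sin s) = \<bar>sin s\<bar> powr (2 * l)" by (simp only: gweight_cos)
      also have "\<dots> \<le> 1" using l powr_mono2[of "2 * l" "\<bar>sin s\<bar>" 1] by simp
      finally have "ennreal (gweight l (cos s) * (- sin s)) \<le> 1" by (metis ennreal_1 ennreal_leI)
      then show ?thesis using True by simp
    qed simp
  qed
  also have "\<dots> < \<infinity>" by (simp add: less_top[symmetric])
  finally have fin: "(\<integral>\<^sup>+x. ennreal (gweight l x * indicator {-1..1} x) \<partial>lborel) < \<infinity>" by simp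
  have "integrable lborel (\<lambda>x. gweight l x * indicator {-1..1} x)"
  proof (rule integrableI_nonneg)
    show "(\<lambda>x. gweight l x * indicator {-1..1} x) \<in> borel_measurable lborel" using meas by simp
  qed (use fin gweight_nonneg in auto)
  then show ?thesis by (simp add: set_integrable_def mult.commute)
qed

lemma set_integrable_bounded_mult:
  fixes f g :: "'a \<Rightarrow> real"
  assumes f: "set_integrable M S f" and g: "set_integrable M S g" and B: "\<And>x. x \<in> S \<Longrightarrow> \<bar>f x\<bar> \<le> B"
  shows "set_integrable M S (\<lambda>x. f x * g x)"
  unfolding set_integrable_def
proof (rule Bochner_Integration.integrable_bound)
  have eq: "(\<lambda>x. indicat_real S x *\<^sub>R (f x * g x)) = (\<lambda>x. (indicat_real S x *\<^sub>R f x) * (indicat_real S x *\<^sub>R g x))"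
    by (auto simp: indicator_def)
  show "integrable M (\<lambda>x. B * (indicat_real S x *\<^sub>R g x))"
    using g unfolding set_integrable_def by (rule integrable_mult_right)
  show "(\<lambda>x. indicat_real S x *\<^sub>R (f x * g x)) \<in> borel_measurable M"
    unfolding eq using f g unfolding set_integrable_def by (intro borel_measurable_times borel_measurable_integrable)
  have "\<bar>f x * g x\<bar> \<le> \<bar>B * g x\<bar>" if "x \<in> S" for x
    unfolding abs_mult using B[OF that] by (intro mult_right_mono) auto
  then show "AE x in M. norm (indicat_real S x *\<^sub>R (f x * g x)) \<le> norm (B * (indicat_real S x *\<^sub>R g x))"
    by (intro AE_I2) (auto simp: indicator_def)
qed

lemma gweight_times_integrable:
  assumes l: "l > 0" and f: "continuous_on {-1..1} f"
  shows "set_integrable lborel {-1..1} (\<lambda>x. f x * gweight l x)"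
proof -
  have "compact (f ` {-1..1})" by (rule compact_continuous_image[OF f]) simp
  then have "bounded (f ` {-1..1})" by (rule compact_imp_bounded)
  then obtain M where "\<forall>y\<in>f ` {-1..1}. norm y \<le> M" unfolding bounded_iff by blast
  then have M: "\<bar>f x\<bar> \<le> M" if "x \<in> {-1..1}" for x using that by force
  show ?thesis
    by (rule set_integrable_bounded_mult[OF borel_integrable_atLeastAtMost'[OF f] gweight_integrable[OF l] M])
qed

lemma lebesgue_eq_gint:
  assumes l: "l > 0" and f: "continuous_on {-1..1} f"
  shows "(LINT x:{-1..1}|lborel. f x * gweight l x) = gint l f"
proof -
  define h where "h = (\<lambda>s. f (cos s) * \<bar>sin s\<bar> powr (2 * l))"
  have conth: "continuous_on {-pi..0} h"
  proof -
    have "continuous_on {-pi..0} (\<lambda>s. \<bar>sin s\<bar> powr (2 * l))"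
      using l by (intro continuous_on_powr' continuous_intros) auto
    then show ?thesis unfolding h_def by (intro continuous_on_mult continuous_on_comp_cos f)
  qed
  have si: "set_integrable lborel {cos (-pi)..cos 0} (\<lambda>x. f x * gweight l x)"
    using gweight_times_integrable[OF l f] by simp
  have "(LINT x:{-1..1}|lborel. f x * gweight l x) = (LBINT x. (f x * gweight l x) * indicator {cos (-pi)..cos 0} x)"
    by (simp add: set_lebesgue_integral_def mult.commute)
  also have "\<dots> = (LBINT s. (f (cos s) * gweight l (cos s)) * (- sin s) * indicator {-pi..0} s)"
    by (rule integral_substitution(2)[where f = "\<lambda>x. f x * gweight l x" and g = cos and g' = "\<lambda>s. - sin s" and a = "-pi" and b = 0, OF si cos_substitution]) simp_all
  also have "\<dots> = (LINT s:{-pi..0}|lborel. h s)"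
    unfolding set_lebesgue_integral_def
  proof (rule Bochner_Integration.integral_cong[OF refl])
    fix s :: real
    show "(f (cos s) * gweight l (cos s)) * (- sin s) * indicator {-pi..0} s = indicat_real {-pi..0} s *\<^sub>R h s"
    proof (cases "s \<in> {-pi..0}")
      case True
      then have "- sin s = \<bar>sin s\<bar>" using cos_substitution(3)[of s] by linarith
      then have "gweight l (cos s) * (- sin s) = \<bar>sin s\<bar> powr (2 * l)" by (simp only: gweight_cos)
      then have "f (cos s) * (gweight l (cos s) * (- sin s)) = h s" by (simp only: h_def)
      then show ?thesis using True by (simp add: mult.assoc)
    qed simp
  qed
  also have "\<dots> = integral {-pi..0} h"
    by (rule set_borel_integral_eq_integral(2)[OF borel_integrable_atLeastAtMost'[OF conth]])
  also have "\<dots> = integral {0..pi} (\<lambda>s. h (- s))"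
    using Henstock_Kurzweil_Integration.integral_reflect_real[of pi 0 "\<lambda>s. h (- s)"] by simp
  also have "\<dots> = gint l f" unfolding gint_def h_def
    by (intro integral_cong) (simp add: sin_ge_zero)
  finally show ?thesis .
qed

text \<open>Subtracting the multiple that cancels the top coefficient leaves a polynomial of smaller
  degree which is orthogonal to all polynomials of degree below n, hence to itself.\<close>

lemma poly_unique_orthogonal:
  assumes l: "l > 0" and p: "degree p = n" "\<And>q. degree q < n \<Longrightarrow> gint l (\<lambda>x. poly p x * poly q x) = 0"
  shows "\<exists>a. p = smult a (ngeg l n)"
proof -
  define a where "a = coeff p n / coeff (ngeg l n) n"
  define d where "d = p - smult a (ngeg l n)"
  have c: "coeff (ngeg l n) n > 0" using ngeg_degree_coeff[OF l] by blast
  have dn: "coeff d n = 0" using c by (simp add: d_def a_def)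
  have dle: "degree d \<le> n" unfolding d_def using p(1) degree_ngeg[OF l, of n]
    by (intro degree_diff_le) (auto intro: order_trans[OF degree_smult_le])
  have "d = 0"
  proof (rule ccontr)
    assume d0: "d \<noteq> 0"
    then have dl: "degree d < n" using dle dn by (metis le_neq_implies_less leading_coeff_0_iff)
    obtain b where b: "d = (\<Sum>k\<le>degree d. smult (b k) (ngeg l k))" using poly_ngeg_expansion[OF l, of d "degree d"] by blast
    have pd: "poly d x = (\<Sum>k\<le>degree d. b k * ng l k x)" for x
      using arg_cong[OF b, of "\<lambda>p. poly p x"] by (simp add: poly_sum)
    have "gint l (\<lambda>x. ng l n x * poly d x) = gint l (\<lambda>x. \<Sum>k\<le>degree d. b k * (ng l n x * ng l k x))"
      unfolding pd by (simp add: sum_distrib_left mult_ac)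
    also have "\<dots> = (\<Sum>k\<le>degree d. b k * gint l (\<lambda>x. ng l n x * ng l k x))"
      by (subst gint_sum[OF l]) (auto intro!: continuous_intros simp: gint_cmult)
    also have "\<dots> = 0" using dl by (intro sum.neutral) (auto simp: ng_inner[OF l])
    finally have o: "gint l (\<lambda>x. ng l n x * poly d x) = 0" .
    have "gint l (\<lambda>x. (poly d x)\<^sup>2) = gint l (\<lambda>x. poly p x * poly d x - a * (ng l n x * poly d x))"
      by (rule arg_cong[of _ _ "gint l"]) (simp add: d_def fun_eq_iff power2_eq_square algebra_simps)
    also have "\<dots> = 0" using o p(2)[OF dl]
      by (subst gint_diff[OF l]) (auto intro!: continuous_intros simp: gint_cmult)
    finally show False using gint_square_pos[OF l d0] by simp
  qed
  then show ?thesis unfolding d_def by auto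
qed

text \<open>Resolves the definite description in \<open>gegenbauer\<close>: the value at 1 singles
  out one multiple. Only the factor being nonzero is exported, because it cancels in the partial
  sums.\<close>

lemma gegenbauer_eq_ngeg:
  assumes l: "l > 0"
  obtains c where "c \<noteq> 0" "gegenbauer l n = smult c (ngeg l n)"
proof -
  define c where "c = Gamma (real n + 2 * l) / (fact n * Gamma (2 * l))"
  have "real n + 2 * l > 0" using l by (simp add: add_nonneg_pos)
  then have "c > 0" unfolding c_def using l by (intro divide_pos_pos mult_pos_pos Gamma_real_pos) auto
  then have c: "c \<noteq> 0" by simp
  have L: "(LINT x:{-1..1}|lborel. poly p x * poly q x * gweight l x) = gint l (\<lambda>x. poly p x * poly q x)" for p q
    by (rule lebesgue_eq_gint[OF l]) (intro continuous_intros)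
  have "gegenbauer l n = smult c (ngeg l n)"
    unfolding gegenbauer_def L c_def[symmetric]
  proof (rule the_equality)
    have "gint l (\<lambda>x. poly (smult c (ngeg l n)) x * poly q x) = 0" if "degree q < n" for q
    proof -
      obtain b where b: "q = (\<Sum>k\<le>degree q. smult (b k) (ngeg l k))" using poly_ngeg_expansion[OF l, of q "degree q"] by blast
      have pq: "poly q x = (\<Sum>k\<le>degree q. b k * ng l k x)" for x
        using arg_cong[OF b, of "\<lambda>p. poly p x"] by (simp add: poly_sum)
      have "gint l (\<lambda>x. poly (smult c (ngeg l n)) x * poly q x) = gint l (\<lambda>x. \<Sum>k\<le>degree q. c * b k * (ng l n x * ng l k x))"
        unfolding pq by (simp add: sum_distrib_left mult_ac)
      also have "\<dots> = (\<Sum>k\<le>degree q. c * b k * gint l (\<lambda>x. ng l n x * ng l k x))"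
        by (subst gint_sum[OF l]) (auto intro!: continuous_intros simp: gint_cmult)
      also have "\<dots> = 0" using that by (intro sum.neutral) (auto simp: ng_inner[OF l])
      finally show ?thesis .
    qed
    then show "degree (smult c (ngeg l n)) = n \<and> (\<forall>q. degree q < n \<longrightarrow> gint l (\<lambda>x. poly (smult c (ngeg l n)) x * poly q x) = 0) \<and> poly (smult c (ngeg l n)) 1 = c"
      using c degree_ngeg[OF l] by (simp add: ng_1)
  next
    fix p assume p: "degree p = n \<and> (\<forall>q. degree q < n \<longrightarrow> gint l (\<lambda>x. poly p x * poly q x) = 0) \<and> poly p 1 = c"
    then obtain a where a: "p = smult a (ngeg l n)" using poly_unique_orthogonal[OF l, of p n] by blast
    then have "a = c" using p by (simp add: ng_1)
    then show "p = smult c (ngeg l n)" using a by simp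
  qed
  then show thesis using that c by blast
qed

text \<open>Fubini for products: Lebesgue measure is the image of the product measure indexed by
  \<open>Basis\<close>. The auxiliary \<open>ix\<close> translates basis vectors back to
  coordinates.\<close>

lemma lborel_integral_tensor:
  fixes u :: "'d::finite \<Rightarrow> real \<Rightarrow> real"
  assumes u: "\<And>j. integrable lborel (u j)"
  shows "integrable lborel (tensor u)" "integral\<^sup>L lborel (tensor u) = (\<Prod>j\<in>UNIV. integral\<^sup>L lborel (u j))"
proof -
  interpret product_sigma_finite "\<lambda>_ :: real ^ 'd. lborel :: real measure" ..
  define P where "P = Pi\<^sub>M (Basis :: (real ^ 'd) set) (\<lambda>_. lborel :: real measure)"
  define g where "g = (\<lambda>f. \<Sum>b\<in>(Basis :: (real ^ 'd) set). f b *\<^sub>R b)"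
  define ix where "ix = inv_into (UNIV :: 'd set) (\<lambda>j. axis j (1::real))"
  have inj: "inj (\<lambda>j :: 'd. axis j (1::real))" by (auto simp: inj_on_def axis_eq_axis)
  have bij: "bij_betw (\<lambda>j :: 'd. axis j (1::real)) UNIV Basis"
    using inj by (auto simp: bij_betw_def Basis_vec_def)
  have ix: "ix (axis j 1) = j" for j unfolding ix_def by (rule inv_f_f[OF inj])
  have gm: "g \<in> measurable P borel" unfolding g_def P_def by measurable
  have um: "u j \<in> borel_measurable borel" for j using borel_measurable_integrable[OF u, of j] by simp
  have tm: "tensor u \<in> borel_measurable borel"
  proof -
    have "(\<lambda>x :: real ^ 'd. u j (x $ j)) \<in> borel_measurable borel" for j
      by (rule measurable_compose[OF _ um]) (intro borel_measurable_continuous_onI continuous_intros)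
    then show ?thesis unfolding tensor_def[abs_def] by (intro borel_measurable_prod)
  qed
  have lb: "(lborel :: (real ^ 'd) measure) = distr P borel g" unfolding P_def g_def by (rule lborel_eq)
  have eq: "tensor u (g f) = (\<Prod>b\<in>Basis. u (ix b) (f b))" for f
  proof -
    have "g f $ j = f (axis j 1)" for j
      unfolding cart_eq_inner_axis g_def by (rule inner_sum_left_Basis) simp
    then have "tensor u (g f) = (\<Prod>j\<in>UNIV. u (ix (axis j 1)) (f (axis j 1)))" by (simp add: tensor_def ix)
    also have "\<dots> = (\<Prod>b\<in>Basis. u (ix b) (f b))" by (rule prod.reindex_bij_betw[OF bij])
    finally show ?thesis .
  qed
  have "integrable P (\<lambda>f. \<Prod>b\<in>Basis. u (ix b) (f b))"
    unfolding P_def by (rule product_integrable_prod) (auto intro: u)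
  then show "integrable lborel (tensor u)"
    unfolding lb integrable_distr_eq[OF gm tm] eq .
  have "integral\<^sup>L lborel (tensor u) = integral\<^sup>L P (\<lambda>f. \<Prod>b\<in>Basis. u (ix b) (f b))"
    unfolding lb integral_distr[OF gm tm] eq ..
  also have "\<dots> = (\<Prod>b\<in>Basis. integral\<^sup>L lborel (u (ix b)))"
    unfolding P_def by (rule product_integral_prod) (auto intro: u)
  also have "\<dots> = (\<Prod>j\<in>UNIV. integral\<^sup>L lborel (u (ix (axis j 1))))"
    by (rule prod.reindex_bij_betw[OF bij, symmetric])
  finally show "integral\<^sup>L lborel (tensor u) = (\<Prod>j\<in>UNIV. integral\<^sup>L lborel (u j))" by (simp add: ix)
qed

lemma indicator_Omega: "indicat_real Omega x = (\<Prod>j\<in>UNIV. indicat_real {-1..1} (x $ j))"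
proof (cases "x \<in> Omega")
  case True then show ?thesis by (simp add: Omega_iff)
next
  case False
  then obtain j where "x $ j \<notin> {-1..1}" by (auto simp: Omega_iff)
  then have "indicat_real {-1..1} (x $ j) = 0" by (simp add: indicator_def)
  then have "(\<Prod>j\<in>UNIV. indicat_real {-1..1} (x $ j)) = 0" by (intro prod_zero) (auto intro!: bexI[of _ j] simp del: indicator_simps)
  then show ?thesis using False by simp
qed

lemma Omega_integral_tensor:
  fixes u :: "'d::finite \<Rightarrow> real \<Rightarrow> real"
  assumes u: "\<And>j. set_integrable lborel {-1..1} (u j)"
  shows "set_integrable lborel Omega (tensor u)" 
    "(LINT x:Omega|lborel. tensor u x) = (\<Prod>j\<in>UNIV. LINT t:{-1..1}|lborel. u j t)"
proof -
  define v where "v = (\<lambda>j t. indicat_real {-1..1} t *\<^sub>R u j t)"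
  have eq: "(\<lambda>x :: real ^ 'd. indicat_real Omega x *\<^sub>R tensor u x) = tensor v"
    by (simp add: fun_eq_iff tensor_def v_def indicator_Omega prod.distrib)
  have v: "integrable lborel (v j)" for j using u[of j] by (simp add: v_def set_integrable_def)
  show "set_integrable lborel Omega (tensor u)" unfolding set_integrable_def eq by (rule lborel_integral_tensor[OF v])
  show "(LINT x:Omega|lborel. tensor u x) = (\<Prod>j\<in>UNIV. LINT t:{-1..1}|lborel. u j t)"
    unfolding set_lebesgue_integral_def eq lborel_integral_tensor(2)[OF v] by (simp add: v_def)
qed

text \<open>The dense algebra on which the partial sum and the iterated projections can be compared
  factor by factor.\<close>

inductive tensor_sum :: "(real ^ 'd \<Rightarrow> real) \<Rightarrow> bool" where
  tensor_sum_tensor: "(\<And>j. continuous_on UNIV (b j)) \<Longrightarrow> tensor_sum (tensor b)"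
| tensor_sum_add: "tensor_sum f \<Longrightarrow> tensor_sum g \<Longrightarrow> tensor_sum (\<lambda>x. f x + g x)"

lemma tensor_sum_mult:
  fixes f g :: "real ^ 'd \<Rightarrow> real"
  assumes "tensor_sum f" "tensor_sum g" shows "tensor_sum (\<lambda>x. f x * g x)"
proof -
  have 1: "tensor_sum (\<lambda>x. tensor a x * g x)" if a: "\<And>j. continuous_on UNIV (a j)" and "tensor_sum g" for a and g :: "real ^ 'd \<Rightarrow> real"
    using that(2)
  proof induction
    case (tensor_sum_tensor b)
    have "(\<lambda>x. tensor a x * tensor b x) = tensor (\<lambda>j t. a j t * b j t)" by (simp add: tensor_def fun_eq_iff prod.distrib)
    then show ?case using tensor_sum.tensor_sum_tensor[of "\<lambda>j t. a j t * b j t"] a tensor_sum_tensor by (auto intro: continuous_on_mult)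
  next
    case (tensor_sum_add f g)
    then show ?case using tensor_sum.tensor_sum_add[of "\<lambda>x. tensor a x * f x" "\<lambda>x. tensor a x * g x"] by (simp add: distrib_left)
  qed
  show ?thesis using assms(1)
  proof induction
    case (tensor_sum_tensor b) then show ?case using 1 assms(2) by blast
  next
    case (tensor_sum_add f h)
    then show ?case using tensor_sum.tensor_sum_add[of "\<lambda>x. f x * g x" "\<lambda>x. h x * g x"] by (simp add: distrib_right)
  qed
qed

lemma continuous_on_tensor_continuous:
  assumes "\<And>j. continuous_on UNIV (b j)" shows "continuous_on S (tensor b)"
  unfolding tensor_def
proof (rule continuous_on_prod)
  fix j
  have "continuous_on S (\<lambda>x. x $ j)" by (intro continuous_intros)
  then show "continuous_on S (\<lambda>x. b j (x $ j))"
    by (rule continuous_on_compose2[OF assms[of j]]) simp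
qed

lemma tensor_sum_continuous: "tensor_sum f \<Longrightarrow> continuous_on S f"
  by (induction rule: tensor_sum.induct) (auto intro: continuous_on_tensor_continuous continuous_on_add)

lemma tensor_sum_dense:
  fixes f :: "real ^ 'd \<Rightarrow> real"
  assumes f: "continuous_on Omega f" and e: "e > 0"
  obtains g where "tensor_sum g" "\<And>x. x \<in> Omega \<Longrightarrow> \<bar>f x - g x\<bar> < e"
proof -
  interpret function_ring_on "Collect tensor_sum" "Omega :: (real ^ 'd) set"
  proof
    show "compact (Omega :: (real ^ 'd) set)" by (simp add: Omega_def)
    show "(\<lambda>_. c) \<in> Collect (tensor_sum :: (real ^ 'd \<Rightarrow> real) \<Rightarrow> bool)" for c
    proof -
      \<comment> \<open>Picks some coordinate of the nonempty index type; the constant is put into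
        that factor and 1 into all others.\<close>
      obtain i :: 'd where True by simp
      have "tensor ((\<lambda>_ _. 1)(i := \<lambda>_. c)) = (\<lambda>_ :: real ^ 'd. c)"
        by (rule ext, subst tensor_split[of _ _ i]) auto
      moreover have "tensor_sum (tensor ((\<lambda>_ _. 1)(i := \<lambda>_. c)))" by (rule tensor_sum_tensor) auto
      ultimately show ?thesis by simp
    qed
    show "\<exists>f\<in>Collect tensor_sum. f x \<noteq> f y" if xy: "x \<noteq> y" for x y :: "real ^ 'd"
    proof -
      obtain i where i: "x $ i \<noteq> y $ i" using xy by (auto simp: vec_eq_iff)
      have "tensor ((\<lambda>_ _. 1)(i := \<lambda>t. t)) z = z $ i" for z :: "real ^ 'd"
        by (subst tensor_split[of _ _ i]) auto
      moreover have "tensor_sum (tensor ((\<lambda>_ _. 1)(i := \<lambda>t. t)))" by (rule tensor_sum_tensor) auto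
      ultimately show ?thesis using i by (intro bexI[of _ "tensor ((\<lambda>_ _. 1)(i := \<lambda>t. t))"]) auto
    qed
  qed (auto intro: tensor_sum_continuous tensor_sum_add tensor_sum_mult)
  show thesis using Stone_Weierstrass_basic[OF f e] that by auto
qed

section \<open>The multivariate partial sum and its agreement with iterated projections\<close>

definition gser :: "real \<Rightarrow> nat \<Rightarrow> (real ^ 'd \<Rightarrow> real) \<Rightarrow> real ^ 'd \<Rightarrow> real" where
  "gser l N f x = (\<Sum>k\<in>Lambda_inf N. gegenbauer_coeff l f k * multi_gegenbauer l k x)"

lemma Lambda_inf_iff: "k \<in> Lambda_inf N \<longleftrightarrow> (\<forall>j. k $ j \<le> N)"
  by (auto simp: Lambda_inf_def)

lemma bij_betw_Lambda_inf: "bij_betw (\<lambda>h. \<chi> j. h j) (PiE UNIV (\<lambda>_. {..N})) (Lambda_inf N :: (nat ^ 'd) set)"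
  by (rule bij_betw_byWitness[where f' = "\<lambda>k. ($) k"]) (auto simp: Lambda_inf_iff PiE_UNIV_domain Pi_iff)

lemma finite_Lambda_inf: "finite (Lambda_inf N :: (nat ^ 'd) set)"
  using bij_betw_finite[OF bij_betw_Lambda_inf[where 'd = 'd, of N]] by (simp add: finite_PiE)

lemma coeff_weight_tensor:
  "multi_gegenbauer l k x * multi_gweight l x = tensor (\<lambda>j t. poly (gegenbauer l (k $ j)) t * gweight l t) x"
  by (simp add: multi_gegenbauer_def multi_gweight_def tensor_def prod.distrib)

lemma coeff_weight_integrable:
  assumes l: "l > 0"
  shows "set_integrable lborel Omega (\<lambda>x. multi_gegenbauer l k x * multi_gweight l x)"
  unfolding coeff_weight_tensor
  by (intro Omega_integral_tensor(1) gweight_times_integrable[OF l] continuous_intros)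

lemma coeff_integrable:
  fixes f :: "real ^ 'd \<Rightarrow> real"
  assumes l: "l > 0" and f: "continuous_on Omega f"
  shows "set_integrable lborel Omega (\<lambda>x. f x * multi_gegenbauer l k x * multi_gweight l x)"
proof -
  obtain M where M: "\<And>x. x \<in> Omega \<Longrightarrow> \<bar>f x\<bar> \<le> M" using bounded_Omega[OF f] by blast
  from set_integrable_bounded_mult[OF set_lebesgue_integral_Omega(1)[OF f] coeff_weight_integrable[OF l, of k] M]
  show ?thesis by (simp add: mult.assoc)
qed

lemma gegenbauer_coeff_diff:
  assumes "l > 0" "continuous_on Omega f" "continuous_on Omega g"
  shows "gegenbauer_coeff l (\<lambda>x. f x - g x) k = gegenbauer_coeff l f k - gegenbauer_coeff l g k"
  unfolding gegenbauer_coeff_def left_diff_distrib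
  by (subst set_integral_diff(2)[OF coeff_integrable coeff_integrable]) (use assms in \<open>auto simp: right_diff_distrib\<close>)

lemma gegenbauer_coeff_add:
  assumes "l > 0" "continuous_on Omega f" "continuous_on Omega g"
  shows "gegenbauer_coeff l (\<lambda>x. f x + g x) k = gegenbauer_coeff l f k + gegenbauer_coeff l g k"
  unfolding gegenbauer_coeff_def distrib_right
  by (subst set_integral_add(2)[OF coeff_integrable coeff_integrable]) (use assms in \<open>auto simp: distrib_left\<close>)

lemma gegenbauer_coeff_bound:
  fixes k :: "nat ^ 'd"
  assumes l: "l > 0"
  shows "\<exists>K\<ge>0. \<forall>f B. continuous_on Omega f \<longrightarrow> (\<forall>x\<in>Omega. \<bar>f x\<bar> \<le> B) \<longrightarrow> \<bar>gegenbauer_coeff l f k\<bar> \<le> K * B"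
proof -
  define Q where "Q = (\<lambda>x :: real ^ 'd. multi_gegenbauer l k x * multi_gweight l x)"
  define K where "K = \<bar>1 / multi_gnorm l k\<bar> * (LINT x:Omega|lborel. \<bar>Q x\<bar>)"
  have Q: "set_integrable lborel Omega Q" using coeff_weight_integrable[OF l, of k] by (simp add: Q_def)
  have I0: "(LINT x:Omega|lborel. \<bar>Q x\<bar>) \<ge> 0" unfolding set_lebesgue_integral_def by (rule integral_nonneg_AE) simp
  show ?thesis
  proof (intro exI[of _ K] conjI allI impI)
    show "K \<ge> 0" using I0 unfolding K_def by (intro mult_nonneg_nonneg) auto
    fix f :: "real ^ 'd \<Rightarrow> real" and B assume f: "continuous_on Omega f" and B: "\<forall>x\<in>Omega. \<bar>f x\<bar> \<le> B"
    have fi: "set_integrable lborel Omega (\<lambda>x. f x * Q x)" using coeff_integrable[OF l f, of k] by (simp add: Q_def mult.assoc)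
    have "\<bar>LINT x:Omega|lborel. f x * Q x\<bar> \<le> (LINT x:Omega|lborel. \<bar>f x * Q x\<bar>)"
      using set_integral_norm_bound[OF fi] by simp
    also have "\<dots> \<le> (LINT x:Omega|lborel. B * \<bar>Q x\<bar>)"
    proof (rule set_integral_mono)
      show "set_integrable lborel Omega (\<lambda>x. \<bar>f x * Q x\<bar>)" using set_integrable_abs[OF fi] .
      show "set_integrable lborel Omega (\<lambda>x. B * \<bar>Q x\<bar>)" using set_integrable_abs[OF Q] by simp
      show "\<And>x. x \<in> Omega \<Longrightarrow> \<bar>f x * Q x\<bar> \<le> B * \<bar>Q x\<bar>" using B by (simp add: abs_mult mult_right_mono)
    qed
    also have "\<dots> = B * (LINT x:Omega|lborel. \<bar>Q x\<bar>)" by simp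
    finally have *: "\<bar>LINT x:Omega|lborel. f x * Q x\<bar> \<le> B * (LINT x:Omega|lborel. \<bar>Q x\<bar>)" .
    have "\<bar>gegenbauer_coeff l f k\<bar> = \<bar>1 / multi_gnorm l k\<bar> * \<bar>LINT x:Omega|lborel. f x * Q x\<bar>"
      unfolding gegenbauer_coeff_def Q_def by (simp add: abs_mult mult.assoc)
    also have "\<dots> \<le> \<bar>1 / multi_gnorm l k\<bar> * (B * (LINT x:Omega|lborel. \<bar>Q x\<bar>))"
      by (intro mult_left_mono *) auto
    finally show "\<bar>gegenbauer_coeff l f k\<bar> \<le> K * B" by (simp add: K_def mult_ac)
  qed
qed

lemma gser_diff:
  assumes "l > 0" "continuous_on Omega f" "continuous_on Omega g"
  shows "gser l N (\<lambda>x. f x - g x) x = gser l N f x - gser l N g x"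
  unfolding gser_def gegenbauer_coeff_diff[OF assms] left_diff_distrib sum_subtractf ..

lemma gser_add:
  assumes "l > 0" "continuous_on Omega f" "continuous_on Omega g"
  shows "gser l N (\<lambda>x. f x + g x) x = gser l N f x + gser l N g x"
  unfolding gser_def gegenbauer_coeff_add[OF assms] distrib_right sum.distrib ..

text \<open>Continuity in the supremum norm for fixed N and x. The constant may grow with N without
  harm, since it only serves to pass to the limit in a density argument.\<close>

lemma gser_bound:
  fixes x :: "real ^ 'd"
  assumes l: "l > 0"
  shows "\<exists>K\<ge>0. \<forall>f B. continuous_on Omega f \<longrightarrow> (\<forall>x\<in>Omega. \<bar>f x\<bar> \<le> B) \<longrightarrow> \<bar>gser l N f x\<bar> \<le> K * B"
proof -
  have "\<forall>k :: nat ^ 'd. \<exists>K. K \<ge> 0 \<and> (\<forall>f B. continuous_on Omega f \<longrightarrow> (\<forall>x\<in>Omega. \<bar>f x\<bar> \<le> B) \<longrightarrow> \<bar>gegenbauer_coeff l f k\<bar> \<le> K * B)"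
    using gegenbauer_coeff_bound[OF l] by blast
  then obtain Kf where "\<forall>k :: nat ^ 'd. Kf k \<ge> 0 \<and> (\<forall>f B. continuous_on Omega f \<longrightarrow> (\<forall>x\<in>Omega. \<bar>f x\<bar> \<le> B) \<longrightarrow> \<bar>gegenbauer_coeff l f k\<bar> \<le> Kf k * B)"
    by (rule choice[THEN exE])
  then have K: "Kf k \<ge> 0" "continuous_on Omega f \<Longrightarrow> (\<And>x. x \<in> Omega \<Longrightarrow> \<bar>f x\<bar> \<le> B) \<Longrightarrow> \<bar>gegenbauer_coeff l f k\<bar> \<le> Kf k * B" for k f B by blast+
  show ?thesis
  proof (intro exI[of _ "\<Sum>k\<in>Lambda_inf N. Kf k * \<bar>multi_gegenbauer l k x\<bar>"] conjI allI impI)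
    show "(\<Sum>k\<in>Lambda_inf N. Kf k * \<bar>multi_gegenbauer l k x\<bar>) \<ge> 0" by (intro sum_nonneg mult_nonneg_nonneg K) auto
    fix f :: "real ^ 'd \<Rightarrow> real" and B assume f: "continuous_on Omega f" and B: "\<forall>x\<in>Omega. \<bar>f x\<bar> \<le> B"
    have "\<bar>gser l N f x\<bar> \<le> (\<Sum>k\<in>Lambda_inf N. \<bar>gegenbauer_coeff l f k * multi_gegenbauer l k x\<bar>)" unfolding gser_def by (rule sum_abs)
    also have "\<dots> \<le> (\<Sum>k\<in>Lambda_inf N. Kf k * B * \<bar>multi_gegenbauer l k x\<bar>)"
      unfolding abs_mult by (intro sum_mono mult_right_mono K(2)[OF f]) (use B in auto)
    finally show "\<bar>gser l N f x\<bar> \<le> (\<Sum>k\<in>Lambda_inf N. Kf k * \<bar>multi_gegenbauer l k x\<bar>) * B"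
      by (simp add: sum_distrib_left mult_ac)
  qed
qed

lemma gproj_tensor:
  "gproj l N i (tensor b) = tensor (b(i := \<lambda>t. gint l (\<lambda>s. gker l N t s * b i s)))"
proof
  fix x
  have "gproj l N i (tensor b) x = gint l (\<lambda>t. (\<Prod>j\<in>UNIV - {i}. b j (x $ j)) * (gker l N (x $ i) t * b i t))"
    unfolding gproj_def by (rule arg_cong[of _ _ "gint l"]) (auto simp: tensor_split[of _ _ i] vupd_nth fun_eq_iff intro!: prod.cong)
  also have "\<dots> = tensor (b(i := \<lambda>t. gint l (\<lambda>s. gker l N t s * b i s))) x"
    unfolding gint_cmult tensor_split[of _ _ i] by (auto intro!: prod.cong)
  finally show "gproj l N i (tensor b) x = tensor (b(i := \<lambda>t. gint l (\<lambda>s. gker l N t s * b i s))) x" .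
qed

lemma fold_gproj_tensor:
  "distinct is \<Longrightarrow> fold (gproj l N) is (tensor b) = tensor (\<lambda>j. if j \<in> set is then \<lambda>t. gint l (\<lambda>s. gker l N t s * b j s) else b j)"
proof (induction "is" arbitrary: b)
  case (Cons i "is")
  have "fold (gproj l N) (i # is) (tensor b) = fold (gproj l N) is (tensor (b(i := \<lambda>t. gint l (\<lambda>s. gker l N t s * b i s))))"
    by (simp add: gproj_tensor)
  also have "\<dots> = tensor (\<lambda>j. if j \<in> set (i # is) then \<lambda>t. gint l (\<lambda>s. gker l N t s * b j s) else b j)"
    using Cons by (subst Cons.IH) (auto intro!: arg_cong[of _ _ tensor])
  finally show ?case .
qed simp

text \<open>The coefficients of a product factor, and because the index set is a box, the sum over
  it is a product of one-variable sums. The factor of \<open>gegenbauer_eq_ngeg\<close> enters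
  squared in the norm and once each in the coefficient integral and the polynomial, so it
  cancels.\<close>

lemma gser_tensor:
  fixes b :: "'d::finite \<Rightarrow> real \<Rightarrow> real"
  assumes l: "l > 0" and b: "\<And>j. continuous_on UNIV (b j)"
  shows "gser l N (tensor b) x = tensor (\<lambda>j t. gint l (\<lambda>s. gker l N t s * b j s)) x"
proof -
  have bc: "continuous_on {-1..1} (b j)" for j using b continuous_on_subset by blast
  define w where "w = (\<lambda>j m. ng l m (x $ j) * gint l (\<lambda>s. ng l m s * b j s) / geta l m)"
  have term1: "gegenbauer_coeff l (tensor b) k * multi_gegenbauer l k x = (\<Prod>j\<in>UNIV. w j (k $ j))" for k
  proof -
    have "\<exists>c. c \<noteq> 0 \<and> gegenbauer l n = smult c (ngeg l n)" for n by (rule gegenbauer_eq_ngeg[OF l, of n]) blast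
    then obtain c where c: "\<And>n. c n \<noteq> 0" "\<And>n. gegenbauer l n = smult (c n) (ngeg l n)" by metis
    have gn: "gnorm l n = (c n)\<^sup>2 * geta l n" for n
      unfolding gnorm_def geta_def c(2) by (subst lebesgue_eq_gint[OF l]) (auto intro!: continuous_intros simp: power_mult_distrib gint_cmult)
    have "(LINT y:Omega|lborel. tensor b y * multi_gegenbauer l k y * multi_gweight l y) 
       = (LINT y:Omega|lborel. tensor (\<lambda>j t. (b j t * poly (gegenbauer l (k $ j)) t) * gweight l t) y)"
      by (simp add: tensor_def multi_gegenbauer_def multi_gweight_def prod.distrib)
    also have "\<dots> = (\<Prod>j\<in>UNIV. LINT t:{-1..1}|lborel. (b j t * poly (gegenbauer l (k $ j)) t) * gweight l t)"
      by (intro Omega_integral_tensor(2) gweight_times_integrable[OF l] continuous_on_mult bc continuous_on_poly continuous_on_id)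
    also have "\<dots> = (\<Prod>j\<in>UNIV. gint l (\<lambda>t. b j t * poly (gegenbauer l (k $ j)) t))"
      by (intro prod.cong refl lebesgue_eq_gint[OF l] continuous_on_mult bc continuous_on_poly continuous_on_id)
    also have "\<dots> = (\<Prod>j\<in>UNIV. c (k $ j) * gint l (\<lambda>s. ng l (k $ j) s * b j s))"
      unfolding c(2) gint_cmult[symmetric] by (simp add: mult_ac)
    finally have I: "(LINT y:Omega|lborel. tensor b y * multi_gegenbauer l k y * multi_gweight l y) = (\<Prod>j\<in>UNIV. c (k $ j) * gint l (\<lambda>s. ng l (k $ j) s * b j s))" .
    have "gegenbauer_coeff l (tensor b) k * multi_gegenbauer l k x = 
       (\<Prod>j\<in>UNIV. inverse ((c (k $ j))\<^sup>2 * geta l (k $ j)) * (c (k $ j) * gint l (\<lambda>s. ng l (k $ j) s * b j s)) * (c (k $ j) * ng l (k $ j) (x $ j)))"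
      unfolding gegenbauer_coeff_def I unfolding multi_gnorm_def gn multi_gegenbauer_def c(2)
      by (simp add: prod.distrib prod_inversef[symmetric] divide_inverse power2_eq_square)
    also have "\<dots> = (\<Prod>j\<in>UNIV. w j (k $ j))"
      unfolding w_def using c(1) by (intro prod.cong refl) (simp add: power2_eq_square field_simps)
    finally show ?thesis .
  qed
  have "gser l N (tensor b) x = (\<Sum>k\<in>Lambda_inf N. \<Prod>j\<in>UNIV. w j (k $ j))" by (simp add: gser_def term1)
  also have "\<dots> = (\<Sum>h\<in>PiE UNIV (\<lambda>_. {..N}). \<Prod>j\<in>UNIV. w j ((\<chi> j. h j) $ j))"
    by (rule sum.reindex_bij_betw[OF bij_betw_Lambda_inf, symmetric])
  also have "\<dots> = (\<Prod>j\<in>UNIV. \<Sum>m\<le>N. w j m)" by (simp add: prod_sum_PiE)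
  also have "\<dots> = tensor (\<lambda>j t. gint l (\<lambda>s. gker l N t s * b j s)) x"
    unfolding tensor_def w_def by (simp add: gint_gker[OF l bc])
  finally show ?thesis .
qed

lemma fold_gproj_bound:
  fixes x :: "real ^ 'd"
  assumes l: "l > 0" and N: "N \<ge> 1" and x: "x \<in> Omega"
  shows "\<exists>K\<ge>0. \<forall>f B. continuous_on Omega f \<longrightarrow> (\<forall>x\<in>Omega. \<bar>f x\<bar> \<le> B) \<longrightarrow> \<bar>fold (gproj l N) is f x\<bar> \<le> K * B"
proof -
  obtain C where C: "C > 0" "\<And>N x. N \<ge> 1 \<Longrightarrow> x \<in> {-1..1} \<Longrightarrow> gint l (\<lambda>t. \<bar>gker l N x t\<bar>) \<le> C * real N powr l"
    using lebesgue_constant[OF l] by blast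
  define L where "L = C * real N powr l"
  have L: "L \<ge> 0" using C by (simp add: L_def)
  have one: "\<bar>gproj l N i f x\<bar> \<le> L * B" if f: "continuous_on Omega f" and B: "\<And>x. x \<in> Omega \<Longrightarrow> \<bar>f x\<bar> \<le> B" and x: "x \<in> Omega" 
    for i f B and x :: "real ^ 'd"
  proof -
    have B0: "B \<ge> 0" using B[OF x] by linarith
    have "\<bar>gproj l N i f x\<bar> \<le> B * gint l (\<lambda>t. \<bar>gker l N (x $ i) t\<bar>)"
      unfolding gproj_def
      by (rule gint_mult_abs_le[OF l continuous_on_gker continuous_on_vupd_line[OF f x order_refl] B]) (rule vupd_Omega[OF x])
    also have "\<dots> \<le> B * L"
      unfolding L_def using x N B0 by (intro mult_left_mono C(2)) (auto simp: Omega_iff)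
    finally show ?thesis by (simp add: mult.commute)
  qed
  have fold: "\<bar>fold (gproj l N) is f x\<bar> \<le> L ^ length is * B" if "continuous_on Omega f" "\<And>x. x \<in> Omega \<Longrightarrow> \<bar>f x\<bar> \<le> B" for f B
    using that
  proof (induction "is" arbitrary: f B)
    case (Cons i "is")
    have "\<bar>fold (gproj l N) is (gproj l N i f) x\<bar> \<le> L ^ length is * (L * B)"
      by (intro Cons.IH continuous_on_gproj l Cons.prems one)
    then show ?case by (simp add: mult_ac)
  qed (use x in auto)
  show ?thesis by (intro exI[of _ "L ^ length is"] conjI allI impI) (use L fold in auto)
qed

text \<open>Both sides are additive in f and bounded in the supremum norm for fixed N and x, and
  they agree on the dense set of sums of products.\<close>

lemma gser_eq_fold_gproj:
  fixes f :: "real ^ 'd \<Rightarrow> real"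
  assumes l: "l > 0" and N: "N \<ge> 1" and f: "continuous_on Omega f" and x: "x \<in> Omega" and "is": "distinct is" "set is = UNIV"
  shows "gser l N f x = fold (gproj l N) is f x"
proof -
  have ts: "gser l N g x = fold (gproj l N) is g x" if "tensor_sum g" for g
    using that
  proof induction
    case (tensor_sum_tensor b)
    then show ?case using "is" by (simp add: gser_tensor[OF l] fold_gproj_tensor)
  next
    case (tensor_sum_add g h)
    have cg: "continuous_on Omega g" "continuous_on Omega h" "continuous_on Omega (\<lambda>x. g x + h x)"
      using tensor_sum_add by (auto intro: tensor_sum_continuous continuous_on_add)
    \<comment> \<open>Additivity of the iterated projections, extracted from the difference rule by
      writing g as (g + h) - h.\<close>
    have "fold (gproj l N) is (\<lambda>x. (g x + h x) - h x) x = fold (gproj l N) is (\<lambda>x. g x + h x) x - fold (gproj l N) is h x"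
      by (rule fold_gproj_diff[OF l cg(3,2) x])
    then show ?case using gser_add[OF l cg(1,2)] tensor_sum_add.IH by simp
  qed
  obtain K1 where K1: "K1 \<ge> 0" "\<forall>f B. continuous_on Omega f \<longrightarrow> (\<forall>x\<in>Omega. \<bar>f x\<bar> \<le> B) \<longrightarrow> \<bar>gser l N f x\<bar> \<le> K1 * B"
    using gser_bound[OF l, of N x] by blast
  obtain K2 where K2: "K2 \<ge> 0" "\<forall>f B. continuous_on Omega f \<longrightarrow> (\<forall>x\<in>Omega. \<bar>f x\<bar> \<le> B) \<longrightarrow> \<bar>fold (gproj l N) is f x\<bar> \<le> K2 * B"
    using fold_gproj_bound[OF l N x, of "is"] by blast
  define D where "D = \<bar>gser l N f x - fold (gproj l N) is f x\<bar>"
  have "D \<le> 0"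
  proof (rule field_le_epsilon)
    fix e :: real assume e: "e > 0"
    define \<eta> where "\<eta> = e / (K1 + K2 + 1)"
    have \<eta>: "\<eta> > 0" using e K1 K2 by (simp add: \<eta>_def)
    obtain g where g: "tensor_sum g" "\<And>x. x \<in> Omega \<Longrightarrow> \<bar>f x - g x\<bar> < \<eta>" using tensor_sum_dense[OF f \<eta>] by blast
    have cg: "continuous_on Omega g" "continuous_on Omega (\<lambda>x. f x - g x)"
      using g(1) f by (auto intro: tensor_sum_continuous continuous_on_diff)
    have le: "\<bar>f x - g x\<bar> \<le> \<eta>" if "x \<in> Omega" for x using g(2)[OF that] by simp
    have "gser l N f x - fold (gproj l N) is f x = gser l N (\<lambda>x. f x - g x) x - fold (gproj l N) is (\<lambda>x. f x - g x) x"
      unfolding gser_diff[OF l f cg(1)] fold_gproj_diff[OF l f cg(1) x] ts[OF g(1)] by simp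
    then have "D \<le> \<bar>gser l N (\<lambda>x. f x - g x) x\<bar> + \<bar>fold (gproj l N) is (\<lambda>x. f x - g x) x\<bar>"
      unfolding D_def by linarith
    also have "\<dots> \<le> K1 * \<eta> + K2 * \<eta>" by (intro add_mono K1(2)[rule_format] K2(2)[rule_format] cg(2) le x)
    also have "\<dots> \<le> (K1 + K2 + 1) * \<eta>" using \<eta> by (simp add: algebra_simps)
    also have "\<dots> = e" using K1 K2 by (simp add: \<eta>_def)
    finally show "D \<le> 0 + e" by simp
  qed
  then show ?thesis by (simp add: D_def)
qed

section \<open>The error estimate\<close>

lemma multi_derivative_0: "multi_derivative 0 \<phi> = \<phi>"
proof -
  define xs where "xs = (SOME is. \<forall>i. count_list is i = (0 :: nat ^ 'a) $ i)"
  have "\<forall>i. count_list xs i = (0 :: nat ^ 'a) $ i"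
    unfolding xs_def by (rule someI_ex[OF ex_count_list])
  then have "count_list xs i = 0" for i by simp
  then have "xs = []" by (cases xs) (metis count_list.simps(2) nat.distinct(1) add_is_0 one_neq_zero)+
  then show ?thesis unfolding multi_derivative_def xs_def[symmetric] by simp
qed

lemma has_distributional_derivative_self: "has_distributional_derivative f 0 f"
  by (simp add: has_distributional_derivative_def multi_derivative_0)

lemma H_space_mixed_family:
  fixes f :: "real ^ 'd \<Rightarrow> real" and m r :: "nat ^ 'd"
  assumes f: "f \<in> H_space m" and r: "\<And>j. r $ j < m $ j"
  obtains M F where "mixed_family UNIV r M F" "F 0 = f"
proof -
  have cf: "continuous_on Omega f" using f by (simp add: H_space_def)
  have "\<forall>n. \<exists>g. (\<forall>j. n $ j \<le> r $ j) \<longrightarrow> continuous_on Omega g \<and> has_distributional_derivative f n g"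
  proof (intro allI)
    fix n
    show "\<exists>g. (\<forall>j. n $ j \<le> r $ j) \<longrightarrow> continuous_on Omega g \<and> has_distributional_derivative f n g"
    proof (cases "\<forall>j. n $ j \<le> r $ j")
      case True
      then have "\<forall>j. n $ j < m $ j" using r le_less_trans by blast
      then show ?thesis using f unfolding H_space_def by blast
    qed blast
  qed
  then obtain F' where F': "\<And>n. (\<And>j. n $ j \<le> r $ j) \<Longrightarrow> continuous_on Omega (F' n) \<and> has_distributional_derivative f n (F' n)"
    by metis
  \<comment> \<open>The representative chosen for order 0 is replaced by f itself, so that
    \<open>F 0 = f\<close> holds as functions and not merely in the sense of distributions.\<close>
  define F where "F = F'(0 := f)"
  have F: "continuous_on Omega (F n)" "has_distributional_derivative f n (F n)" if "\<And>j. n $ j \<le> r $ j" for n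
    using F'[OF that] cf by (auto simp: F_def has_distributional_derivative_self)
  define I where "I = {n. \<forall>j. n $ j \<le> r $ j}"
  have finI: "finite I"
  proof (rule finite_subset)
    show "I \<subseteq> Lambda_inf (\<Sum>j\<in>UNIV. r $ j)"
      unfolding I_def Lambda_inf_iff subset_iff mem_Collect_eq by (meson UNIV_I finite le_trans member_le_sum zero_le)
  qed (rule finite_Lambda_inf)
  have "\<forall>n\<in>I. \<exists>M. M > 0 \<and> (\<forall>x\<in>Omega. \<bar>F n x\<bar> \<le> M)"
  proof
    fix n assume "n \<in> I"
    then have "continuous_on Omega (F n)" by (intro F(1)) (simp add: I_def)
    then obtain M where "M > 0" "\<And>x. x \<in> Omega \<Longrightarrow> \<bar>F n x\<bar> \<le> M" using bounded_Omega by blast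
    then show "\<exists>M. M > 0 \<and> (\<forall>x\<in>Omega. \<bar>F n x\<bar> \<le> M)" by auto
  qed
  from bchoice[OF this] obtain B where "\<forall>n\<in>I. B n > 0 \<and> (\<forall>x\<in>Omega. \<bar>F n x\<bar> \<le> B n)" ..
  then have B: "\<And>n. n \<in> I \<Longrightarrow> B n > 0" "\<And>n x. n \<in> I \<Longrightarrow> x \<in> Omega \<Longrightarrow> \<bar>F n x\<bar> \<le> B n" by blast+
  have "mixed_family UNIV r (\<Sum>n\<in>I. B n) F"
    unfolding mixed_family_def
  proof (intro allI impI conjI ballI)
    fix n assume "\<forall>j. n $ j \<le> (if j \<in> UNIV then r $ j else 0)"
    then have n: "\<And>j. n $ j \<le> r $ j" by simp
    then have nI: "n \<in> I" by (simp add: I_def)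
    show "continuous_on Omega (F n)" by (rule F(1)[OF n])
    show "\<bar>F n x\<bar> \<le> (\<Sum>n\<in>I. B n)" if "x \<in> Omega" for x
      using B(2)[OF nI that] member_le_sum[of n I B] nI finI B(1) by (auto simp: less_imp_le intro: order_trans)
    fix i and x :: "real ^ 'd" assume i: "n $ i < r $ i" and x: "x \<in> Omega"
    have n': "(n + axis i 1) $ j \<le> r $ j" for j using n[of j] i by (auto simp: axis_def)
    show "((\<lambda>s. F n (vupd x i s)) has_real_derivative F (n + axis i 1) x) (at (x $ i) within {-1..1})"
      by (rule weak_partial_imp_derivative[OF F(1)[OF n] F(1)[OF n'] F(2)[OF n] F(2)[OF n'] x])
  qed
  then show thesis by (rule that) (simp add: F_def)
qed

lemma gegenbauer_partial_sum_error:
  fixes f :: "real ^ 'd \<Rightarrow> real" and m :: "nat ^ 'd"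
  assumes l: "l > 0" and f: "f \<in> H_space m" and m: "\<And>j. real (m $ j) > l + 1"
  shows "\<exists>C N0. \<forall>N\<ge>N0. \<forall>x\<in>Omega. \<bar>f x - gser l N f x\<bar> \<le> C * real N powr - (MIN j. real (m $ j) - l - 1)"
proof -
  \<comment> \<open>The largest orders for which \<open>H_space\<close> provides continuous
    derivatives; m_j > l + 1 makes the truncated subtraction exact and gives r_j > l.\<close>
  define r :: "nat ^ 'd" where "r = (\<chi> j. m $ j - 1)"
  have m1: "m $ j \<ge> 1" for j using m[of j] l by (cases "m $ j") auto
  have r: "real (r $ j) = real (m $ j) - 1" for j using m1[of j] by (simp add: r_def)
  have rl: "real (r $ j) > l" for j using m[of j] by (simp add: r)
  have rm: "r $ j < m $ j" for j using m1[of j] by (simp add: r_def)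
  obtain M F where F: "mixed_family UNIV r M F" "F 0 = f" using H_space_mixed_family[OF f rm] by blast
  obtain "is" :: "'d list" where "is": "distinct is" "set is = UNIV" using finite_distinct_list[OF finite, of "UNIV :: 'd set"] by blast
  \<comment> \<open>Chosen so that l - \<rho> is the exponent of the claim; it is then the smallest
    of the r_j.\<close>
  define \<rho> where "\<rho> = (MIN j. real (m $ j) - l - 1) + l"
  have \<rho>: "\<rho> \<le> real (r $ j)" for j
  proof -
    have "(MIN j. real (m $ j) - l - 1) \<le> real (m $ j) - l - 1" by (rule Min_le) auto
    then show ?thesis unfolding \<rho>_def r by linarith
  qed
  obtain C N0 where C: "\<forall>N\<ge>N0. \<forall>F M. mixed_family (set is) r M F \<longrightarrow>
     (\<forall>x\<in>Omega. \<bar>F 0 x - fold (gproj l N) is (F 0) x\<bar> \<le> C * M * real N powr (l - \<rho>))"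
    using tensor_projection_error[OF l rl \<rho> "is"(1)] by blast
  have cf: "continuous_on Omega f" using f by (simp add: H_space_def)
  have "\<bar>f x - gser l N f x\<bar> \<le> (C * M) * real N powr - (MIN j. real (m $ j) - l - 1)"
    if N: "N \<ge> max 1 N0" and x: "x \<in> Omega" for N x
  proof -
    have "\<bar>F 0 x - fold (gproj l N) is (F 0) x\<bar> \<le> C * M * real N powr (l - \<rho>)"
      using C N F(1) x unfolding "is"(2) by simp
    moreover have "gser l N f x = fold (gproj l N) is f x"
      using N by (intro gser_eq_fold_gproj[OF l _ cf x "is"]) simp
    moreover have "l - \<rho> = - (MIN j. real (m $ j) - l - 1)" by (simp add: \<rho>_def)
    ultimately show ?thesis by (simp add: F(2))
  qed
  then show ?thesis by blast
qed

theorem theorem5p2: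
  fixes f :: "real ^ 'd \<Rightarrow> real" and lam :: real
  assumes "lam > 0"
  shows "\<exists>K::real. \<forall>m :: nat ^ 'd.
    (\<forall>j. real (m $ j) > lam + 1) \<and> f \<in> H_space m \<longrightarrow>
    (\<exists>N0::nat. \<forall>N\<ge>N0. \<forall>x\<in>Omega.
      \<bar>f x - (\<Sum>k\<in>Lambda_inf N. gegenbauer_coeff lam f k * multi_gegenbauer lam k x)\<bar>
        \<le> K * real N powr - (MIN j. real (m $ j) - lam - 1))"
proof -
  define adm where "adm = {m :: nat ^ 'd. (\<forall>j. real (m $ j) > lam + 1) \<and> f \<in> H_space m}"
  define \<mu> where "\<mu> = (\<lambda>m :: nat ^ 'd. MIN j. m $ j)"
  have \<mu>: "(MIN j. real (m $ j) - lam - 1) = real (\<mu> m) - lam - 1" for m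
  proof -
    have "mono (\<lambda>k::nat. real k - lam - 1)" by (auto simp: mono_def)
    from mono_Min_commute[OF this, of "range (($) m)"] show ?thesis by (simp add: \<mu>_def image_image)
  qed
  have err: "\<exists>C N0. \<forall>N\<ge>N0. \<forall>x\<in>Omega. \<bar>f x - gser lam N f x\<bar> \<le> C * real N powr - (real (\<mu> m) - lam - 1)" if "m \<in> adm" for m
    using gegenbauer_partial_sum_error[OF assms, of f m] that unfolding \<mu> adm_def by blast
  have "\<exists>K. \<forall>m\<in>adm. \<exists>N0. \<forall>N\<ge>N0. \<forall>x\<in>Omega. \<bar>f x - gser lam N f x\<bar> \<le> K * real N powr - (real (\<mu> m) - lam - 1)"
  proof (cases "\<exists>m\<in>adm. \<forall>m'\<in>adm. \<mu> m' \<le> \<mu> m")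
    case True
    then obtain m where m: "m \<in> adm" "\<And>m'. m' \<in> adm \<Longrightarrow> \<mu> m' \<le> \<mu> m" by blast
    obtain C N0 where C: "\<And>N x. N \<ge> N0 \<Longrightarrow> x \<in> Omega \<Longrightarrow> \<bar>f x - gser lam N f x\<bar> \<le> C * real N powr - (real (\<mu> m) - lam - 1)"
      using err[OF m(1)] by blast
    have "\<bar>f x - gser lam N f x\<bar> \<le> \<bar>C\<bar> * real N powr - (real (\<mu> m') - lam - 1)"
      if m': "m' \<in> adm" and N: "N \<ge> max 1 N0" and x: "x \<in> Omega" for m' N x
    proof -
      have "\<bar>f x - gser lam N f x\<bar> \<le> C * real N powr - (real (\<mu> m) - lam - 1)" using C N x by simp
      also have "\<dots> \<le> \<bar>C\<bar> * real N powr - (real (\<mu> m') - lam - 1)"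
        using N m(2)[OF m'] by (intro mult_mono powr_mono) auto
      finally show ?thesis .
    qed
    then show ?thesis by blast
  next
    \<comment> \<open>The case without a largest minimum; it also covers the situation that no m is
      admissible. Minima are integers, so a larger one exceeds the given one by at least 1, and N
      \<ge> |C| lets the gained factor 1/N absorb the constant.\<close>
    case False
    show ?thesis
    proof (rule exI[of _ 1], rule ballI)
      fix m assume m: "m \<in> adm"
      then obtain m' where m': "m' \<in> adm" "\<mu> m < \<mu> m'" using False by (meson not_le)
      obtain C N0 where C: "\<And>N x. N \<ge> N0 \<Longrightarrow> x \<in> Omega \<Longrightarrow> \<bar>f x - gser lam N f x\<bar> \<le> C * real N powr - (real (\<mu> m') - lam - 1)"
        using err[OF m'(1)] by blast
      have "\<bar>f x - gser lam N f x\<bar> \<le> 1 * real N powr - (real (\<mu> m) - lam - 1)"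
        if N: "N \<ge> max (max 1 N0) (nat \<lceil>\<bar>C\<bar>\<rceil>)" and x: "x \<in> Omega" for N x
      proof -
        have CN: "\<bar>C\<bar> \<le> real N" "real N \<ge> 1" using N by linarith+
        have "\<bar>f x - gser lam N f x\<bar> \<le> C * real N powr - (real (\<mu> m') - lam - 1)" using C N x by simp
        also have "\<dots> \<le> real N * real N powr (- (real (\<mu> m) - lam - 1) - 1)"
          using CN m'(2) by (intro mult_mono powr_mono) auto
        also have "\<dots> = 1 * real N powr - (real (\<mu> m) - lam - 1)" using CN by (simp add: powr_diff)
        finally show ?thesis .
      qed
      then show "\<exists>N0. \<forall>N\<ge>N0. \<forall>x\<in>Omega. \<bar>f x - gser lam N f x\<bar> \<le> 1 * real N powr - (real (\<mu> m) - lam - 1)" by blast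
    qed
  qed
  then show ?thesis unfolding adm_def gser_def \<mu>[symmetric] by auto
qed

end
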